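(* Let $a$, $f$, $J$ be the exact bilinear form, linear form and modified energy functional of linear elasticity, let $\mathcal T$ be a partition of $\Omega$, let $a_{\mathcal T}$, $f_{\mathcal T}$ be the discrete (quadrature) forms, $J_{\mathcal T}(\boldsymbol v)=\frac12a_{\mathcal T}(\boldsymbol v,\boldsymbol v)-f_{\mathcal T}(\boldsymbol v)$, and let $\mathcal M_N(l)$, $\mathcal M_{2N}(l)$ be the sets of neural network functions, all as given in the context. Assume that there exists a positive constant $\beta$ independent of $\mathcal M_N(l)$ such that $$\beta\,\|\boldsymbol v\|_a^2\le a_{\mathcal T}(\boldsymbol v,\boldsymbol v)\quad\text{for all }\boldsymbol v\in\mathcal M_N(l).$$ Let $\boldsymbol u\in H^1(\Omega)^d$ be the solution of $J(\boldsymbol u)=\min_{\boldsymbol v\in H^1(\Omega)^d}J(\boldsymbol v)$, and let $\boldsymbol u_{\mathcal T}\in\mathcal M_N(l)$ be a solution of $J_{\mathcal T}(\boldsymbol u_{\mathcal T})=\min_{\boldsymbol v\in\mathcal M_N(l)}J_{\mathcal T}(\boldsymbol v)$. Then $$\|\boldsymbol u-\boldsymbol u_{\mathcal T}\|_a\le\frac2\beta\sup_{\boldsymbol w\in\mathcal M_{2N}(l)}\frac{|f(\boldsymbol w)-f_{\mathcal T}(\boldsymbol w)|}{\|\boldsymbol w\|_a}+\frac{2+\beta}{\beta}\inf_{\boldsymbol v\in\mathcal M_N(l)}\left\{\|\boldsymbol u-\boldsymbol v\|_a+\sup_{\boldsymbol w\in\mathcal M_{2N}(l)}\frac{|a(\boldsymbol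 v,\boldsymbol w)-a_{\mathcal T}(\boldsymbol v,\boldsymbol w)|}{\|\boldsymbol w\|_a}\right\},$$ where $\|\boldsymbol v\|_a:=\sqrt{a(\boldsymbol v,\boldsymbol v)}$ is the energy norm.
   Context: Setting. $\Omega\subset\mathbb{R}^d$ is a bounded domain with Lipschitz boundary $\partial\Omega=\Gamma_D\cup\Gamma_N$, where $\Gamma_D$ and $\Gamma_N$ are disjoint; the quadrature forms below are written for $d=2$. $\mu,\lambda$ are the Lamé constants, $\gamma=\mu\gamma_D$ is a penalization constant, and $\boldsymbol f,\boldsymbol g_D,\boldsymbol g_N$ are given vector-valued functions on $\Omega,\Gamma_D,\Gamma_N$. Exact forms. $\boldsymbol\varepsilon(\boldsymbol v)=\frac12(\nabla\boldsymbol v+(\nabla\boldsymbol v)^T)$; $(\cdot,\cdot)$ and $(\cdot,\cdot)_{0,\Gamma_N}$ are $L^2$ inner products on $\Omega$ and $\Gamma_N$; $$\|\boldsymbol v\|_{1/2,\Gamma_D}=\left(\int_{\Gamma_D}|\boldsymbol v|^2\,dS+\int_{\Gamma_D}\int_{\Gamma_D}\frac{|\boldsymbol v(\boldsymbol x)-\boldsymbol v(\boldsymbol x')|^2}{d(\boldsymbol x,\boldsymbol x')^{d}}\,dS(\boldsymbol x)\,dS(\boldsymbol x')\right)^{1/2},$$ where $d(\boldsymbol x,\boldsymbol x')$ is the geodesic distance in $\Gamma_D$ and the exponent $d$ is the space dimension; $(\cdot,\cdot)_{1/2,\Gamma_D}$ is the associated inner product. Define $$a(\boldsymbol u,\boldsymbol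 v)=2\mu(\boldsymbol\varepsilon(\boldsymbol u),\boldsymbol\varepsilon(\boldsymbol v))+\lambda(\nabla\cdot\boldsymbol u,\nabla\cdot\boldsymbol v)+\gamma(\boldsymbol u,\boldsymbol v)_{1/2,\Gamma_D},$$ $$f(\boldsymbol v)=(\boldsymbol f,\boldsymbol v)+(\boldsymbol g_N,\boldsymbol v)_{0,\Gamma_N}+\gamma(\boldsymbol g_D,\boldsymbol v)_{1/2,\Gamma_D},$$ $$J(\boldsymbol v)=\frac12\left\{\int_\Omega\left(2\mu|\boldsymbol\varepsilon(\boldsymbol v)|^2+\lambda|\nabla\cdot\boldsymbol v|^2\right)d\boldsymbol x+\gamma\|\boldsymbol v-\boldsymbol g_D\|^2_{1/2,\Gamma_D}\right\}-(\boldsymbol f,\boldsymbol v)-(\boldsymbol g_N,\boldsymbol v)_{0,\Gamma_N}.$$ Networks. $\tau$ is a nonlinear activation function, acting componentwise, smooth enough (e.g. sigmoid) that the network functions below are $C^1$ on $\Omega$. With $l$ layers, hidden widths $n_1,\dots,n_{l-1}$ and $n_0=n_l=d$, let $N^{(j)}(\boldsymbol x^{(j-1)})=\tau(\boldsymbol\omega^{(j)}\boldsymbol x^{(j-1)}-\boldsymbol b^{(j)})$ for $\boldsymbol x^{(j-1)}\in\mathbb{R}^{n_{j-1}}$, $j=1,\dots,l-1$, and $$\mathcal M_N(l)=\left\{\boldsymbol\omega^{(l)}\left(N^{(l-1)}\circ\cdots\circ N^{(1)}(\boldsymbol x)\right)-\boldsymbol b^{(l)}:\ \boldsymbol\omega^{(j)}\in\mathbb{R}^{n_j\times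 n_{j-1}},\ \boldsymbol b^{(j)}\in\mathbb{R}^{n_j}\text{ for all }j\right\}\subset H^1(\Omega)^d.$$ $\mathcal M_{2N}(l)$ is the set defined in the same way with every hidden width $n_j$ replaced by $2n_j$, so that it contains all differences of two elements of $\mathcal M_N(l)$. Quadrature. $\mathcal T$ is a collection of pairwise disjoint open subdomains of $\Omega$ with $\bar\Omega=\bigcup_{T\in\mathcal T}\bar T$. For $S\in\{D,N\}$, $\mathcal E_S=\{\partial T\cap\Gamma_S:T\in\mathcal T\}$. $\Gamma_D$ is the union of disjoint pieces $\Gamma_D^1,\dots,\Gamma_D^I$, and $\mathcal E_D^k$ is the induced partition of $\Gamma_D^k$. $|T|$, $|E|$ are the measures of $T\in\mathcal T$ and of boundary elements $E$, and $\boldsymbol x_T$, $\boldsymbol x_E$ are their centroids. For points $\boldsymbol x,\boldsymbol x'\in\Gamma_D^k$, the divided difference $\boldsymbol v[\boldsymbol x;\boldsymbol x']$ has components $v_i[\boldsymbol x;\boldsymbol x']=\frac{v_i(\boldsymbol x)-v_i(\boldsymbol x')}{d(\boldsymbol x,\boldsymbol x')}$ if $\boldsymbol x'\ne\boldsymbol x$, and the derivative of $v_i$ along $\Gamma_D^k$ at $\boldsymbol x$ if $\boldsymbol x'=\boldsymbol x$. Then $$a_{\mathcal T}(\boldsymbol u,\boldsymbol v)=2\mu\sum_{T\in\mathcal T}(\boldsymbol\varepsilon(\boldsymbol u):\boldsymbol\varepsilon(\boldsymbol v))(\boldsymbol x_T)|T|+\lambda\sum_{T\in\mathcal T}(\nabla\cdot\boldsymbol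 u\,\nabla\cdot\boldsymbol v)(\boldsymbol x_T)|T|+\mu\gamma_D\left\{\sum_{E\in\mathcal E_D}(\boldsymbol u\cdot\boldsymbol v)(\boldsymbol x_E)|E|+\sum_{k=1}^I\sum_{E\in\mathcal E_D^k}\sum_{E'\in\mathcal E_D^k}\boldsymbol u[\boldsymbol x_E;\boldsymbol x_{E'}]\cdot\boldsymbol v[\boldsymbol x_E;\boldsymbol x_{E'}]\,|E||E'|\right\},$$ $$f_{\mathcal T}(\boldsymbol v)=\sum_{T\in\mathcal T}(\boldsymbol f\cdot\boldsymbol v)(\boldsymbol x_T)|T|+\sum_{E\in\mathcal E_N}(\boldsymbol g_N\cdot\boldsymbol v)(\boldsymbol x_E)|E|+\mu\gamma_D\left\{\sum_{E\in\mathcal E_D}(\boldsymbol g_D\cdot\boldsymbol v)(\boldsymbol x_E)|E|+\sum_{k=1}^I\sum_{E\in\mathcal E_D^k}\sum_{E'\in\mathcal E_D^k}\boldsymbol g_D[\boldsymbol x_E;\boldsymbol x_{E'}]\cdot\boldsymbol v[\boldsymbol x_E;\boldsymbol x_{E'}]\,|E||E'|\right\}.$$ *)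

theory Defs
  imports "HOL-Analysis.Analysis"
begin

section \<open>Lipschitz domains, surface measure and geodesic distance\<close>

definition lipschitz_domain :: "(real^2) set \<Rightarrow> bool" where
  "lipschitz_domain \<Omega> \<longleftrightarrow> open \<Omega> \<and> connected \<Omega> \<and> bounded \<Omega> \<and> \<Omega> \<noteq> {} \<and>
     (\<forall>x\<in>frontier \<Omega>. \<exists>r>0. \<exists>e n h L. norm e = 1 \<and> norm n = 1 \<and> e \<bullet> n = 0 \<and>
        L-lipschitz_on UNIV (h :: real \<Rightarrow> real) \<and>
        \<Omega> \<inter> ball x r = {y \<in> ball x r. y \<bullet> n > h (y \<bullet> e)})"

text \<open>The one-dimensional Hausdorff (outer) measure; on Borel sets it is a measure, so that
  the use of \<^const>\<open>measure_of\<close> below is not degenerate.  On the boundary of a planar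
  Lipschitz domain it is the surface (arc length) measure.\<close>

definition hausdorff1 :: "'a::metric_space set \<Rightarrow> ennreal" where
  "hausdorff1 A = (SUP \<delta>\<in>{0<..}.
     INF C\<in>{C :: nat \<Rightarrow> 'a set. A \<subseteq> (\<Union>i. C i) \<and> (\<forall>i. bounded (C i) \<and> diameter (C i) \<le> \<delta>)}.
       \<Sum>i. ennreal (diameter (C i)))"

definition surface :: "(real^2) set \<Rightarrow> (real^2) measure" where
  "surface \<Gamma> = completion (restrict_space (measure_of UNIV (sets borel) hausdorff1) \<Gamma>)"

definition curve_length :: "(real \<Rightarrow> 'a::metric_space) \<Rightarrow> ennreal" where
  "curve_length g = (SUP (k, t)\<in>{(k :: nat, t :: nat \<Rightarrow> real).
       (\<forall>i<k. t i \<le> t (Suc i)) \<and> t ` {..k} \<subseteq> {0..1}}.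
     \<Sum>i<k. ennreal (dist (g (t i)) (g (t (Suc i)))))"

text \<open>The value is \<open>\<infinity>\<close> for points that no path in \<open>\<Gamma>\<close> joins.\<close>

definition geodesic_dist :: "'a::metric_space set \<Rightarrow> 'a \<Rightarrow> 'a \<Rightarrow> ennreal" where
  "geodesic_dist \<Gamma> x y =
     (INF g\<in>{g. path g \<and> path_image g \<subseteq> \<Gamma> \<and> pathstart g = x \<and> pathfinish g = y}. curve_length g)"

text \<open>Quotients by \<open>gdist\<close> vanish at pairs of points at geodesic distance \<open>\<infinity>\<close>, since
  \<^const>\<open>enn2real\<close> maps \<open>\<infinity>\<close> to \<open>0\<close> and division by \<open>0\<close> gives \<open>0\<close>.
  So such pairs contribute nothing below, as they should.\<close>

definition gdist :: "'a::metric_space set \<Rightarrow> 'a \<Rightarrow> 'a \<Rightarrow> real" where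
  "gdist \<Gamma> x y = enn2real (geodesic_dist \<Gamma> x y)"


section \<open>The spaces\<close>

definition sq_integrable :: "'a measure \<Rightarrow> ('a \<Rightarrow> 'b::euclidean_space) \<Rightarrow> bool" where
  "sq_integrable M g \<longleftrightarrow> g \<in> borel_measurable M \<and> integrable M (\<lambda>x. (norm (g x))\<^sup>2)"

text \<open>Entry \<open>i\<close>, \<open>j\<close> of \<open>G\<close> is the weak partial derivative of component \<open>i\<close> in direction \<open>j\<close>,
  tested against compactly supported \<open>C\<^sup>1\<close> functions.\<close>

definition is_weak_grad ::
    "(real^2) set \<Rightarrow> (real^2 \<Rightarrow> real^2) \<Rightarrow> (real^2 \<Rightarrow> real^2^2) \<Rightarrow> bool" where
  "is_weak_grad \<Omega> v G \<longleftrightarrow>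
     (\<forall>\<phi> \<phi>'. (\<forall>x. GDERIV \<phi> x :> \<phi>' x) \<and> continuous_on UNIV \<phi>' \<and>
             (\<exists>K. compact K \<and> K \<subseteq> \<Omega> \<and> (\<forall>x. x \<notin> K \<longrightarrow> \<phi> x = 0)) \<longrightarrow>
        (\<forall>i j. (\<integral>x. v x $ i * \<phi>' x $ j \<partial>lebesgue_on \<Omega>) =
                - (\<integral>x. G x $ i $ j * \<phi> x \<partial>lebesgue_on \<Omega>)))"

definition H1 :: "(real^2) set \<Rightarrow> (real^2 \<Rightarrow> real^2) set" where
  "H1 \<Omega> = {v. sq_integrable (lebesgue_on \<Omega>) v \<and>
              (\<exists>G. sq_integrable (lebesgue_on \<Omega>) G \<and> is_weak_grad \<Omega> v G)}"

definition weak_grad :: "(real^2) set \<Rightarrow> (real^2 \<Rightarrow> real^2) \<Rightarrow> real^2 \<Rightarrow> real^2^2" where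
  "weak_grad \<Omega> v = (SOME G. sq_integrable (lebesgue_on \<Omega>) G \<and> is_weak_grad \<Omega> v G)"

text \<open>The boundary trace, as the limit of averages over \<open>ball x r \<inter> \<Omega>\<close>.  For a Sobolev
  function on a bounded Lipschitz domain this limit exists at almost every boundary point and
  agrees there with the continuous extension of the restriction map
  (Evans and Gariepy, Measure Theory and Fine Properties of Functions, Section 5.3).\<close>

definition has_trace_at ::
    "(real^2) set \<Rightarrow> (real^2 \<Rightarrow> real^2) \<Rightarrow> real^2 \<Rightarrow> real^2 \<Rightarrow> bool" where
  "has_trace_at \<Omega> v x z \<longleftrightarrow>
     ((\<lambda>r. (\<integral>\<^sup>+y\<in>ball x r \<inter> \<Omega>. ennreal (norm (v y - z)) \<partial>lebesgue) /
           emeasure lebesgue (ball x r \<inter> \<Omega>)) \<longlongrightarrow> 0) (at_right 0)"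

definition bdry_trace :: "(real^2) set \<Rightarrow> (real^2 \<Rightarrow> real^2) \<Rightarrow> real^2 \<Rightarrow> real^2" where
  "bdry_trace \<Omega> v x = (THE z. has_trace_at \<Omega> v x z)"

text \<open>The exponent of \<^const>\<open>gdist\<close> is the space dimension.\<close>

definition half_ip ::
    "(real^2) set \<Rightarrow> (real^2 \<Rightarrow> real^2) \<Rightarrow> (real^2 \<Rightarrow> real^2) \<Rightarrow> real" where
  "half_ip \<Gamma> g h = (\<integral>x. g x \<bullet> h x \<partial>surface \<Gamma>) +
     (\<integral>(x, x'). (g x - g x') \<bullet> (h x - h x') / (gdist \<Gamma> x x')^2 \<partial>(surface \<Gamma> \<Otimes>\<^sub>M surface \<Gamma>))"

definition half_norm :: "(real^2) set \<Rightarrow> (real^2 \<Rightarrow> real^2) \<Rightarrow> real" where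
  "half_norm \<Gamma> g = sqrt (half_ip \<Gamma> g g)"

definition H_half :: "(real^2) set \<Rightarrow> (real^2 \<Rightarrow> real^2) set" where
  "H_half \<Gamma> = {g. sq_integrable (surface \<Gamma>) g \<and>
     integrable (surface \<Gamma> \<Otimes>\<^sub>M surface \<Gamma>)
       (\<lambda>(x, x'). (norm (g x - g x'))\<^sup>2 / (gdist \<Gamma> x x')^2)}"


section \<open>The exact problem\<close>

definition strain :: "real^2^2 \<Rightarrow> real^2^2" where
  "strain G = (1/2) *\<^sub>R (G + transpose G)"

text \<open>The inner product of matrices is the Frobenius product, and the divergence is the
  trace of the gradient.\<close>

definition form_a ::
    "(real^2) set \<Rightarrow> (real^2) set \<Rightarrow> real \<Rightarrow> real \<Rightarrow> real \<Rightarrow>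
     (real^2 \<Rightarrow> real^2) \<Rightarrow> (real^2 \<Rightarrow> real^2) \<Rightarrow> real" where
  "form_a \<Omega> \<Gamma>\<^sub>D \<mu> lam \<gamma> u v =
     2 * \<mu> * (\<integral>x. strain (weak_grad \<Omega> u x) \<bullet> strain (weak_grad \<Omega> v x) \<partial>lebesgue_on \<Omega>) +
     lam * (\<integral>x. trace (weak_grad \<Omega> u x) * trace (weak_grad \<Omega> v x) \<partial>lebesgue_on \<Omega>) +
     \<gamma> * half_ip \<Gamma>\<^sub>D (bdry_trace \<Omega> u) (bdry_trace \<Omega> v)"

definition energy_norm ::
    "(real^2) set \<Rightarrow> (real^2) set \<Rightarrow> real \<Rightarrow> real \<Rightarrow> real \<Rightarrow> (real^2 \<Rightarrow> real^2) \<Rightarrow> real" where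
  "energy_norm \<Omega> \<Gamma>\<^sub>D \<mu> lam \<gamma> v = sqrt (form_a \<Omega> \<Gamma>\<^sub>D \<mu> lam \<gamma> v v)"

definition form_f ::
    "(real^2) set \<Rightarrow> (real^2) set \<Rightarrow> (real^2) set \<Rightarrow> real \<Rightarrow>
     (real^2 \<Rightarrow> real^2) \<Rightarrow> (real^2 \<Rightarrow> real^2) \<Rightarrow> (real^2 \<Rightarrow> real^2) \<Rightarrow>
     (real^2 \<Rightarrow> real^2) \<Rightarrow> real" where
  "form_f \<Omega> \<Gamma>\<^sub>D \<Gamma>\<^sub>N \<gamma> f g\<^sub>D g\<^sub>N v =
     (\<integral>x. f x \<bullet> v x \<partial>lebesgue_on \<Omega>) +
     (\<integral>x. g\<^sub>N x \<bullet> bdry_trace \<Omega> v x \<partial>surface \<Gamma>\<^sub>N) +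
     \<gamma> * half_ip \<Gamma>\<^sub>D g\<^sub>D (bdry_trace \<Omega> v)"

text \<open>The energy is \<open>\<infinity>\<close> if the boundary terms are undefined.  By the trace theorem this
  never happens for \<open>v \<in> H1 \<Omega>\<close> on a bounded Lipschitz domain.\<close>

definition energy_J ::
    "(real^2) set \<Rightarrow> (real^2) set \<Rightarrow> (real^2) set \<Rightarrow> real \<Rightarrow> real \<Rightarrow> real \<Rightarrow>
     (real^2 \<Rightarrow> real^2) \<Rightarrow> (real^2 \<Rightarrow> real^2) \<Rightarrow> (real^2 \<Rightarrow> real^2) \<Rightarrow>
     (real^2 \<Rightarrow> real^2) \<Rightarrow> ereal" where
  "energy_J \<Omega> \<Gamma>\<^sub>D \<Gamma>\<^sub>N \<mu> lam \<gamma> f g\<^sub>D g\<^sub>N v =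
     (if (AE x in surface (frontier \<Omega>). \<exists>z. has_trace_at \<Omega> v x z) \<and>
         sq_integrable (surface \<Gamma>\<^sub>N) (bdry_trace \<Omega> v) \<and> bdry_trace \<Omega> v \<in> H_half \<Gamma>\<^sub>D
      then ereal (
        1/2 * ((\<integral>x. 2 * \<mu> * (norm (strain (weak_grad \<Omega> v x)))\<^sup>2 +
                      lam * \<bar>trace (weak_grad \<Omega> v x)\<bar>\<^sup>2 \<partial>lebesgue_on \<Omega>) +
               \<gamma> * (half_norm \<Gamma>\<^sub>D (\<lambda>x. bdry_trace \<Omega> v x - g\<^sub>D x))\<^sup>2)
        - (\<integral>x. f x \<bullet> v x \<partial>lebesgue_on \<Omega>)
        - (\<integral>x. g\<^sub>N x \<bullet> bdry_trace \<Omega> v x \<partial>surface \<Gamma>\<^sub>N))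
      else \<infinity>)"


section \<open>Neural networks\<close>

text \<open>\<open>n j\<close> is the width of layer \<open>j\<close>; the units of a layer are numbered from \<open>1\<close>.
  \<open>layer \<tau> n \<omega> b x j\<close> is the output of the \<open>j\<close>-th layer; layer \<open>0\<close> is the input.\<close>

fun layer ::
    "(real \<Rightarrow> real) \<Rightarrow> (nat \<Rightarrow> nat) \<Rightarrow> (nat \<Rightarrow> nat \<Rightarrow> nat \<Rightarrow> real) \<Rightarrow> (nat \<Rightarrow> nat \<Rightarrow> real) \<Rightarrow>
     real^2 \<Rightarrow> nat \<Rightarrow> nat \<Rightarrow> real" where
  "layer \<tau> n \<omega> b x 0 i = x $ of_nat i"
| "layer \<tau> n \<omega> b x (Suc j) i =
     \<tau> ((\<Sum>k = 1..n j. \<omega> (Suc j) i k * layer \<tau> n \<omega> b x j k) - b (Suc j) i)"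

definition network ::
    "(real \<Rightarrow> real) \<Rightarrow> (nat \<Rightarrow> nat) \<Rightarrow> nat \<Rightarrow> (nat \<Rightarrow> nat \<Rightarrow> nat \<Rightarrow> real) \<Rightarrow>
     (nat \<Rightarrow> nat \<Rightarrow> real) \<Rightarrow> real^2 \<Rightarrow> real^2" where
  "network \<tau> n l \<omega> b x =
     (let out = (\<lambda>i. (\<Sum>k = 1..n (l - 1). \<omega> l i k * layer \<tau> n \<omega> b x (l - 1) k) - b l i)
      in vector [out 1, out 2])"

definition networks :: "(real \<Rightarrow> real) \<Rightarrow> (nat \<Rightarrow> nat) \<Rightarrow> nat \<Rightarrow> (real^2 \<Rightarrow> real^2) set" where
  "networks \<tau> n l = {network \<tau> n l \<omega> b |\<omega> b. True}"

definition double_hidden :: "nat \<Rightarrow> (nat \<Rightarrow> nat) \<Rightarrow> nat \<Rightarrow> nat" where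
  "double_hidden l n j = (if 0 < j \<and> j < l then 2 * n j else n j)"


section \<open>The quadrature forms\<close>

definition is_partition :: "(real^2) set \<Rightarrow> (real^2) set set \<Rightarrow> bool" where
  "is_partition \<Omega> \<T> \<longleftrightarrow> finite \<T> \<and> disjoint \<T> \<and>
     (\<forall>T\<in>\<T>. open T \<and> connected T \<and> T \<noteq> {} \<and> T \<subseteq> \<Omega>) \<and> closure \<Omega> = (\<Union>T\<in>\<T>. closure T)"

definition bdry_elems :: "(real^2) set set \<Rightarrow> (real^2) set \<Rightarrow> (real^2) set set" where
  "bdry_elems \<T> \<Gamma> = (\<lambda>T. frontier T \<inter> \<Gamma>) ` \<T>"

definition vol :: "(real^2) set \<Rightarrow> real" where
  "vol T = measure lebesgue T"

definition len :: "(real^2) set \<Rightarrow> real" where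
  "len E = measure (surface E) E"

definition cell_centroid :: "(real^2) set \<Rightarrow> real^2" where
  "cell_centroid T = (1 / vol T) *\<^sub>R (\<integral>x. x \<partial>lebesgue_on T)"

definition elem_centroid :: "(real^2) set \<Rightarrow> real^2" where
  "elem_centroid E = (1 / len E) *\<^sub>R (\<integral>x. x \<partial>surface E)"

text \<open>Differentiation along a curve is differentiation in arc length.  The orientation of the
  parametrization is immaterial, because the derivatives of two functions at the same point are
  only ever multiplied with each other.  At points where the curve has no tangent, the
  derivative is set to \<open>0\<close>.\<close>

definition arc_param :: "(real^2) set \<Rightarrow> real^2 \<Rightarrow> (real \<Rightarrow> real^2) \<Rightarrow> bool" where
  "arc_param \<Gamma> x c \<longleftrightarrow> c 0 = x \<and> c differentiable (at 0) \<and>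
     (\<exists>e>0. \<forall>s\<in>{-e<..<e}. c s \<in> \<Gamma> \<and>
        (\<forall>t\<in>{-e<..<e}. geodesic_dist \<Gamma> (c s) (c t) = ennreal \<bar>s - t\<bar>))"

definition deriv_along :: "(real^2) set \<Rightarrow> (real^2 \<Rightarrow> real^2) \<Rightarrow> real^2 \<Rightarrow> real^2" where
  "deriv_along \<Gamma> v x =
     (if \<exists>c. arc_param \<Gamma> x c
      then vector_derivative (\<lambda>s. v ((SOME c. arc_param \<Gamma> x c) s)) (at 0) else 0)"

definition divdiff ::
    "(real^2) set \<Rightarrow> (real^2) set \<Rightarrow> (real^2 \<Rightarrow> real^2) \<Rightarrow> real^2 \<Rightarrow> real^2 \<Rightarrow> real^2" where
  "divdiff \<Gamma>\<^sub>D \<Gamma> v x x' =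
     (if x' = x then deriv_along \<Gamma> v x else (1 / gdist \<Gamma>\<^sub>D x x') *\<^sub>R (v x - v x'))"

text \<open>\<open>P k\<close> for \<open>k = 1, \<dots>, K\<close> are the pieces of the Dirichlet boundary.\<close>

definition half_ip_quad ::
    "(real^2) set \<Rightarrow> (nat \<Rightarrow> (real^2) set) \<Rightarrow> nat \<Rightarrow> (real^2) set set \<Rightarrow>
     (real^2 \<Rightarrow> real^2) \<Rightarrow> (real^2 \<Rightarrow> real^2) \<Rightarrow> real" where
  "half_ip_quad \<Gamma>\<^sub>D P K \<T> u v =
     (\<Sum>E\<in>bdry_elems \<T> \<Gamma>\<^sub>D. (u (elem_centroid E) \<bullet> v (elem_centroid E)) * len E) +
     (\<Sum>k = 1..K. \<Sum>E\<in>bdry_elems \<T> (P k). \<Sum>E'\<in>bdry_elems \<T> (P k).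
        (divdiff \<Gamma>\<^sub>D (P k) u (elem_centroid E) (elem_centroid E') \<bullet>
         divdiff \<Gamma>\<^sub>D (P k) v (elem_centroid E) (elem_centroid E')) * len E * len E')"

definition form_aT ::
    "(real^2) set \<Rightarrow> (nat \<Rightarrow> (real^2) set) \<Rightarrow> nat \<Rightarrow> real \<Rightarrow> real \<Rightarrow> real \<Rightarrow> (real^2) set set \<Rightarrow>
     (real^2 \<Rightarrow> real^2) \<Rightarrow> (real^2 \<Rightarrow> real^2) \<Rightarrow> real" where
  "form_aT \<Gamma>\<^sub>D P K \<mu> lam \<gamma>\<^sub>D \<T> u v =
     2 * \<mu> * (\<Sum>T\<in>\<T>. (strain (matrix (frechet_derivative u (at (cell_centroid T)))) \<bullet>
                        strain (matrix (frechet_derivative v (at (cell_centroid T))))) * vol T) +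
     lam * (\<Sum>T\<in>\<T>. (trace (matrix (frechet_derivative u (at (cell_centroid T)))) *
                      trace (matrix (frechet_derivative v (at (cell_centroid T))))) * vol T) +
     \<mu> * \<gamma>\<^sub>D * half_ip_quad \<Gamma>\<^sub>D P K \<T> u v"

definition form_fT ::
    "(real^2) set \<Rightarrow> (real^2) set \<Rightarrow> (nat \<Rightarrow> (real^2) set) \<Rightarrow> nat \<Rightarrow> real \<Rightarrow> real \<Rightarrow> (real^2) set set \<Rightarrow>
     (real^2 \<Rightarrow> real^2) \<Rightarrow> (real^2 \<Rightarrow> real^2) \<Rightarrow> (real^2 \<Rightarrow> real^2) \<Rightarrow>
     (real^2 \<Rightarrow> real^2) \<Rightarrow> real" where
  "form_fT \<Gamma>\<^sub>D \<Gamma>\<^sub>N P K \<mu> \<gamma>\<^sub>D \<T> f g\<^sub>D g\<^sub>N v =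
     (\<Sum>T\<in>\<T>. (f (cell_centroid T) \<bullet> v (cell_centroid T)) * vol T) +
     (\<Sum>E\<in>bdry_elems \<T> \<Gamma>\<^sub>N. (g\<^sub>N (elem_centroid E) \<bullet> v (elem_centroid E)) * len E) +
     \<mu> * \<gamma>\<^sub>D * half_ip_quad \<Gamma>\<^sub>D P K \<T> g\<^sub>D v"

definition energy_JT ::
    "(real^2) set \<Rightarrow> (real^2) set \<Rightarrow> (nat \<Rightarrow> (real^2) set) \<Rightarrow> nat \<Rightarrow> real \<Rightarrow> real \<Rightarrow> real \<Rightarrow>
     (real^2) set set \<Rightarrow> (real^2 \<Rightarrow> real^2) \<Rightarrow> (real^2 \<Rightarrow> real^2) \<Rightarrow> (real^2 \<Rightarrow> real^2) \<Rightarrow>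
     (real^2 \<Rightarrow> real^2) \<Rightarrow> real" where
  "energy_JT \<Gamma>\<^sub>D \<Gamma>\<^sub>N P K \<mu> lam \<gamma>\<^sub>D \<T> f g\<^sub>D g\<^sub>N v =
     1/2 * form_aT \<Gamma>\<^sub>D P K \<mu> lam \<gamma>\<^sub>D \<T> v v - form_fT \<Gamma>\<^sub>D \<Gamma>\<^sub>N P K \<mu> \<gamma>\<^sub>D \<T> f g\<^sub>D g\<^sub>N v"

text \<open>The supremum of \<open>|F w| / N w\<close> over those \<open>w \<in> W\<close> for which the quotient is defined;
  it may be \<open>\<infinity>\<close>.\<close>

definition sup_quot :: "('a \<Rightarrow> real) \<Rightarrow> 'a set \<Rightarrow> ('a \<Rightarrow> real) \<Rightarrow> ennreal" where
  "sup_quot N W F = (SUP w\<in>{w\<in>W. N w \<noteq> 0}. ennreal (\<bar>F w\<bar> / N w))"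

end

(* The discrete minimizer u_T and any network v differ by a network w of doubled width, and
   comparing J_T(u_T) with J_T(v) gives a_T(w, w) / 2 <= f_T(w) - a_T(v, w).  The first variation of J
   at u says a(u, w) = f(w), so the right-hand side is (f_T - f)(w) + a(u - v, w) + (a - a_T)(v, w);
   coercivity and the Cauchy-Schwarz inequality for a bound ||w||_a, and the triangle inequality
   concludes.

   What needs work is that a is bilinear on a space containing u and the networks.  Weak gradients
   are unique almost everywhere, which is shown with test functions approximating indicators of open
   sets.  The quotients in the H^(1/2) product must be measurable: in the charts of a Lipschitz
   boundary a connected subset is an interval or the complement of one, hence geodesic balls are
   Borel, and every nonconstant path meets a fixed countable set D, so off the diagonal the geodesic
   distance from x to y is the infimum of d(x, z) + d(z, y) over z in D. *)

theory Submission
  imports Defs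
begin

section \<open>The surface measure\<close>

text \<open>A minimizer over \<open>M\<^sub>N\<close> satisfies no discrete variational equation,
  since networks of fixed width do not form a linear space; only the comparison of two values of
  \<open>J\<^sub>T\<close> is available. The half in the energy then leaves \<beta>/2 instead of
  \<beta>, whence the constant 2/\<beta>, and 1 + 2/\<beta> = (2 + \<beta>)/\<beta> after the
  triangle inequality. As a difference of networks is what gets estimated, the coercivity constant
  must also serve the doubled class. No trace theorem is invoked. The energy is infinite where
  boundary terms are undefined, so J(u) <= J(0) already puts u in the linear space of functions for
  which they make sense. There \<open>weak_grad\<close>, an arbitrary choice, and
  \<open>bdry_trace\<close> are linear only up to null sets, so linearity statements carry
  almost-everywhere clauses, and the completion of the surface measure keeps traces of combinations
  measurable. Nor is the Hausdorff set function ever shown to be a measure: upper bounds on it are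
  enough.\<close>

lemma space_surface [simp]: "space (surface \<Gamma>) = \<Gamma>"
  by (simp add: surface_def space_restrict_space)

lemma borel_measurable_surface:
  assumes "f \<in> borel_measurable borel" shows "f \<in> borel_measurable (surface \<Gamma>)"
  unfolding surface_def
  by (intro measurable_completion measurable_restrict_space1) (use assms in \<open>auto simp: measurable_def\<close>)

text \<open>\<open>measure_of\<close> yields either m or, if m is not countably additive, the zero
  measure. Upper bounds on the Hausdorff set function therefore pass to \<open>surface\<close> in
  both cases.\<close>

lemma emeasure_measure_of_le: "emeasure (measure_of \<Omega> A m) X \<le> m X"
  unfolding emeasure_measure_of_conv by auto

text \<open>Cutting the interval into n pieces of length h with L h <= \<delta> covers the image by
  sets of diameter at most L h; the diameters add up to at most L (b - a), whatever \<delta>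
  is.\<close>

lemma hausdorff1_Lipschitz_image:
  fixes p :: "real \<Rightarrow> 'a::real_normed_vector"
  assumes "L-lipschitz_on UNIV p" "a \<le> b"
  shows "hausdorff1 (p ` {a..b}) \<le> ennreal (L * (b - a))"
  unfolding hausdorff1_def
proof (rule SUP_least)
  fix \<delta> :: real assume "\<delta> \<in> {0<..}"
  then have "\<delta> > 0" by simp
  have L: "L \<ge> 0" using assms(1) by (simp add: lipschitz_on_def)
  obtain n :: nat where n: "L * (b - a) / \<delta> < real n" using reals_Archimedean2 by blast
  then have n0: "n > 0" using L assms(2) \<open>\<delta> > 0\<close>
    by (metis divide_nonneg_pos diff_ge_0_iff_ge mult_nonneg_nonneg gr0I linorder_not_less of_nat_0)
  define h where "h = (b - a) / n"
  have h0: "h \<ge> 0" using assms(2) by (simp add: h_def)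
  have Lh: "L * h \<le> \<delta>" using n n0 \<open>\<delta> > 0\<close> by (simp add: h_def field_simps)
  \<comment> \<open>The cover is indexed by all natural numbers; the empty sets from n on have
    diameter 0 and make the series finite.\<close>
  define C where "C i = (if i < n then p ` {a + i * h .. a + (i + 1) * h} else {})" for i :: nat
  have dC: "dist x y \<le> L * h" if "x \<in> C i" "y \<in> C i" for i x y
  proof -
    obtain s t where st: "x = p s" "y = p t" "s \<in> {a + i * h .. a + (i + 1) * h}" "t \<in> {a + i * h .. a + (i + 1) * h}"
      using \<open>x \<in> C i\<close> \<open>y \<in> C i\<close> by (auto simp: C_def split: if_splits)
    have "dist x y \<le> L * dist s t" using assms(1) st by (simp add: lipschitz_on_def)
    also have "dist s t \<le> h" using st by (auto simp: dist_real_def algebra_simps)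
    finally show ?thesis using L by (simp add: mult_left_mono)
  qed
  have diam: "diameter (C i) \<le> L * h" for i
    using dC h0 L by (intro diameter_le) (auto simp: dist_norm)
  have bd: "bounded (C i)" for i
    unfolding bounded_two_points using dC by blast
  have cov: "p ` {a..b} \<subseteq> (\<Union>i. C i)"
  proof (rule image_subsetI)
    fix s assume s: "s \<in> {a..b}"
    show "p s \<in> (\<Union>i. C i)"
    proof (cases "h = 0")
      case True
      then have "s = a" using s n0 by (simp add: h_def)
      then have "p s \<in> C 0" using True n0 by (auto simp: C_def)
      then show ?thesis by blast
    next
      case False
      with h0 have hp: "h > 0" by simp
      show ?thesis
      \<comment> \<open>At the right endpoint the floor formula would give the index n, outside the
        cover, so b is put into the last piece.\<close>
      proof (cases "s = b")
        case True
        have "b = a + n * h" using n0 by (simp add: h_def)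
        then have "p s \<in> C (n - 1)" using n0 True hp by (auto simp: C_def of_nat_diff algebra_simps)
        then show ?thesis by blast
      next
        case False
        define i where "i = nat \<lfloor>(s - a) / h\<rfloor>"
        have i: "real i \<le> (s - a) / h" "(s - a) / h < real i + 1"
          using s hp by (auto simp: i_def)
        have "(s - a) / h < n" using s False n0 hp by (simp add: h_def field_simps)
        then have "i < n" using i by linarith
        moreover have "s \<in> {a + i * h .. a + (i + 1) * h}" using i hp by (auto simp: field_simps)
        ultimately have "p s \<in> C i" by (auto simp: C_def)
        then show ?thesis by blast
      qed
    qed
  qed
  have "(\<Sum>i. ennreal (diameter (C i))) = (\<Sum>i<n. ennreal (diameter (C i)))"
    by (rule suminf_finite) (auto simp: C_def)
  also have "\<dots> \<le> (\<Sum>i<n. ennreal (L * h))" using diam by (intro sum_mono ennreal_leI) auto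
  also have "\<dots> = ennreal (L * (b - a))"
    using n0 L h0 by (simp add: h_def ennreal_of_nat_eq_real_of_nat flip: ennreal_mult' )
  finally have "(\<Sum>i. ennreal (diameter (C i))) \<le> ennreal (L * (b - a))" .
  moreover have "C \<in> {C. p ` {a..b} \<subseteq> (\<Union>i. C i) \<and> (\<forall>i. bounded (C i) \<and> diameter (C i) \<le> \<delta>)}"
    using cov bd order_trans[OF diam Lh] by auto
  ultimately show "(INF C\<in>{C :: nat \<Rightarrow> 'a set. p ` {a..b} \<subseteq> (\<Union>i. C i) \<and> (\<forall>i. bounded (C i) \<and> diameter (C i) \<le> \<delta>)}.
       \<Sum>i. ennreal (diameter (C i))) \<le> ennreal (L * (b - a))"
    by (rule INF_lower2[rotated])
qed

lemma AE_surface_subset: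
  assumes "A \<in> sets borel" "B \<in> sets borel" "A \<subseteq> B" "AE x in surface B. Q x"
  shows "AE x in surface A. Q x"
  using assms unfolding surface_def AE_completion_iff
  by (auto simp: AE_restrict_space_iff)

lemma finite_surface:
  assumes "\<Gamma> \<in> sets borel" "\<Gamma> \<subseteq> (\<Union>i\<in>I. (p i :: real \<Rightarrow> real^2) ` {a i..b i})" "finite I"
    "\<And>i. i \<in> I \<Longrightarrow> (L i)-lipschitz_on UNIV (p i) \<and> a i \<le> b i"
  shows "finite_measure (surface \<Gamma>)"
proof
  let ?M = "measure_of UNIV (sets borel) hausdorff1 :: (real^2) measure"
  have c: "p i ` {a i..b i} \<in> sets ?M" if "i \<in> I" for i
  proof -
    have "continuous_on UNIV (p i)" using assms(4)[OF that] by (auto intro: lipschitz_on_continuous_on)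
    then have "compact (p i ` {a i..b i})"
      by (intro compact_continuous_image) (auto intro: continuous_on_subset)
    then show ?thesis by (simp add: borel_compact)
  qed
  have r: "\<Gamma> \<in> sets (restrict_space ?M \<Gamma>)"
    using assms(1) by (auto simp: sets_restrict_space)
  have "emeasure (surface \<Gamma>) \<Gamma> = emeasure ?M \<Gamma>"
    unfolding surface_def using assms(1)
    by (simp add: emeasure_restrict_space r)
  also have "\<dots> \<le> emeasure ?M (\<Union>i\<in>I. p i ` {a i..b i})"
    using assms(2,3) c by (intro emeasure_mono sets.finite_UN) auto
  also have "\<dots> \<le> (\<Sum>i\<in>I. emeasure ?M (p i ` {a i..b i}))"
    using c assms(3) by (intro emeasure_subadditive_finite) auto
  also have "\<dots> \<le> (\<Sum>i\<in>I. ennreal (L i * (b i - a i)))"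
    using assms(4) by (intro sum_mono order_trans[OF emeasure_measure_of_le] hausdorff1_Lipschitz_image) auto
  also have "\<dots> < \<infinity>" using assms(3) by simp
  finally show "emeasure (surface \<Gamma>) (space (surface \<Gamma>)) \<noteq> \<infinity>" by simp
qed

section \<open>Square integrable functions and the fractional boundary product\<close>

lemma sq_integrable_inner:
  assumes "sq_integrable M f" "sq_integrable M g"
  shows "integrable M (\<lambda>x. f x \<bullet> g x)"
proof (rule Bochner_Integration.integrable_bound)
  show "integrable M (\<lambda>x. (norm (f x))\<^sup>2 + (norm (g x))\<^sup>2)"
    using assms by (auto simp: sq_integrable_def)
  show "(\<lambda>x. f x \<bullet> g x) \<in> borel_measurable M"
    using assms by (auto simp: sq_integrable_def)
  have "norm (f x \<bullet> g x) \<le> norm ((norm (f x))\<^sup>2 + (norm (g x))\<^sup>2)" for x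
  proof -
    have "norm (f x \<bullet> g x) \<le> norm (f x) * norm (g x)"
      by (simp add: Cauchy_Schwarz_ineq2)
    also have "\<dots> \<le> (norm (f x))\<^sup>2 + (norm (g x))\<^sup>2"
      using sum_squares_bound[of "norm (f x)" "norm (g x)"]
        mult_nonneg_nonneg[OF norm_ge_zero[of "f x"] norm_ge_zero[of "g x"]]
      by linarith
    finally show ?thesis by simp
  qed
  then show "AE x in M. norm (f x \<bullet> g x) \<le> norm ((norm (f x))\<^sup>2 + (norm (g x))\<^sup>2)" by simp
qed

lemma sq_integrable_lincomb:
  assumes "sq_integrable M f" "sq_integrable M g"
  shows "sq_integrable M (\<lambda>x. c *\<^sub>R f x + d *\<^sub>R g x)"
  unfolding sq_integrable_def
proof
  show "(\<lambda>x. c *\<^sub>R f x + d *\<^sub>R g x) \<in> borel_measurable M"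
    using assms by (auto simp: sq_integrable_def)
  have "(\<lambda>x. (norm (c *\<^sub>R f x + d *\<^sub>R g x))\<^sup>2) =
      (\<lambda>x. c\<^sup>2 * (f x \<bullet> f x) + 2 * c * d * (f x \<bullet> g x) + d\<^sup>2 * (g x \<bullet> g x))"
    by (auto simp: power2_norm_eq_inner inner_commute power2_eq_square[of c] power2_eq_square[of d] algebra_simps)
  then show "integrable M (\<lambda>x. (norm (c *\<^sub>R f x + d *\<^sub>R g x))\<^sup>2)"
    using assms by (auto intro!: Bochner_Integration.integrable_add sq_integrable_inner integrable_mult_right)
qed

lemma sq_integrable_AE_cong:
  assumes "sq_integrable M f" "g \<in> borel_measurable M" "AE x in M. f x = g x"
  shows "sq_integrable M g"
proof -
  have "integrable M (\<lambda>x. (norm (f x))\<^sup>2) \<longleftrightarrow> integrable M (\<lambda>x. (norm (g x))\<^sup>2)"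
    using assms by (intro integrable_cong_AE borel_measurable_power borel_measurable_norm) (auto simp: sq_integrable_def)
  with assms show ?thesis by (simp add: sq_integrable_def)
qed

lemma sq_integrable_linear:
  fixes T :: "'b::euclidean_space \<Rightarrow> 'c::euclidean_space"
  assumes "linear T" "sq_integrable M f"
  shows "sq_integrable M (\<lambda>x. T (f x))"
  unfolding sq_integrable_def
proof
  have bl: "bounded_linear T" using assms(1) by (simp add: linear_conv_bounded_linear)
  obtain B where B: "\<And>x. norm (T x) \<le> norm x * B" "B \<ge> 0"
    using bounded_linear.nonneg_bounded[OF bl] by blast
  show m: "(\<lambda>x. T (f x)) \<in> borel_measurable M"
    using assms bl by (auto simp: sq_integrable_def intro: borel_measurable_continuous_on linear_continuous_on)
  have "(norm (T (f x)))\<^sup>2 \<le> B\<^sup>2 * (norm (f x))\<^sup>2" for x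
    using power_mono[OF B(1)[of "f x"], of 2] by (simp add: power_mult_distrib mult.commute)
  then have *: "norm ((norm (T (f x)))\<^sup>2) \<le> norm (B\<^sup>2 * (norm (f x))\<^sup>2)" for x
    by (metis abs_ge_self abs_power2 order_trans real_norm_def)
  show "integrable M (\<lambda>x. (norm (T (f x)))\<^sup>2)"
  proof (rule Bochner_Integration.integrable_bound)
    show "integrable M (\<lambda>x. B\<^sup>2 * (norm (f x))\<^sup>2)"
      using assms(2) by (simp add: sq_integrable_def)
    show "(\<lambda>x. (norm (T (f x)))\<^sup>2) \<in> borel_measurable M"
      using m by measurable
  qed (rule AE_I2, rule *)
qed

lemma sq_integrable_bounded:
  assumes "finite_measure M" "f \<in> borel_measurable M" "\<And>x. x \<in> space M \<Longrightarrow> norm (f x) \<le> B"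
  shows "sq_integrable M f"
  unfolding sq_integrable_def
proof
  interpret finite_measure M by fact
  show "integrable M (\<lambda>x. (norm (f x))\<^sup>2)"
    using assms by (intro integrable_const_bound[of _ "B\<^sup>2"]) (auto intro!: power_mono AE_I2)
qed fact

lemma sq_integrable_imp_integrable:
  assumes "finite_measure M" "sq_integrable M f"
  shows "integrable M f"
proof -
  interpret finite_measure M by fact
  have "norm (f x) \<le> norm (1 + (norm (f x))\<^sup>2)" for x
    using sum_squares_bound[of 1 "norm (f x)"] norm_ge_zero[of "f x"] by (simp del: norm_ge_zero)
  note * = this
  show ?thesis
  proof (rule Bochner_Integration.integrable_bound)
    show "integrable M (\<lambda>x. 1 + (norm (f x))\<^sup>2)"
      using assms(2) by (simp add: sq_integrable_def)
    show "f \<in> borel_measurable M"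
      using assms(2) by (simp add: sq_integrable_def)
  qed (rule AE_I2, rule *)
qed

text \<open>k is a combination of f and g only almost everywhere, as the weak gradient or trace of a
  combination is; its measurability is thus a separate premise.\<close>

lemma inner_integral_lincomb:
  assumes "sq_integrable M f" "sq_integrable M g" "sq_integrable M h" "k \<in> borel_measurable M"
    and "AE x in M. k x = c *\<^sub>R f x + d *\<^sub>R g x"
  shows "(\<integral>x. h x \<bullet> k x \<partial>M) = c * (\<integral>x. h x \<bullet> f x \<partial>M) + d * (\<integral>x. h x \<bullet> g x \<partial>M)"
proof -
  have "(\<integral>x. h x \<bullet> k x \<partial>M) = (\<integral>x. c * (h x \<bullet> f x) + d * (h x \<bullet> g x) \<partial>M)"
    using assms by (intro integral_cong_AE) (auto simp: sq_integrable_def inner_add)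
  also have "\<dots> = c * (\<integral>x. h x \<bullet> f x \<partial>M) + d * (\<integral>x. h x \<bullet> g x \<partial>M)"
    using assms by (simp add: sq_integrable_inner)
  finally show ?thesis .
qed

text \<open>The Slobodeckij quotient, whose square carries \<open>gdist\<close> to the power 2, the
  space dimension. With it the second term of \<open>half_ip\<close> is an L2 product over pairs of
  points, so that L2 facts serve for both terms.\<close>

definition dquot :: "(real^2) set \<Rightarrow> (real^2 \<Rightarrow> real^2) \<Rightarrow> (real^2) \<times> (real^2) \<Rightarrow> real^2" where
  "dquot \<Gamma> g p = (1 / gdist \<Gamma> (fst p) (snd p)) *\<^sub>R (g (fst p) - g (snd p))"

lemma half_ip_dquot:
  "half_ip \<Gamma> g h = (\<integral>x. g x \<bullet> h x \<partial>surface \<Gamma>) +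
     (\<integral>p. dquot \<Gamma> g p \<bullet> dquot \<Gamma> h p \<partial>(surface \<Gamma> \<Otimes>\<^sub>M surface \<Gamma>))"
  unfolding half_ip_def dquot_def
  by (intro arg_cong2[where f="(+)"] Bochner_Integration.integral_cong) (auto simp: power2_eq_square)

lemma half_ip_commute: "half_ip \<Gamma> g h = half_ip \<Gamma> h g"
  by (simp add: half_ip_dquot inner_commute)

lemma half_ip_nonneg: "0 \<le> half_ip \<Gamma> g g"
  by (simp add: half_ip_dquot)

text \<open>The two facts about \<Gamma> that make \<open>half_ip\<close> bilinear on
  \<open>H_half\<close>. Without a jointly measurable distance the double integral could fall back
  to its default value 0, and linearity could fail.\<close>

locale measurable_gdist =
  fixes \<Gamma> :: "(real^2) set"
  assumes finite_surface: "finite_measure (surface \<Gamma>)"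
    and gdist_measurable:
      "(\<lambda>p. gdist \<Gamma> (fst p) (snd p)) \<in> borel_measurable (surface \<Gamma> \<Otimes>\<^sub>M surface \<Gamma>)"
begin

lemma dquot_measurable:
  assumes [measurable]: "g \<in> borel_measurable (surface \<Gamma>)"
  shows "dquot \<Gamma> g \<in> borel_measurable (surface \<Gamma> \<Otimes>\<^sub>M surface \<Gamma>)"
proof -
  note gdist_measurable [measurable]
  show ?thesis unfolding dquot_def[abs_def] by measurable
qed

lemma H_half_iff:
  "g \<in> H_half \<Gamma> \<longleftrightarrow> sq_integrable (surface \<Gamma>) g \<and>
     sq_integrable (surface \<Gamma> \<Otimes>\<^sub>M surface \<Gamma>) (dquot \<Gamma> g)"
proof -
  have "(\<lambda>(x, x'). (norm (g x - g x'))\<^sup>2 / (gdist \<Gamma> x x')^2) = (\<lambda>p. (norm (dquot \<Gamma> g p))\<^sup>2)"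
    by (auto simp: dquot_def power_mult_distrib power_divide)
  then show ?thesis
    unfolding H_half_def by (auto simp: sq_integrable_def intro: dquot_measurable)
qed

text \<open>A null set N of exceptions on \<Gamma> produces exceptional pairs only in N x \<Gamma>
  and \<Gamma> x N, both null for the product measure.\<close>

lemma AE_dquot_cong:
  assumes "AE x in surface \<Gamma>. g x = h x"
  shows "AE p in surface \<Gamma> \<Otimes>\<^sub>M surface \<Gamma>. dquot \<Gamma> g p = dquot \<Gamma> h p"
proof -
  interpret finite_measure "surface \<Gamma>" by (rule finite_surface)
  obtain N where N: "{x\<in>space (surface \<Gamma>). g x \<noteq> h x} \<subseteq> N" "N \<in> null_sets (surface \<Gamma>)"
    using assms unfolding eventually_ae_filter by blast
  have "N \<times> space (surface \<Gamma>) \<in> null_sets (surface \<Gamma> \<Otimes>\<^sub>M surface \<Gamma>)"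
    "space (surface \<Gamma>) \<times> N \<in> null_sets (surface \<Gamma> \<Otimes>\<^sub>M surface \<Gamma>)"
    using times_in_null_sets1[OF N(2) sets.top] times_in_null_sets2[OF sets.top N(2)] by blast+
  then have "N \<times> space (surface \<Gamma>) \<union> space (surface \<Gamma>) \<times> N \<in> null_sets (surface \<Gamma> \<Otimes>\<^sub>M surface \<Gamma>)"
    by (rule null_sets.Un)
  then have "AE p in surface \<Gamma> \<Otimes>\<^sub>M surface \<Gamma>. p \<notin> N \<times> space (surface \<Gamma>) \<union> space (surface \<Gamma>) \<times> N"
    by (rule AE_not_in)
  with AE_space show ?thesis
  proof eventually_elim
    case (elim p)
    then have "g (fst p) = h (fst p)" "g (snd p) = h (snd p)"
      using N(1) by (auto simp: space_pair_measure)
    then show ?case by (simp add: dquot_def)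
  qed
qed

lemma dquot_lincomb:
  "dquot \<Gamma> (\<lambda>x. c *\<^sub>R g x + d *\<^sub>R h x) = (\<lambda>p. c *\<^sub>R dquot \<Gamma> g p + d *\<^sub>R dquot \<Gamma> h p)"
  by (rule ext) (simp add: dquot_def algebra_simps)

lemma H_half_lincomb:
  assumes "g \<in> H_half \<Gamma>" "h \<in> H_half \<Gamma>" "k \<in> borel_measurable (surface \<Gamma>)"
    and "AE x in surface \<Gamma>. k x = c *\<^sub>R g x + d *\<^sub>R h x"
  shows "k \<in> H_half \<Gamma>"
proof -
  let ?l = "\<lambda>x. c *\<^sub>R g x + d *\<^sub>R h x"
  have "sq_integrable (surface \<Gamma>) ?l"
    "sq_integrable (surface \<Gamma> \<Otimes>\<^sub>M surface \<Gamma>) (dquot \<Gamma> ?l)"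
    using assms by (auto simp: H_half_iff dquot_lincomb intro!: sq_integrable_lincomb)
  moreover have "AE p in surface \<Gamma> \<Otimes>\<^sub>M surface \<Gamma>. dquot \<Gamma> ?l p = dquot \<Gamma> k p"
    using assms(4) by (intro AE_dquot_cong) (simp add: eq_commute)
  moreover have "AE x in surface \<Gamma>. ?l x = k x" using assms(4) by (simp add: eq_commute)
  ultimately show ?thesis
    unfolding H_half_iff
    using sq_integrable_AE_cong[OF _ assms(3)] sq_integrable_AE_cong[OF _ dquot_measurable[OF assms(3)]]
    by blast
qed

lemma half_ip_lincomb:
  assumes "g \<in> H_half \<Gamma>" "h \<in> H_half \<Gamma>" "w \<in> H_half \<Gamma>" "k \<in> borel_measurable (surface \<Gamma>)"
    and "AE x in surface \<Gamma>. k x = c *\<^sub>R g x + d *\<^sub>R h x"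
  shows "half_ip \<Gamma> w k = c * half_ip \<Gamma> w g + d * half_ip \<Gamma> w h"
proof -
  have "AE p in surface \<Gamma> \<Otimes>\<^sub>M surface \<Gamma>. dquot \<Gamma> k p = c *\<^sub>R dquot \<Gamma> g p + d *\<^sub>R dquot \<Gamma> h p"
    using AE_dquot_cong[OF assms(5)] by (simp add: dquot_lincomb)
  then have "(\<integral>p. dquot \<Gamma> w p \<bullet> dquot \<Gamma> k p \<partial>(surface \<Gamma> \<Otimes>\<^sub>M surface \<Gamma>)) =
      c * (\<integral>p. dquot \<Gamma> w p \<bullet> dquot \<Gamma> g p \<partial>(surface \<Gamma> \<Otimes>\<^sub>M surface \<Gamma>)) +
      d * (\<integral>p. dquot \<Gamma> w p \<bullet> dquot \<Gamma> h p \<partial>(surface \<Gamma> \<Otimes>\<^sub>M surface \<Gamma>))"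
    using assms(1-3) dquot_measurable[OF assms(4)] by (intro inner_integral_lincomb) (auto simp: H_half_iff)
  moreover have "(\<integral>x. w x \<bullet> k x \<partial>surface \<Gamma>) =
      c * (\<integral>x. w x \<bullet> g x \<partial>surface \<Gamma>) + d * (\<integral>x. w x \<bullet> h x \<partial>surface \<Gamma>)"
    using assms by (intro inner_integral_lincomb) (auto simp: H_half_iff)
  ultimately show ?thesis
    unfolding half_ip_dquot by (simp add: distrib_left)
qed

end

section \<open>Geodesic distance on the boundary\<close>

lemma ennreal_SUP_add_SUP_le:
  fixes f :: "'a \<Rightarrow> ennreal" and g :: "'b \<Rightarrow> ennreal"
  assumes "I \<noteq> {}" "J \<noteq> {}" "\<And>i j. i \<in> I \<Longrightarrow> j \<in> J \<Longrightarrow> f i + g j \<le> c"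
  shows "(SUP i\<in>I. f i) + (SUP j\<in>J. g j) \<le> c"
proof -
  have "(SUP i\<in>I. f i) + (SUP j\<in>J. g j) = (SUP j\<in>J. SUP i\<in>I. f i + g j)"
    by (simp only: ennreal_SUP_add_right[OF assms(2)] ennreal_SUP_add_left[OF assms(1)])
  also have "\<dots> \<le> c" using assms(3) by (intro SUP_least)
  finally show ?thesis .
qed

lemma ennreal_le_INF_add:
  fixes f :: "'a \<Rightarrow> ennreal"
  assumes "\<And>i. i \<in> I \<Longrightarrow> c \<le> b + f i"
  shows "c \<le> b + (INF i\<in>I. f i)"
proof (cases "b = top")
  case False
  then have "c - b \<le> (INF i\<in>I. f i)"
    using assms by (intro INF_greatest) (simp add: ennreal_minus_le_iff)
  then show ?thesis using False by (simp add: ennreal_minus_le_iff)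
qed simp

section \<open>Length of curves\<close>

lemma curve_length_upper:
  assumes "\<And>i. i < k \<Longrightarrow> t i \<le> t (Suc i)" "\<And>i. i \<le> k \<Longrightarrow> 0 \<le> t i \<and> t i \<le> 1"
  shows "(\<Sum>i<k. ennreal (dist (g (t i)) (g (t (Suc i))))) \<le> curve_length g"
proof -
  have "(k, t) \<in> {(k, t). (\<forall>i<k. t i \<le> t (Suc i)) \<and> t ` {..k} \<subseteq> {0..1}}" using assms by auto
  from SUP_upper[OF this, of "\<lambda>(k, t). \<Sum>i<k. ennreal (dist (g (t i)) (g (t (Suc i))))"]
  show ?thesis by (simp add: curve_length_def)
qed

lemma curve_length_least:
  assumes "\<And>k t. (\<And>i. i < k \<Longrightarrow> t i \<le> t (Suc i)) \<Longrightarrow> (\<And>i. i \<le> k \<Longrightarrow> 0 \<le> t i \<and> t i \<le> 1) \<Longrightarrow>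
    (\<Sum>i<k. ennreal (dist (g (t i)) (g (t (Suc i))))) \<le> c"
  shows "curve_length g \<le> c"
  unfolding curve_length_def
proof (rule SUP_least, clarify)
  fix k :: nat and t :: "nat \<Rightarrow> real" assume t: "\<forall>i<k. t i \<le> t (Suc i)" "t ` {..k} \<subseteq> {0..1}"
  then show "(\<Sum>i<k. ennreal (dist (g (t i)) (g (t (Suc i))))) \<le> c"
    by (intro assms) (auto simp: image_subset_iff)
qed

lemma dist_le_curve_length: "ennreal (dist (g 0) (g 1)) \<le> curve_length g"
  using curve_length_upper[of 1 "\<lambda>i. if i = 0 then 0 else 1" g] by simp

text \<open>A partition for each subpath, rescaled to [0, s] and [s, 1], concatenates to a partition
  of the whole curve; the bridging step between them can only add length.\<close>

lemma curve_length_subpaths: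
  assumes "0 \<le> s" "s \<le> 1"
  shows "curve_length (subpath 0 s g) + curve_length (subpath s 1 g) \<le> curve_length g"
proof -
  let ?K = "{(k :: nat, t :: nat \<Rightarrow> real). (\<forall>i<k. t i \<le> t (Suc i)) \<and> t ` {..k} \<subseteq> {0..1}}"
  let ?S = "\<lambda>g :: real \<Rightarrow> 'a. \<lambda>(k, t). \<Sum>i<k. ennreal (dist (g (t i)) (g (t (Suc i))))"
  have "(0, \<lambda>_. 0) \<in> ?K" by simp
  then have ne: "?K \<noteq> {}" by blast
  have "(SUP a\<in>?K. ?S (subpath 0 s g) a) + (SUP b\<in>?K. ?S (subpath s 1 g) b) \<le> curve_length g"
  proof (rule ennreal_SUP_add_SUP_le[OF ne ne], clarify)
    fix k1 k2 :: nat and t1 t2 :: "nat \<Rightarrow> real"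
    assume t1: "\<forall>i<k1. t1 i \<le> t1 (Suc i)" "t1 ` {..k1} \<subseteq> {0..1}"
      and t2: "\<forall>i<k2. t2 i \<le> t2 (Suc i)" "t2 ` {..k2} \<subseteq> {0..1}"
    \<comment> \<open>Index k1 ends the first partition and Suc k1 starts the second, so step k1 is
      the bridge from \<open>s * t1 k1\<close> to \<open>s + (1 - s) * t2 0\<close>, and there are
      Suc k1 + k2 steps in all.\<close>
    define t where "t i = (if i \<le> k1 then s * t1 i else s + (1 - s) * t2 (i - Suc k1))" for i
    have t1': "0 \<le> t1 i" "t1 i \<le> 1" if "i \<le> k1" for i using t1 that by (auto simp: image_subset_iff)
    have t2': "0 \<le> t2 i" "t2 i \<le> 1" if "i \<le> k2" for i using t2 that by (auto simp: image_subset_iff)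
    have split: "(\<Sum>i<m + k. F i) = (\<Sum>i<m. F i) + (\<Sum>i<k. F (m + i))" for m k and F :: "nat \<Rightarrow> ennreal"
      by (induction k) (auto simp: add.assoc)
    have "t i \<le> t (Suc i)" if i: "i < Suc k1 + k2" for i
    proof (rule linorder_cases[of i k1])
      assume "i = k1"
      moreover have "s * t1 k1 \<le> s" using t1'[of k1] assms by (simp add: mult_left_le)
      moreover have "0 \<le> (1 - s) * t2 0" using t2'[of 0] assms by simp
      ultimately show ?thesis by (simp add: t_def)
    next
      assume "i > k1"
      then have "t2 (i - Suc k1) \<le> t2 (i - k1)"
        using t2(1)[rule_format, of "i - Suc k1"] i by (simp add: Suc_diff_Suc)
      then show ?thesis using \<open>i > k1\<close> assms by (simp add: t_def mult_left_mono)
    qed (use t1 assms in \<open>auto simp: t_def mult_left_mono\<close>)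
    moreover have "0 \<le> t i \<and> t i \<le> 1" if i: "i \<le> Suc k1 + k2" for i
    proof (cases "i \<le> k1")
      case True
      then show ?thesis using t1'[of i] assms by (simp add: t_def mult_le_one)
    next
      case False
      then have "(1 - s) * t2 (i - Suc k1) \<le> 1 - s" "0 \<le> (1 - s) * t2 (i - Suc k1)"
        using t2'[of "i - Suc k1"] assms i by (auto simp: mult_left_le)
      then show ?thesis using False assms by (simp add: t_def)
    qed
    ultimately have total: "(\<Sum>i<Suc k1 + k2. ennreal (dist (g (t i)) (g (t (Suc i))))) \<le> curve_length g"
      by (rule curve_length_upper)
    have first: "(\<Sum>i<k1. ennreal (dist (subpath 0 s g (t1 i)) (subpath 0 s g (t1 (Suc i))))) =
        (\<Sum>i<k1. ennreal (dist (g (t i)) (g (t (Suc i)))))"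
      by (intro sum.cong) (auto simp: t_def subpath_def)
    have second: "(\<Sum>i<k2. ennreal (dist (subpath s 1 g (t2 i)) (subpath s 1 g (t2 (Suc i))))) =
        (\<Sum>i<k2. ennreal (dist (g (t (Suc k1 + i))) (g (t (Suc (Suc k1 + i))))))"
      by (intro sum.cong) (auto simp: t_def subpath_def add.commute)
    \<comment> \<open>Adding the bridging term makes the first sum match the split of the total at
      Suc k1.\<close>
    have "(\<Sum>i<k1. ennreal (dist (g (t i)) (g (t (Suc i))))) \<le>
        (\<Sum>i<Suc k1. ennreal (dist (g (t i)) (g (t (Suc i)))))"
      by simp
    from order_trans[OF add_right_mono[OF this] total[unfolded split]]
    show "(\<Sum>i<k1. ennreal (dist (subpath 0 s g (t1 i)) (subpath 0 s g (t1 (Suc i))))) +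
        (\<Sum>i<k2. ennreal (dist (subpath s 1 g (t2 i)) (subpath s 1 g (t2 (Suc i))))) \<le> curve_length g"
      unfolding first second .
  qed
  then show ?thesis by (simp add: curve_length_def)
qed

lemma curve_length_subpath_le:
  assumes "0 \<le> s" "s \<le> 1"
  shows "curve_length (subpath 0 s g) \<le> curve_length g" "curve_length (subpath s 1 g) \<le> curve_length g"
  using curve_length_subpaths[OF assms, of g]
  by (metis add.commute add_increasing2 zero_le order_trans le_iff_add)+

text \<open>Clamping the parameter to either half turns one partition of the join into a partition
  of each curve.\<close>

lemma curve_length_joinpaths:
  assumes "pathfinish g1 = pathstart g2"
  shows "curve_length (g1 +++ g2) \<le> curve_length g1 + curve_length g2"
proof (rule curve_length_least)
  fix k and t :: "nat \<Rightarrow> real"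
  assume t: "\<And>i. i < k \<Longrightarrow> t i \<le> t (Suc i)" "\<And>i. i \<le> k \<Longrightarrow> 0 \<le> t i \<and> t i \<le> 1"
  let ?l = "\<lambda>x :: real. 2 * min x (1/2)" and ?r = "\<lambda>x :: real. 2 * max x (1/2) - 1"
  have j: "(g1 +++ g2) x = (if x \<le> 1/2 then g1 (?l x) else g2 (?r x))" for x
    by (auto simp: joinpaths_def min_def max_def)
  have m: "g1 1 = g2 0" using assms by (simp add: pathfinish_def pathstart_def)
  have "dist ((g1 +++ g2) x) ((g1 +++ g2) y) \<le>
      dist (g1 (?l x)) (g1 (?l y)) + dist (g2 (?r x)) (g2 (?r y))" if "x \<le> y" for x y
  \<comment> \<open>Only a step that straddles 1/2 moves along both curves; there the triangle
    inequality passes through the junction point.\<close>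
  proof (cases "x \<le> 1/2 \<and> \<not> y \<le> 1/2")
    case True
    then show ?thesis using m dist_triangle[of "g1 (2 * x)" "g2 (2 * y - 1)" "g1 1"]
      by (simp add: joinpaths_def min_def max_def)
  next
    case False
    then show ?thesis using that by (auto simp: joinpaths_def min_def max_def)
  qed
  then have "(\<Sum>i<k. ennreal (dist ((g1 +++ g2) (t i)) ((g1 +++ g2) (t (Suc i))))) \<le>
     (\<Sum>i<k. ennreal (dist (g1 (?l (t i))) (g1 (?l (t (Suc i))))) +
             ennreal (dist (g2 (?r (t i))) (g2 (?r (t (Suc i))))))"
    using t(1) by (intro sum_mono) (simp flip: ennreal_plus)
  also have "\<dots> = (\<Sum>i<k. ennreal (dist (g1 (?l (t i))) (g1 (?l (t (Suc i)))))) +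
     (\<Sum>i<k. ennreal (dist (g2 (?r (t i))) (g2 (?r (t (Suc i))))))"
    by (rule sum.distrib)
  also have "\<dots> \<le> curve_length g1 + curve_length g2"
  proof (intro add_mono curve_length_upper)
    fix i assume "i < k"
    then have "t i \<le> t (Suc i)" by (rule t)
    then show "?l (t i) \<le> ?l (t (Suc i))" "?r (t i) \<le> ?r (t (Suc i))" by auto
  next
    fix i assume "i \<le> k"
    then have "0 \<le> t i \<and> t i \<le> 1" by (rule t)
    then show "0 \<le> ?l (t i) \<and> ?l (t i) \<le> 1" "0 \<le> ?r (t i) \<and> ?r (t i) \<le> 1" by auto
  qed
  finally show "(\<Sum>i<k. ennreal (dist ((g1 +++ g2) (t i)) ((g1 +++ g2) (t (Suc i))))) \<le>
    curve_length g1 + curve_length g2" .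
qed

section \<open>Geodesic distance: triangle inequality and balls\<close>

definition paths_from_to :: "'a::real_normed_vector set \<Rightarrow> 'a \<Rightarrow> 'a \<Rightarrow> (real \<Rightarrow> 'a) set" where
  "paths_from_to \<Gamma> x y = {g. path g \<and> path_image g \<subseteq> \<Gamma> \<and> pathstart g = x \<and> pathfinish g = y}"

lemma geodesic_dist_less_iff:
  fixes x :: "'a::real_normed_vector"
  shows "geodesic_dist \<Gamma> x y < c \<longleftrightarrow> (\<exists>g\<in>paths_from_to \<Gamma> x y. curve_length g < c)"
  by (simp add: geodesic_dist_def paths_from_to_def INF_less_iff)

lemma geodesic_dist_le:
  fixes x :: "'a::real_normed_vector"
  shows "g \<in> paths_from_to \<Gamma> x y \<Longrightarrow> geodesic_dist \<Gamma> x y \<le> curve_length g"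
  unfolding geodesic_dist_def paths_from_to_def by (rule INF_lower)

lemma subpaths_from_to:
  assumes "g \<in> paths_from_to \<Gamma> x y" "0 \<le> s" "s \<le> 1"
  shows "subpath 0 s g \<in> paths_from_to \<Gamma> x (g s)" "subpath s 1 g \<in> paths_from_to \<Gamma> (g s) y"
proof -
  have "path_image (subpath 0 s g) \<subseteq> path_image g" "path_image (subpath s 1 g) \<subseteq> path_image g"
    using assms by (intro path_image_subpath_subset; simp add: paths_from_to_def)+
  then show "subpath 0 s g \<in> paths_from_to \<Gamma> x (g s)" "subpath s 1 g \<in> paths_from_to \<Gamma> (g s) y"
    using assms unfolding paths_from_to_def
    by (simp_all add: order_trans[of _ "path_image g"]) (simp_all add: pathstart_def pathfinish_def)
qed

lemma geodesic_dist_triangle: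
  fixes x :: "'a::real_normed_vector"
  shows "geodesic_dist \<Gamma> x y \<le> geodesic_dist \<Gamma> x z + geodesic_dist \<Gamma> z y"
proof -
  have "geodesic_dist \<Gamma> x y \<le> curve_length g + curve_length h"
    if gh: "g \<in> paths_from_to \<Gamma> x z" "h \<in> paths_from_to \<Gamma> z y" for g h
  proof -
    have "g +++ h \<in> paths_from_to \<Gamma> x y"
      using gh by (auto simp: paths_from_to_def path_image_join)
    then have "geodesic_dist \<Gamma> x y \<le> curve_length (g +++ h)" by (rule geodesic_dist_le)
    also have "\<dots> \<le> curve_length g + curve_length h"
      using gh by (intro curve_length_joinpaths) (auto simp: paths_from_to_def)
    finally show ?thesis .
  qed
  then have "geodesic_dist \<Gamma> x y \<le> curve_length g + geodesic_dist \<Gamma> z y"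
    if "g \<in> paths_from_to \<Gamma> x z" for g
    unfolding geodesic_dist_def[of \<Gamma> z] paths_from_to_def[symmetric]
    using that by (intro ennreal_le_INF_add)
  then have "geodesic_dist \<Gamma> x y \<le> geodesic_dist \<Gamma> z y + geodesic_dist \<Gamma> x z"
    unfolding geodesic_dist_def[of \<Gamma> x z] paths_from_to_def[symmetric]
    by (intro ennreal_le_INF_add) (simp add: add.commute)
  then show ?thesis by (simp add: add.commute)
qed

lemma dist_le_geodesic_dist:
  fixes x :: "'a::real_normed_vector"
  shows "ennreal (dist x y) \<le> geodesic_dist \<Gamma> x y"
  unfolding geodesic_dist_def
  by (rule INF_greatest) (auto simp: pathstart_def pathfinish_def dist_le_curve_length)

lemma geodesic_dist_refl:
  fixes x :: "'a::real_normed_vector"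
  assumes "x \<in> \<Gamma>" shows "geodesic_dist \<Gamma> x x = 0"
proof -
  have "curve_length (\<lambda>_. x) \<le> 0" by (rule curve_length_least) simp
  moreover have "(\<lambda>_. x) \<in> paths_from_to \<Gamma> x x"
    using assms by (auto simp: paths_from_to_def path_def path_image_def pathstart_def pathfinish_def)
  ultimately show ?thesis using geodesic_dist_le[of "\<lambda>_. x" \<Gamma> x x] by simp
qed

text \<open>Every initial piece of a short path is short, so the ball around z is the union of the
  images of all short paths starting at z, and these images share z. For the second set, paths
  ending at z and their final pieces do the same.\<close>

lemma connected_geodesic_balls:
  fixes z :: "'a::real_normed_vector"
  shows "connected {y. geodesic_dist \<Gamma> z y < c}" "connected {x. geodesic_dist \<Gamma> x z < c}"
proof -
  let ?P = "{g. path g \<and> path_image g \<subseteq> \<Gamma> \<and> pathstart g = z \<and> curve_length g < c}"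
  have "{y. geodesic_dist \<Gamma> z y < c} = \<Union> (path_image ` ?P)"
  proof (safe)
    fix y assume "geodesic_dist \<Gamma> z y < c"
    then obtain g where "g \<in> ?P" "y = pathfinish g"
      unfolding geodesic_dist_less_iff paths_from_to_def by auto
    then show "y \<in> \<Union> (path_image ` ?P)" by blast
  next
    fix y g assume g: "path g" "path_image g \<subseteq> \<Gamma>" "z = pathstart g" "curve_length g < c" "y \<in> path_image g"
    then obtain s where s: "0 \<le> s" "s \<le> 1" "y = g s" by (auto simp: path_image_def)
    have "g \<in> paths_from_to \<Gamma> z (pathfinish g)" using g by (simp add: paths_from_to_def)
    from subpaths_from_to(1)[OF this s(1,2)] show "geodesic_dist \<Gamma> (pathstart g) y < c"
      unfolding geodesic_dist_less_iff using curve_length_subpath_le(1)[OF s(1,2), of g] g s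
      by (auto intro: le_less_trans)
  qed
  moreover have "connected (\<Union> (path_image ` ?P))"
  proof (cases "?P = {}")
    case False
    then have "z \<in> \<Inter> (path_image ` ?P)" by (force simp: pathstart_def path_image_def)
    then show ?thesis
    proof (intro connected_Union)
      show "\<Inter> (path_image ` ?P) \<noteq> {}"
        using \<open>z \<in> \<Inter> (path_image ` ?P)\<close> by blast
    qed (auto intro: connected_path_image)
  qed (simp only: image_empty Union_empty connected_empty)
  ultimately show "connected {y. geodesic_dist \<Gamma> z y < c}" by simp
  let ?Q = "{g. path g \<and> path_image g \<subseteq> \<Gamma> \<and> pathfinish g = z \<and> curve_length g < c}"
  have "{x. geodesic_dist \<Gamma> x z < c} = \<Union> (path_image ` ?Q)"
  proof (safe)
    fix y assume "geodesic_dist \<Gamma> y z < c"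
    then obtain g where "g \<in> ?Q" "y = pathstart g"
      unfolding geodesic_dist_less_iff paths_from_to_def by auto
    then show "y \<in> \<Union> (path_image ` ?Q)" by blast
  next
    fix y g assume g: "path g" "path_image g \<subseteq> \<Gamma>" "z = pathfinish g" "curve_length g < c" "y \<in> path_image g"
    then obtain s where s: "0 \<le> s" "s \<le> 1" "y = g s" by (auto simp: path_image_def)
    have "g \<in> paths_from_to \<Gamma> (pathstart g) z" using g by (simp add: paths_from_to_def)
    from subpaths_from_to(2)[OF this s(1,2)] show "geodesic_dist \<Gamma> y (pathfinish g) < c"
      unfolding geodesic_dist_less_iff using curve_length_subpath_le(2)[OF s(1,2), of g] g s
      by (auto intro: le_less_trans)
  qed
  moreover have "connected (\<Union> (path_image ` ?Q))"
  proof (cases "?Q = {}")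
    case False
    then have "z \<in> \<Inter> (path_image ` ?Q)" by (force simp: pathfinish_def path_image_def)
    then show ?thesis
    proof (intro connected_Union)
      show "\<Inter> (path_image ` ?Q) \<noteq> {}"
        using \<open>z \<in> \<Inter> (path_image ` ?Q)\<close> by blast
    qed (auto intro: connected_path_image)
  qed (simp only: image_empty Union_empty connected_empty)
  ultimately show "connected {x. geodesic_dist \<Gamma> x z < c}" by simp
qed

text \<open>An arc in V with coordinate \<pi> and parametrization p over (\<alpha>, \<omega>). The
  part of B in V must lie on the arc but need not fill it; this is enough to compare connected
  subsets of B with intervals.\<close>

definition arc_chart ::
    "'a::real_normed_vector set \<Rightarrow> 'a set \<Rightarrow> ('a \<Rightarrow> real) \<Rightarrow> (real \<Rightarrow> 'a) \<Rightarrow> real \<Rightarrow> real \<Rightarrow> bool" where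
  "arc_chart B V \<pi> p \<alpha> \<omega> \<longleftrightarrow> open V \<and> continuous_on UNIV \<pi> \<and> continuous_on UNIV p \<and>
     (\<forall>y\<in>B \<inter> V. \<alpha> < \<pi> y \<and> \<pi> y < \<omega> \<and> p (\<pi> y) = y) \<and>
     (\<forall>s. \<alpha> < s \<and> s < \<omega> \<longrightarrow> p s \<in> V \<and> \<pi> (p s) = s)"

text \<open>The part of A on the closed arc is relatively closed, as the arc is compact, and
  relatively open, as A misses both ends and so meets the arc only over the open parameter interval.
  Connectedness leaves none or all of A.\<close>

lemma arc_chart_connected_cases:
  assumes "arc_chart B V \<pi> p \<alpha> \<omega>" "connected A" "A \<subseteq> B" "\<alpha> < q1" "q2 < \<omega>" "p q1 \<notin> A" "p q2 \<notin> A"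
  shows "A \<inter> p ` {q1..q2} = {} \<or> A \<subseteq> p ` {q1..q2}"
proof -
  have eq: "A \<inter> p ` {q1..q2} = A \<inter> (V \<inter> \<pi> -` {q1<..<q2})"
  proof (intro equalityI subsetI)
    fix y assume "y \<in> A \<inter> p ` {q1..q2}"
    then obtain s where s: "y \<in> A" "y = p s" "q1 \<le> s" "s \<le> q2" by auto
    then have "q1 \<noteq> s" "s \<noteq> q2" using assms(6,7) by auto
    then show "y \<in> A \<inter> (V \<inter> \<pi> -` {q1<..<q2})"
      using s assms(1,4,5) by (auto simp: arc_chart_def)
  next
    fix y assume "y \<in> A \<inter> (V \<inter> \<pi> -` {q1<..<q2})"
    moreover from this have "y = p (\<pi> y)" using assms(1,3) by (auto simp: arc_chart_def)
    ultimately show "y \<in> A \<inter> p ` {q1..q2}" by auto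
  qed
  have "openin (top_of_set A) (A \<inter> p ` {q1..q2})"
    unfolding eq using assms(1) by (auto simp: arc_chart_def intro!: openin_open_Int open_Int open_vimage)
  moreover have "compact (p ` {q1..q2})"
    using assms(1) by (auto simp: arc_chart_def intro!: compact_continuous_image intro: continuous_on_subset)
  then have "closedin (top_of_set A) (A \<inter> p ` {q1..q2})"
    by (intro closedin_closed_Int compact_imp_closed)
  ultimately have "A \<inter> p ` {q1..q2} = {} \<or> A \<inter> p ` {q1..q2} = A"
    using assms(2) by (simp add: connected_clopen)
  then show ?thesis by auto
qed

lemma is_interval_borel:
  fixes S :: "real set" assumes "is_interval S" shows "S \<in> sets borel"
  using is_real_interval[OF assms] by auto

text \<open>Two parameters missed by A with a point of A between them trap all of A between them;
  then the parameter set is the connected image of A under \<pi>. If no such pair exists, the missed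
  parameters form an interval.\<close>

lemma arc_chart_connected_borel:
  assumes "arc_chart B V \<pi> p \<alpha> \<omega>" "connected A" "A \<subseteq> B" "closed B"
  shows "A \<inter> V \<in> sets borel"
proof -
  define S where "S = {s \<in> {\<alpha><..<\<omega>}. p s \<in> A}"
  have "S \<in> sets borel"
  proof (cases "\<exists>q1 q2. \<alpha> < q1 \<and> q2 < \<omega> \<and> p q1 \<notin> A \<and> p q2 \<notin> A \<and> A \<inter> p ` {q1..q2} \<noteq> {}")
    case True
    then obtain q1 q2 where q: "\<alpha> < q1" "q2 < \<omega>" "p q1 \<notin> A" "p q2 \<notin> A" "A \<inter> p ` {q1..q2} \<noteq> {}" by auto
    then have "A \<subseteq> p ` {q1..q2}" using arc_chart_connected_cases[OF assms(1-3)] by blast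
    then have "S = \<pi> ` A" using assms(1) q unfolding S_def arc_chart_def by force
    moreover have "connected (\<pi> ` A)" using assms(1,2)
      by (auto simp: arc_chart_def intro!: connected_continuous_image intro: continuous_on_subset)
    ultimately show ?thesis by (auto intro: is_interval_borel simp: is_interval_connected_1)
  next
    case False
    have "is_interval ({\<alpha><..<\<omega>} - S)"
      unfolding is_interval_1
    proof (intro ballI allI impI)
      fix a b x assume ab: "a \<in> {\<alpha><..<\<omega>} - S" "b \<in> {\<alpha><..<\<omega>} - S" "a \<le> x \<and> x \<le> b"
      then have "\<alpha> < a" "b < \<omega>" "p a \<notin> A" "p b \<notin> A" by (auto simp: S_def)
      then have "A \<inter> p ` {a..b} = {}" using False by blast
      moreover have "p x \<in> p ` {a..b}" using ab by auto
      ultimately show "x \<in> {\<alpha><..<\<omega>} - S" using ab by (auto simp: S_def)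
    qed
    then have "{\<alpha><..<\<omega>} - ({\<alpha><..<\<omega>} - S) \<in> sets borel" by (intro sets.Diff is_interval_borel) auto
    moreover have "{\<alpha><..<\<omega>} - ({\<alpha><..<\<omega>} - S) = S" by (auto simp: S_def)
    ultimately show ?thesis by simp
  qed
  then have "\<pi> -` S \<in> sets borel"
    using assms(1) measurable_sets[of \<pi> borel borel S] by (auto simp: arc_chart_def borel_measurable_continuous_onI)
  then have "B \<inter> V \<inter> \<pi> -` S \<in> sets borel"
    using assms(1,4) by (auto simp: arc_chart_def)
  moreover have "A \<inter> V = B \<inter> V \<inter> \<pi> -` S"
    using assms(1,3) by (fastforce simp: arc_chart_def S_def)
  ultimately show ?thesis by simp
qed

definition arc_covered :: "'a::real_normed_vector set \<Rightarrow> bool" where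
  "arc_covered B \<longleftrightarrow> compact B \<and> (\<forall>x\<in>B. \<exists>V \<pi> p \<alpha> \<omega>. x \<in> V \<and> arc_chart B V \<pi> p \<alpha> \<omega>)"

lemma arc_covered_finite:
  assumes "arc_covered B"
  obtains \<V> where "finite \<V>" "B \<subseteq> \<Union>\<V>" "\<And>V. V \<in> \<V> \<Longrightarrow> \<exists>\<pi> p \<alpha> \<omega>. arc_chart B V \<pi> p \<alpha> \<omega>"
proof -
  let ?C = "{V. \<exists>\<pi> p \<alpha> \<omega>. arc_chart B V \<pi> p \<alpha> \<omega>}"
  have "open V" if "V \<in> ?C" for V using that unfolding arc_chart_def by blast
  moreover have "B \<subseteq> \<Union>?C" "compact B" using assms unfolding arc_covered_def by blast+
  ultimately obtain \<V> where "\<V> \<subseteq> ?C" "finite \<V>" "B \<subseteq> \<Union>\<V>"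
    by (metis (no_types, lifting) compactE)
  then show ?thesis by (intro that) auto
qed

lemma arc_covered_connected_borel:
  assumes "arc_covered B" "connected A" "A \<subseteq> B"
  shows "A \<in> sets borel"
proof -
  obtain \<V> where \<V>: "finite \<V>" "B \<subseteq> \<Union>\<V>" "\<And>V. V \<in> \<V> \<Longrightarrow> \<exists>\<pi> p \<alpha> \<omega>. arc_chart B V \<pi> p \<alpha> \<omega>"
    using arc_covered_finite[OF assms(1)] by blast
  have "closed B" using assms(1) by (simp add: arc_covered_def compact_imp_closed)
  then have "(\<Union>V\<in>\<V>. A \<inter> V) \<in> sets borel"
    using \<V>(1,3) arc_chart_connected_borel assms(2,3) by (intro sets.finite_UN) blast+
  moreover have "(\<Union>V\<in>\<V>. A \<inter> V) = A" using \<V>(2) assms(3) by auto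
  ultimately show ?thesis by simp
qed

text \<open>D consists of the points with rational parameter in finitely many charts. If A avoided
  D, rational parameters on both sides of \<pi> x would trap A in an arc around x too short to
  contain y.\<close>

lemma arc_covered_countable_hit:
  assumes "arc_covered B"
  obtains D where "countable D" "\<And>A x y. connected A \<Longrightarrow> A \<subseteq> B \<Longrightarrow> x \<in> A \<Longrightarrow> y \<in> A \<Longrightarrow> x \<noteq> y \<Longrightarrow> A \<inter> D \<noteq> {}"
proof -
  obtain \<V> where \<V>: "finite \<V>" "B \<subseteq> \<Union>\<V>" "\<And>V. V \<in> \<V> \<Longrightarrow> \<exists>\<pi> p \<alpha> \<omega>. arc_chart B V \<pi> p \<alpha> \<omega>"
    using arc_covered_finite[OF assms(1)] by blast
  then obtain p where p: "\<And>V. V \<in> \<V> \<Longrightarrow> \<exists>\<pi> \<alpha> \<omega>. arc_chart B V \<pi> (p V) \<alpha> \<omega>"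
    by metis
  let ?D = "\<Union>V\<in>\<V>. p V ` \<rat>"
  have "countable ?D" using \<V>(1) by (intro countable_UN countable_image countable_rat countable_finite)
  moreover have "A \<inter> ?D \<noteq> {}" if A: "connected A" "A \<subseteq> B" "x \<in> A" "y \<in> A" "x \<noteq> y" for A x y
  proof
    assume empty: "A \<inter> ?D = {}"
    obtain V where V: "V \<in> \<V>" "x \<in> V" using A \<V>(2) by blast
    obtain \<pi> \<alpha> \<omega> where c: "arc_chart B V \<pi> (p V) \<alpha> \<omega>" using p[OF V(1)] by blast
    have s: "\<alpha> < \<pi> x" "\<pi> x < \<omega>" "p V (\<pi> x) = x" using c A V by (auto simp: arc_chart_def)
    \<comment> \<open>The bounds keep \<pi> y out of [q1, q2] unless \<pi> y = \<pi> x. The point y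
      may lie outside V, where \<pi> y does not determine it; that y lies on the arc follows only
      from the trapping.\<close>
    obtain q1 where q1: "q1 \<in> \<rat>" "(if \<pi> y < \<pi> x then max \<alpha> (\<pi> y) else \<alpha>) < q1" "q1 < \<pi> x"
      using Rats_dense_in_real[of "if \<pi> y < \<pi> x then max \<alpha> (\<pi> y) else \<alpha>" "\<pi> x"] s by (metis max_less_iff_conj)
    obtain q2 where q2: "q2 \<in> \<rat>" "\<pi> x < q2" "q2 < (if \<pi> x < \<pi> y then min \<omega> (\<pi> y) else \<omega>)"
      using Rats_dense_in_real[of "\<pi> x" "if \<pi> x < \<pi> y then min \<omega> (\<pi> y) else \<omega>"] s by (metis min_less_iff_conj)
    have q: "\<alpha> < q1" "q2 < \<omega>" "\<pi> y < \<pi> x \<Longrightarrow> \<pi> y < q1" "\<pi> x < \<pi> y \<Longrightarrow> q2 < \<pi> y"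
      using q1 q2 by (auto split: if_splits)
    have "p V q1 \<notin> A" "p V q2 \<notin> A" using empty q1 q2 V by auto
    then have "A \<inter> p V ` {q1..q2} = {} \<or> A \<subseteq> p V ` {q1..q2}"
      by (intro arc_chart_connected_cases[OF c A(1,2)] q)
    moreover have "x \<in> p V ` {q1..q2}" using s(3) q1 q2 by (intro image_eqI[of _ _ "\<pi> x"]) auto
    ultimately have "y \<in> p V ` {q1..q2}" using A by auto
    then obtain u where u: "y = p V u" "q1 \<le> u" "u \<le> q2" by auto
    then have "\<pi> y = u" using c q by (auto simp: arc_chart_def)
    then have "\<pi> y = \<pi> x" using u q by (meson linorder_not_less linorder_cases)
    then have "y = x" using u s \<open>\<pi> y = u\<close> by simp
    then show False using A by simp
  qed
  ultimately show ?thesis by (rule that)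
qed

text \<open>The two pieces of a path split at a point of D are together no longer than the path, so
  the detour through D costs nothing. D depends on B alone; x = y is excluded because a constant
  path may miss D.\<close>

lemma arc_covered_geodesic_dist_INF:
  assumes "arc_covered B"
  obtains D where "countable D" "\<And>\<Gamma> x y. \<Gamma> \<subseteq> B \<Longrightarrow> x \<noteq> y \<Longrightarrow>
    geodesic_dist \<Gamma> x y = (INF z\<in>D. geodesic_dist \<Gamma> x z + geodesic_dist \<Gamma> z y)"
proof -
  obtain D where D: "countable D"
    "\<And>A x y. connected A \<Longrightarrow> A \<subseteq> B \<Longrightarrow> x \<in> A \<Longrightarrow> y \<in> A \<Longrightarrow> x \<noteq> y \<Longrightarrow> A \<inter> D \<noteq> {}"
    using arc_covered_countable_hit[OF assms] by blast
  have "geodesic_dist \<Gamma> x y = (INF z\<in>D. geodesic_dist \<Gamma> x z + geodesic_dist \<Gamma> z y)"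
    if "\<Gamma> \<subseteq> B" "x \<noteq> y" for \<Gamma> x y
  proof (rule antisym)
    show "geodesic_dist \<Gamma> x y \<le> (INF z\<in>D. geodesic_dist \<Gamma> x z + geodesic_dist \<Gamma> z y)"
      by (intro INF_greatest geodesic_dist_triangle)
    show "(INF z\<in>D. geodesic_dist \<Gamma> x z + geodesic_dist \<Gamma> z y) \<le> geodesic_dist \<Gamma> x y"
      unfolding geodesic_dist_def[of \<Gamma> x y] paths_from_to_def[symmetric]
    proof (rule INF_greatest)
      fix g assume g: "g \<in> paths_from_to \<Gamma> x y"
      then have "path_image g \<inter> D \<noteq> {}"
        using that by (intro D(2)[of _ x y] connected_path_image) (auto simp: paths_from_to_def)
      then obtain s where s: "0 \<le> s" "s \<le> 1" "g s \<in> D" by (auto simp: path_image_def)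
      have "(INF z\<in>D. geodesic_dist \<Gamma> x z + geodesic_dist \<Gamma> z y) \<le>
          geodesic_dist \<Gamma> x (g s) + geodesic_dist \<Gamma> (g s) y"
        using s(3) by (rule INF_lower)
      also have "\<dots> \<le> curve_length (subpath 0 s g) + curve_length (subpath s 1 g)"
        using subpaths_from_to[OF g s(1,2)] by (intro add_mono geodesic_dist_le)
      also have "\<dots> \<le> curve_length g" by (rule curve_length_subpaths[OF s(1,2)])
      finally show "(INF z\<in>D. geodesic_dist \<Gamma> x z + geodesic_dist \<Gamma> z y) \<le> curve_length g" .
    qed
  qed
  then show ?thesis using D(1) that by blast
qed

text \<open>A strict sublevel set of a section is a geodesic ball, connected and inside \<Gamma>,
  hence Borel. This gives measurability in each variable separately; joint measurability needs the
  countable infimum.\<close>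

lemma geodesic_dist_borel_measurable:
  assumes "arc_covered B" "\<Gamma> \<subseteq> B"
  shows "(\<lambda>y. geodesic_dist \<Gamma> z y) \<in> borel_measurable borel"
    "(\<lambda>x. geodesic_dist \<Gamma> x z) \<in> borel_measurable borel"
proof -
  have in_\<Gamma>: "x \<in> \<Gamma> \<and> y \<in> \<Gamma>" if "geodesic_dist \<Gamma> x y < c" for x y c
    using that unfolding geodesic_dist_less_iff paths_from_to_def by auto
  have "{y. geodesic_dist \<Gamma> z y < c} \<in> sets borel" "{x. geodesic_dist \<Gamma> x z < c} \<in> sets borel" for c
    using in_\<Gamma> assms(2) by (intro arc_covered_connected_borel[OF assms(1)] connected_geodesic_balls; blast)+
  then show "(\<lambda>y. geodesic_dist \<Gamma> z y) \<in> borel_measurable borel"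
    "(\<lambda>x. geodesic_dist \<Gamma> x z) \<in> borel_measurable borel"
    by (auto intro!: borel_measurableI_less)
qed

lemma gdist_measurable_pair:
  assumes "arc_covered B" "\<Gamma> \<subseteq> B"
  shows "(\<lambda>p. gdist \<Gamma> (fst p) (snd p)) \<in> borel_measurable (surface \<Gamma> \<Otimes>\<^sub>M surface \<Gamma>)"
proof -
  obtain D where D: "countable D" "\<And>\<Gamma> x y. \<Gamma> \<subseteq> B \<Longrightarrow> x \<noteq> y \<Longrightarrow>
    geodesic_dist \<Gamma> x y = (INF z\<in>D. geodesic_dist \<Gamma> x z + geodesic_dist \<Gamma> z y)"
    using arc_covered_geodesic_dist_INF[OF assms(1)] by blast
  note [measurable] = borel_measurable_surface[OF geodesic_dist_borel_measurable(1)[OF assms]]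
    borel_measurable_surface[OF geodesic_dist_borel_measurable(2)[OF assms]]
  have id: "(\<lambda>x. x) \<in> borel_measurable (surface \<Gamma>)"
    by (rule borel_measurable_surface) simp
  \<comment> \<open>The infimum formula may fail on the diagonal, where the distance is 0, so the
    diagonal has to be separated measurably.\<close>
  have [measurable]: "Measurable.pred (surface \<Gamma> \<Otimes>\<^sub>M surface \<Gamma>) (\<lambda>p. fst p = snd p)"
    unfolding pred_def
    by (rule measurable_equality_set; rule measurable_compose[OF _ id]) simp_all
  have "(\<lambda>p. if fst p = snd p then 0 else
      enn2real (INF z\<in>D. geodesic_dist \<Gamma> (fst p) z + geodesic_dist \<Gamma> z (snd p)))
    \<in> borel_measurable (surface \<Gamma> \<Otimes>\<^sub>M surface \<Gamma>)"
    using D(1) by measurable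
  also have "?this \<longleftrightarrow> ?thesis"
    by (intro measurable_cong) (auto simp: gdist_def space_pair_measure geodesic_dist_refl D(2)[OF assms(2)])
  finally show ?thesis .
qed

section \<open>Charts and finite length of a Lipschitz boundary\<close>

lemma orthonormal_expansion_2:
  fixes e n y :: "real^2"
  assumes "norm e = 1" "norm n = 1" "e \<bullet> n = 0"
  shows "y = (y \<bullet> e) *\<^sub>R e + (y \<bullet> n) *\<^sub>R n"
proof -
  define z where "z = y - (y \<bullet> e) *\<^sub>R e - (y \<bullet> n) *\<^sub>R n"
  have "e \<bullet> e = 1" "n \<bullet> n = 1" "n \<bullet> e = 0" using assms by (simp_all add: dot_square_norm inner_commute)
  then have 1: "z \<bullet> e = 0" "z \<bullet> n = 0"
    using assms(3) by (simp_all add: z_def inner_diff_left)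
  \<comment> \<open>c is the determinant of the frame (e, n): the orthonormality relations give c^2
    = 1, and orthogonality of z to both vectors gives c z = 0.\<close>
  define c where "c = e $ 1 * n $ 2 - e $ 2 * n $ 1"
  have "(e $ 1)\<^sup>2 + (e $ 2)\<^sup>2 = 1" "(n $ 1)\<^sup>2 + (n $ 2)\<^sup>2 = 1" "e $ 1 * n $ 1 + e $ 2 * n $ 2 = 0"
    using \<open>e \<bullet> e = 1\<close> \<open>n \<bullet> n = 1\<close> assms(3) by (simp_all add: inner_vec_def sum_2 power2_eq_square)
  then have "c\<^sup>2 = 1" unfolding c_def by algebra
  then have "c \<noteq> 0" by auto
  moreover have "z $ 1 * c = 0" "z $ 2 * c = 0"
    using 1 unfolding c_def inner_vec_def sum_2 inner_real_def by algebra+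
  ultimately have "z = 0" by (simp add: vec_eq_iff forall_2)
  then show ?thesis by (simp add: z_def algebra_simps)
qed

text \<open>Near x the boundary lies on the graph of h: a point above it belongs to the open set
  \<Omega>, a point below it has a neighbourhood that misses \<Omega>. The chart takes the
  coordinate along e, and its inverse is the graph parametrization, Lipschitz with constant 1 +
  L.\<close>

lemma lipschitz_domain_arc_chart:
  assumes "lipschitz_domain \<Omega>" "x \<in> frontier \<Omega>"
  obtains V \<pi> p \<alpha> \<omega> L where "x \<in> V" "arc_chart (frontier \<Omega>) V \<pi> p \<alpha> \<omega>" "L-lipschitz_on UNIV p"
proof -
  have "open \<Omega>" using assms(1) by (simp add: lipschitz_domain_def)
  obtain r e n h L where r: "r > 0" and en: "norm e = 1" "norm n = 1" "e \<bullet> n = 0"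
    and h: "L-lipschitz_on UNIV (h :: real \<Rightarrow> real)"
    and eq: "\<Omega> \<inter> ball x r = {y \<in> ball x r. y \<bullet> n > h (y \<bullet> e)}"
    using assms unfolding lipschitz_domain_def by meson
  have hc: "continuous_on UNIV h" using h by (rule lipschitz_on_continuous_on)
  have graph: "y \<bullet> n = h (y \<bullet> e)" if y: "y \<in> frontier \<Omega>" "y \<in> ball x r" for y
  proof (rule antisym)
    have "y \<notin> \<Omega>" using y(1) \<open>open \<Omega>\<close> by (simp add: frontier_def interior_open)
    then show "y \<bullet> n \<le> h (y \<bullet> e)" using eq y(2) by force
    show "h (y \<bullet> e) \<le> y \<bullet> n"
    proof (rule ccontr)
      let ?U = "ball x r \<inter> {z. z \<bullet> n < h (z \<bullet> e)}"
      assume "\<not> ?thesis"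
      then have "y \<in> ?U" using y(2) by simp
      moreover have "open ?U"
        by (intro open_Int open_ball open_Collect_less continuous_intros continuous_on_compose2[OF hc]) auto
      moreover have "y \<in> closure \<Omega>" using y(1) by (simp add: frontier_def)
      ultimately have "\<Omega> \<inter> ?U \<noteq> {}" using open_Int_closure_eq_empty[of ?U \<Omega>] by blast
      then show False using eq by (auto simp: set_eq_iff) (metis less_asym)
    qed
  qed
  define p where "p s = s *\<^sub>R e + h s *\<^sub>R n" for s
  have lip: "(1 + L)-lipschitz_on UNIV p"
  proof (rule lipschitz_onI)
    fix s t :: real
    have "dist (p s) (p t) = norm ((s - t) *\<^sub>R e + (h s - h t) *\<^sub>R n)"
      by (simp add: p_def dist_norm algebra_simps)
    also have "\<dots> \<le> \<bar>s - t\<bar> + \<bar>h s - h t\<bar>"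
      using norm_triangle_ineq[of "(s - t) *\<^sub>R e" "(h s - h t) *\<^sub>R n"] en by simp
    also have "\<bar>h s - h t\<bar> \<le> L * \<bar>s - t\<bar>" using h by (auto simp: lipschitz_on_def dist_real_def)
    finally show "dist (p s) (p t) \<le> (1 + L) * dist s t" by (simp add: dist_real_def algebra_simps)
  qed (use h in \<open>auto simp: lipschitz_on_def\<close>)
  have L: "0 < 1 + L" using h by (simp add: lipschitz_on_def)
  \<comment> \<open>The graph moves at speed at most 1 + L, so parameters within \<delta> of
    \<open>x \<bullet> e\<close> stay in the ball of radius r.\<close>
  define \<delta> where "\<delta> = r / (1 + L)"
  define V where "V = ball x r \<inter> {y. x \<bullet> e - \<delta> < y \<bullet> e} \<inter> {y. y \<bullet> e < x \<bullet> e + \<delta>}"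
  have inv: "p (y \<bullet> e) = y" if "y \<in> frontier \<Omega>" "y \<in> ball x r" for y
    using graph[OF that] orthonormal_expansion_2[OF en, of y] by (simp add: p_def)
  have pe: "p s \<bullet> e = s" for s
    using en by (simp add: p_def inner_add_left inner_commute[of n e] dot_square_norm)
  have "p s \<in> ball x r" if "x \<bullet> e - \<delta> < s" "s < x \<bullet> e + \<delta>" for s
  proof -
    have "dist (p (x \<bullet> e)) (p s) \<le> (1 + L) * dist (x \<bullet> e) s" using lip by (simp add: lipschitz_on_def)
    also have "dist (x \<bullet> e) s < \<delta>" using that by (auto simp: dist_real_def)
    also have "(1 + L) * \<delta> = r" using L by (simp add: \<delta>_def)
    finally show ?thesis using inv[OF assms(2)] r L by simp
  qed
  then have "arc_chart (frontier \<Omega>) V (\<lambda>y. y \<bullet> e) p (x \<bullet> e - \<delta>) (x \<bullet> e + \<delta>)"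
    unfolding arc_chart_def V_def using inv lipschitz_on_continuous_on[OF lip]
    by (auto simp: pe intro!: open_Int open_Collect_less continuous_intros)
  moreover have "x \<in> V" using r L by (simp add: V_def \<delta>_def)
  ultimately show ?thesis using lip by (intro that)
qed

lemma lipschitz_domain_arc_covered:
  assumes "lipschitz_domain \<Omega>" shows "arc_covered (frontier \<Omega>)"
  using assms lipschitz_domain_arc_chart[OF assms]
  unfolding arc_covered_def lipschitz_domain_def by (metis compact_frontier_bounded)

text \<open>Compactness of the frontier leaves finitely many charts, each contained in a Lipschitz
  arc over a bounded interval and so of finite length.\<close>

lemma lipschitz_domain_finite_surface:
  assumes "lipschitz_domain \<Omega>" "\<Gamma> \<subseteq> frontier \<Omega>" "\<Gamma> \<in> sets borel"
  shows "finite_measure (surface \<Gamma>)"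
proof -
  define Q :: "(real^2) set \<Rightarrow> (real \<Rightarrow> real^2) \<Rightarrow> real \<Rightarrow> real \<Rightarrow> real \<Rightarrow> bool"
    where "Q V p \<alpha> \<omega> L \<longleftrightarrow> open V \<and> frontier \<Omega> \<inter> V \<subseteq> p ` {\<alpha>..\<omega>} \<and> L-lipschitz_on UNIV p \<and> \<alpha> \<le> \<omega>"
    for V p \<alpha> \<omega> L
  define C where "C = {V. \<exists>p \<alpha> \<omega> L. Q V p \<alpha> \<omega> L}"
  have "\<exists>V. x \<in> V \<and> V \<in> C" if x: "x \<in> frontier \<Omega>" for x
  proof -
    obtain V \<pi> p \<alpha> \<omega> L where *: "x \<in> V" "arc_chart (frontier \<Omega>) V \<pi> p \<alpha> \<omega>" "L-lipschitz_on UNIV p"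
      using lipschitz_domain_arc_chart[OF assms(1) x] by blast
    have "frontier \<Omega> \<inter> V \<subseteq> p ` {\<alpha>..\<omega>}"
    proof
      fix y assume "y \<in> frontier \<Omega> \<inter> V"
      then show "y \<in> p ` {\<alpha>..\<omega>}" using *(2) unfolding arc_chart_def
        by (intro image_eqI[of _ _ "\<pi> y"]) (simp, force)
    qed
    moreover have "\<alpha> \<le> \<omega>" "open V" using * x by (auto simp: arc_chart_def)
    ultimately have "Q V p \<alpha> \<omega> L" using * by (simp add: Q_def)
    then have "V \<in> C" unfolding C_def by blast
    with *(1) show ?thesis by blast
  qed
  then have "frontier \<Omega> \<subseteq> \<Union>C" by blast
  moreover have "open V" if "V \<in> C" for V using that by (auto simp: C_def Q_def)
  moreover have "compact (frontier \<Omega>)"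
    using assms(1) by (simp add: lipschitz_domain_def compact_frontier_bounded)
  ultimately obtain \<V> where \<V>: "\<V> \<subseteq> C" "finite \<V>" "frontier \<Omega> \<subseteq> \<Union>\<V>"
    by (metis (no_types, lifting) compactE)
  then have "\<forall>V\<in>\<V>. \<exists>p \<alpha> \<omega> L. Q V p \<alpha> \<omega> L" unfolding C_def by blast
  then obtain p \<alpha> \<omega> L where QV: "\<And>V. V \<in> \<V> \<Longrightarrow> Q V (p V) (\<alpha> V) (\<omega> V) (L V)" by metis
  show ?thesis
  proof (rule finite_surface[OF assms(3) _ \<V>(2)])
    show "\<Gamma> \<subseteq> (\<Union>V\<in>\<V>. p V ` {\<alpha> V..\<omega> V})" using \<V>(3) assms(2) QV unfolding Q_def by blast
    show "\<And>V. V \<in> \<V> \<Longrightarrow> (L V)-lipschitz_on UNIV (p V) \<and> \<alpha> V \<le> \<omega> V" using QV by (simp add: Q_def)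
  qed
qed

lemma lipschitz_domain_measurable_gdist:
  assumes "lipschitz_domain \<Omega>" "\<Gamma> \<subseteq> frontier \<Omega>" "\<Gamma> \<in> sets borel"
  shows "measurable_gdist \<Gamma>"
  by (intro measurable_gdist.intro lipschitz_domain_finite_surface[OF assms]
      gdist_measurable_pair[OF lipschitz_domain_arc_covered[OF assms(1)] assms(2)])

section \<open>Boundary traces\<close>

lemma set_nn_measurable:
  fixes g :: "real^2 \<Rightarrow> ennreal"
  assumes "open \<Omega>" "g \<in> borel_measurable (lebesgue_on \<Omega>)"
  shows "(\<lambda>y. g y * indicator (ball x r \<inter> \<Omega>) y) \<in> borel_measurable lebesgue"
proof -
  have "(\<lambda>y. g y * indicator \<Omega> y) \<in> borel_measurable lebesgue"
    using assms by (simp add: borel_measurable_restrict_space_iff_ennreal)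
  then have "(\<lambda>y. (g y * indicator \<Omega> y) * indicator (ball x r) y) \<in> borel_measurable lebesgue"
    by (rule borel_measurable_times_ennreal[OF _ borel_measurable_indicator]) auto
  then show ?thesis by (simp add: indicator_inter_arith ac_simps)
qed

text \<open>At points of the closure the trace averages have proper denominators: a nonempty open
  set is not negligible.\<close>

lemma emeasure_ball_Int_open:
  fixes x :: "real^2"
  assumes "open \<Omega>" "x \<in> closure \<Omega>" "r > 0"
  shows "0 < emeasure lebesgue (ball x r \<inter> \<Omega>)" "emeasure lebesgue (ball x r \<inter> \<Omega>) < top"
proof -
  have "open (ball x r \<inter> \<Omega>)" using assms(1) by auto
  moreover have "ball x r \<inter> \<Omega> \<noteq> {}"
  proof -
    have "x \<in> ball x r \<inter> closure \<Omega>" using assms by simp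
    then show ?thesis using open_Int_closure_eq_empty[OF open_ball[of x r], of \<Omega>] by blast
  qed
  ultimately have "\<not> negligible (ball x r \<inter> \<Omega>)" by (rule open_not_negligible)
  moreover have s: "ball x r \<inter> \<Omega> \<in> sets lebesgue" using assms(1) by auto
  ultimately have "emeasure lebesgue (ball x r \<inter> \<Omega>) \<noteq> 0"
    by (auto simp: negligible_iff_null_sets null_sets_def)
  then show "0 < emeasure lebesgue (ball x r \<inter> \<Omega>)" by (simp add: zero_less_iff_neq_zero)
  have "emeasure lebesgue (ball x r \<inter> \<Omega>) \<le> emeasure lebesgue (ball x r)"
    by (intro emeasure_mono) auto
  also have "\<dots> < top"
    using emeasure_bounded_finite[of "ball x r"] by (simp add: less_top)
  finally show "emeasure lebesgue (ball x r \<inter> \<Omega>) < top" .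
qed

lemma has_trace_at_lincomb:
  assumes "open \<Omega>" "u \<in> borel_measurable (lebesgue_on \<Omega>)" "v \<in> borel_measurable (lebesgue_on \<Omega>)"
    and "has_trace_at \<Omega> u x y" "has_trace_at \<Omega> v x z"
  shows "has_trace_at \<Omega> (\<lambda>x. c *\<^sub>R u x + d *\<^sub>R v x) x (c *\<^sub>R y + d *\<^sub>R z)"
  unfolding has_trace_at_def
proof (rule tendsto_sandwich[OF _ _ tendsto_const])
  let ?I = "\<lambda>u z r. (\<integral>\<^sup>+y\<in>ball x r \<inter> \<Omega>. ennreal (norm (u y - z)) \<partial>lebesgue) /
           emeasure lebesgue (ball x r \<inter> \<Omega>)"
  have "((\<lambda>r. ennreal \<bar>c\<bar> * ?I u y r + ennreal \<bar>d\<bar> * ?I v z r) \<longlongrightarrow> ennreal \<bar>c\<bar> * 0 + ennreal \<bar>d\<bar> * 0) (at_right 0)"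
    using assms(4,5) unfolding has_trace_at_def by (intro tendsto_add ennreal_tendsto_cmult) auto
  then show "((\<lambda>r. ennreal \<bar>c\<bar> * ?I u y r + ennreal \<bar>d\<bar> * ?I v z r) \<longlongrightarrow> 0) (at_right 0)" by simp
  have m: "(\<lambda>w. ennreal (norm (u w - y)) * indicator (ball x r \<inter> \<Omega>) w) \<in> borel_measurable lebesgue"
    "(\<lambda>w. ennreal (norm (v w - z)) * indicator (ball x r \<inter> \<Omega>) w) \<in> borel_measurable lebesgue" for r
    using assms(2,3) by (intro set_nn_measurable assms(1); measurable)+
  have "?I (\<lambda>x. c *\<^sub>R u x + d *\<^sub>R v x) (c *\<^sub>R y + d *\<^sub>R z) r \<le>
    ennreal \<bar>c\<bar> * ?I u y r + ennreal \<bar>d\<bar> * ?I v z r" for r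
  proof -
    have "norm (c *\<^sub>R u w + d *\<^sub>R v w - (c *\<^sub>R y + d *\<^sub>R z)) \<le>
       \<bar>c\<bar> * norm (u w - y) + \<bar>d\<bar> * norm (v w - z)" for w
    proof -
      have "c *\<^sub>R u w + d *\<^sub>R v w - (c *\<^sub>R y + d *\<^sub>R z) = c *\<^sub>R (u w - y) + d *\<^sub>R (v w - z)"
        by (simp add: algebra_simps)
      then show ?thesis
        using norm_triangle_ineq[of "c *\<^sub>R (u w - y)" "d *\<^sub>R (v w - z)"] by simp
    qed
    then have "ennreal (norm (c *\<^sub>R u w + d *\<^sub>R v w - (c *\<^sub>R y + d *\<^sub>R z))) \<le>
       ennreal \<bar>c\<bar> * ennreal (norm (u w - y)) + ennreal \<bar>d\<bar> * ennreal (norm (v w - z))" for w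
      by (simp flip: ennreal_mult' ennreal_plus)
    then have "(\<integral>\<^sup>+w\<in>ball x r \<inter> \<Omega>. ennreal (norm (c *\<^sub>R u w + d *\<^sub>R v w - (c *\<^sub>R y + d *\<^sub>R z))) \<partial>lebesgue) \<le>
      (\<integral>\<^sup>+w. ennreal \<bar>c\<bar> * (ennreal (norm (u w - y)) * indicator (ball x r \<inter> \<Omega>) w) +
         ennreal \<bar>d\<bar> * (ennreal (norm (v w - z)) * indicator (ball x r \<inter> \<Omega>) w) \<partial>lebesgue)"
      by (intro nn_integral_mono) (auto split: split_indicator)
    also have "\<dots> = ennreal \<bar>c\<bar> * (\<integral>\<^sup>+w\<in>ball x r \<inter> \<Omega>. ennreal (norm (u w - y)) \<partial>lebesgue) +
      ennreal \<bar>d\<bar> * (\<integral>\<^sup>+w\<in>ball x r \<inter> \<Omega>. ennreal (norm (v w - z)) \<partial>lebesgue)"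
      using m by (simp add: nn_integral_add nn_integral_cmult)
    finally show ?thesis
      by (metis (no_types, lifting) divide_right_mono_ennreal ennreal_times_divide add_divide_distrib_ennreal)
  qed
  then show "\<forall>\<^sub>F r in at_right 0. ?I (\<lambda>x. c *\<^sub>R u x + d *\<^sub>R v x) (c *\<^sub>R y + d *\<^sub>R z) r \<le>
    ennreal \<bar>c\<bar> * ?I u y r + ennreal \<bar>d\<bar> * ?I v z r" by simp
qed simp

text \<open>The zero function v - v has the trace y - z, while its averaged distance to y - z is
  constantly the norm of z - y.\<close>

lemma has_trace_at_unique:
  assumes "open \<Omega>" "x \<in> closure \<Omega>" "v \<in> borel_measurable (lebesgue_on \<Omega>)"
    and "has_trace_at \<Omega> v x y" "has_trace_at \<Omega> v x z"
  shows "y = z"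
proof -
  have "has_trace_at \<Omega> (\<lambda>x. 1 *\<^sub>R v x + (-1) *\<^sub>R v x) x (1 *\<^sub>R y + (-1) *\<^sub>R z)"
    using assms by (intro has_trace_at_lincomb) auto
  then have "((\<lambda>r. (\<integral>\<^sup>+w\<in>ball x r \<inter> \<Omega>. ennreal (norm (z - y)) \<partial>lebesgue) /
           emeasure lebesgue (ball x r \<inter> \<Omega>)) \<longlongrightarrow> 0) (at_right 0)"
    by (simp add: has_trace_at_def)
  moreover have "\<forall>\<^sub>F r in at_right 0. (\<integral>\<^sup>+w\<in>ball x r \<inter> \<Omega>. ennreal (norm (z - y)) \<partial>lebesgue) /
           emeasure lebesgue (ball x r \<inter> \<Omega>) = ennreal (norm (z - y))"
    using eventually_at_right_less[of "0::real"]
  proof eventually_elim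
    case (elim r)
    have "ball x r \<inter> \<Omega> \<in> sets lebesgue" using assms(1) by auto
    then show ?case
      using emeasure_ball_Int_open[OF assms(1,2) elim]
      by (simp add: nn_integral_cmult_indicator ennreal_mult_divide_eq)
  qed
  ultimately have "((\<lambda>r::real. ennreal (norm (z - y))) \<longlongrightarrow> 0) (at_right 0)"
    by (simp add: tendsto_cong)
  then have "ennreal (norm (z - y)) = 0"
    by (simp add: tendsto_const_iff)
  then show ?thesis by simp
qed

lemma bdry_trace_eq:
  assumes "open \<Omega>" "x \<in> closure \<Omega>" "v \<in> borel_measurable (lebesgue_on \<Omega>)" "has_trace_at \<Omega> v x z"
  shows "bdry_trace \<Omega> v x = z"
  unfolding bdry_trace_def using assms has_trace_at_unique by (intro the_equality) blast+

lemma has_trace_at_continuous: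
  assumes "open \<Omega>" "x \<in> closure \<Omega>" "isCont v x"
  shows "has_trace_at \<Omega> v x (v x)"
  unfolding has_trace_at_def
proof (rule order_tendstoI)
  fix \<epsilon> :: ennreal assume "0 < \<epsilon>"
  then obtain e' where e': "0 < e'" "e' < \<epsilon>" using dense by blast
  then obtain e where "e' = ennreal e" "0 \<le> e" by (cases e') auto
  with e' have e: "ennreal e < \<epsilon>" "0 < e" by auto
  obtain \<delta> where \<delta>: "\<delta> > 0" "\<And>y. dist y x < \<delta> \<Longrightarrow> dist (v y) (v x) < e"
    using assms(3) e unfolding continuous_at_eps_delta by blast
  have "\<forall>\<^sub>F r in at_right 0. 0 < r \<and> r < \<delta>"
    using \<delta>(1) by (auto simp: eventually_at_right_field)
  then show "\<forall>\<^sub>F r in at_right 0. (\<integral>\<^sup>+y\<in>ball x r \<inter> \<Omega>. ennreal (norm (v y - v x)) \<partial>lebesgue) /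
           emeasure lebesgue (ball x r \<inter> \<Omega>) < \<epsilon>"
  proof eventually_elim
    case (elim r)
    have s: "ball x r \<inter> \<Omega> \<in> sets lebesgue" using assms(1) by auto
    have "ennreal (norm (v y - v x)) \<le> ennreal e" if "y \<in> ball x r" for y
      using \<delta>(2)[of y] that elim by (intro ennreal_leI) (simp add: dist_norm norm_minus_commute)
    then have "(\<integral>\<^sup>+y\<in>ball x r \<inter> \<Omega>. ennreal (norm (v y - v x)) \<partial>lebesgue) \<le>
      (\<integral>\<^sup>+y. ennreal e * indicator (ball x r \<inter> \<Omega>) y \<partial>lebesgue)"
      by (intro nn_integral_mono) (auto split: split_indicator)
    also have "\<dots> = ennreal e * emeasure lebesgue (ball x r \<inter> \<Omega>)"
      using s by (simp add: nn_integral_cmult_indicator)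
    finally have "(\<integral>\<^sup>+y\<in>ball x r \<inter> \<Omega>. ennreal (norm (v y - v x)) \<partial>lebesgue) /
           emeasure lebesgue (ball x r \<inter> \<Omega>) \<le> ennreal e * emeasure lebesgue (ball x r \<inter> \<Omega>) / emeasure lebesgue (ball x r \<inter> \<Omega>)"
      by (rule divide_right_mono_ennreal)
    also have "\<dots> = ennreal e"
      using emeasure_ball_Int_open[OF assms(1,2), of r] elim by (simp add: ennreal_mult_divide_eq)
    finally show ?case using e by simp
  qed
qed simp

section \<open>Weak gradients\<close>

definition C1_grad :: "(real^2 \<Rightarrow> real) \<Rightarrow> (real^2 \<Rightarrow> real^2) \<Rightarrow> bool" where
  "C1_grad g g' \<longleftrightarrow> (\<forall>x. GDERIV g x :> g' x) \<and> continuous_on UNIV g'"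

lemma C1_grad_const: "C1_grad (\<lambda>x. c) (\<lambda>x. 0)"
  by (simp add: C1_grad_def GDERIV_const)

lemma C1_grad_continuous: "C1_grad g g' \<Longrightarrow> continuous_on UNIV g"
  unfolding C1_grad_def gderiv_def
  by (auto intro!: continuous_at_imp_continuous_on has_derivative_continuous)

lemma C1_grad_add: "C1_grad f f' \<Longrightarrow> C1_grad g g' \<Longrightarrow> C1_grad (\<lambda>x. f x + g x) (\<lambda>x. f' x + g' x)"
  by (auto simp: C1_grad_def intro: GDERIV_add continuous_on_add)

lemma C1_grad_mult:
  assumes "C1_grad f f'" "C1_grad g g'"
  shows "C1_grad (\<lambda>x. f x * g x) (\<lambda>x. f x *\<^sub>R g' x + g x *\<^sub>R f' x)"
  unfolding C1_grad_def
proof (intro conjI allI)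
  show "GDERIV (\<lambda>x. f x * g x) x :> f x *\<^sub>R g' x + g x *\<^sub>R f' x" for x
    using assms by (intro GDERIV_mult) (auto simp: C1_grad_def)
  show "continuous_on UNIV (\<lambda>x. f x *\<^sub>R g' x + g x *\<^sub>R f' x)"
    using assms C1_grad_continuous[OF assms(1)] C1_grad_continuous[OF assms(2)]
    by (intro continuous_intros) (auto simp: C1_grad_def)
qed

lemma C1_grad_sum:
  assumes "\<And>k. k \<in> I \<Longrightarrow> C1_grad (f k) (f' k)"
  shows "C1_grad (\<lambda>x. \<Sum>k\<in>I. f k x) (\<lambda>x. \<Sum>k\<in>I. f' k x)"
  using assms by (induction I rule: infinite_finite_induct) (simp_all add: C1_grad_const C1_grad_add)

text \<open>Derivatives of h are asked only at values of f, and continuity of h' only on the range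
  of f. This admits functions with a pole elsewhere, as in \<open>test_fun_saturate\<close>.\<close>

lemma C1_grad_compose:
  assumes "C1_grad f f'" "\<And>x. (h has_real_derivative h' (f x)) (at (f x))" "continuous_on (range f) h'"
  shows "C1_grad (\<lambda>x. h (f x)) (\<lambda>x. h' (f x) *\<^sub>R f' x)"
  unfolding C1_grad_def
proof (intro conjI allI)
  show "GDERIV (\<lambda>x. h (f x)) x :> h' (f x) *\<^sub>R f' x" for x
    using assms by (intro GDERIV_DERIV_compose[of f]) (auto simp: C1_grad_def)
  show "continuous_on UNIV (\<lambda>x. h' (f x) *\<^sub>R f' x)"
    using assms(1)
    by (intro continuous_on_scaleR continuous_on_compose2[OF assms(3) C1_grad_continuous[OF assms(1)]])
      (auto simp: C1_grad_def)
qed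

lemma C1_grad_zero_outside:
  assumes "C1_grad g g'" "closed K" "\<And>x. x \<notin> K \<Longrightarrow> g x = 0" "x \<notin> K"
  shows "g' x = 0"
proof -
  have "(g has_derivative (\<lambda>h. h \<bullet> g' x)) (at x)" using assms(1) by (simp add: C1_grad_def gderiv_def)
  moreover have "(g has_derivative (\<lambda>h. 0)) (at x)"
  proof (rule has_derivative_transform_within_open)
    show "((\<lambda>x. 0) has_derivative (\<lambda>h. 0)) (at x)" by simp
    show "open (- K)" "x \<in> - K" using assms by auto
  qed (use assms(3) in auto)
  ultimately have "(\<lambda>h. h \<bullet> g' x) = (\<lambda>h. 0)" by (rule has_derivative_unique)
  then have "g' x \<bullet> g' x = 0" by metis
  then show ?thesis by simp
qed

lemma bounded_support_bound:
  fixes f :: "real^2 \<Rightarrow> 'b::real_normed_vector"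
  assumes "continuous_on UNIV f" "compact K" "\<And>x. x \<notin> K \<Longrightarrow> f x = 0"
  obtains M where "M \<ge> 0" "\<And>x. norm (f x) \<le> M"
proof -
  have "compact (f ` K)" using assms by (intro compact_continuous_image) (auto intro: continuous_on_subset)
  then obtain M where M: "\<And>y. y \<in> f ` K \<Longrightarrow> norm y \<le> M" by (meson bounded_iff compact_imp_bounded)
  have "norm (f x) \<le> max M 0" for x
  proof (cases "x \<in> K")
    case True
    then show ?thesis using M[of "f x"] by auto
  qed (use assms(3) in auto)
  then show ?thesis using that[of "max M 0"] by auto
qed

lemma compact_support_integral:
  fixes f :: "real^2 \<Rightarrow> real"
  assumes "continuous_on UNIV f" "compact K" "\<And>x. x \<notin> K \<Longrightarrow> f x = 0"
  shows "integrable lborel f"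
    and "open \<Omega> \<Longrightarrow> K \<subseteq> \<Omega> \<Longrightarrow> (\<integral>x. f x \<partial>lebesgue_on \<Omega>) = (\<integral>x. f x \<partial>lborel)"
proof -
  have "integrable lborel (\<lambda>x. indicator K x *\<^sub>R f x)"
    using assms by (intro borel_integrable_compact) (auto intro: continuous_on_subset)
  moreover have "(\<lambda>x. indicator K x *\<^sub>R f x) = f" using assms(3) by (fastforce simp: fun_eq_iff split: split_indicator)
  ultimately show i: "integrable lborel f" by simp
  assume "open \<Omega>" "K \<subseteq> \<Omega>"
  then have "(\<integral>x. f x \<partial>lebesgue_on \<Omega>) = (\<integral>x. indicator \<Omega> x *\<^sub>R f x \<partial>lebesgue)"
    by (intro integral_restrict_space) auto
  also have "(\<lambda>x. indicator \<Omega> x *\<^sub>R f x) = f" using assms(3) \<open>K \<subseteq> \<Omega>\<close> by (fastforce simp: fun_eq_iff split: split_indicator)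
  also have "(\<integral>x. f x \<partial>lebesgue) = (\<integral>x. f x \<partial>lborel)" using i by (intro integral_completion) auto
  finally show "(\<integral>x. f x \<partial>lebesgue_on \<Omega>) = (\<integral>x. f x \<partial>lborel)" .
qed

text \<open>By translation invariance the difference quotients have integral zero; they converge
  boundedly to the partial derivative.\<close>

lemma integral_partial_derivative_zero:
  assumes "C1_grad g g'" "compact K" "\<And>x. x \<notin> K \<Longrightarrow> g x = 0"
  shows "(\<integral>x. g' x $ j \<partial>lborel) = 0"
proof -
  let ?d = "axis j 1 :: real^2"
  let ?h = "\<lambda>n. inverse (real (Suc n))"
  let ?q = "\<lambda>n x. (g (x + ?h n *\<^sub>R ?d) - g x) / ?h n"
  have gc: "continuous_on UNIV g" using assms(1) by (rule C1_grad_continuous)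
  have g'c: "continuous_on UNIV g'" using assms(1) by (simp add: C1_grad_def)
  have zero: "g' x = 0" if "x \<notin> K" for x
    using C1_grad_zero_outside[OF assms(1) compact_imp_closed[OF assms(2)] assms(3) that] by blast
  obtain M where M: "M \<ge> 0" "\<And>x. norm (g' x) \<le> M" using bounded_support_bound[OF g'c assms(2) zero] by blast
  have lip: "\<bar>g x - g y\<bar> \<le> M * norm (x - y)" for x y
  proof -
    have "norm (g x - g y) \<le> M * norm (x - y)"
    proof (rule differentiable_bound[of UNIV g "\<lambda>x h. h \<bullet> g' x"])
      show "(g has_derivative (\<lambda>h. h \<bullet> g' x)) (at x within UNIV)" for x
        using assms(1) by (simp add: C1_grad_def gderiv_def)
      show "onorm (\<lambda>h. h \<bullet> g' x) \<le> M" for x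
      proof (rule onorm_le)
        fix h
        have "norm (h \<bullet> g' x) \<le> norm h * norm (g' x)" by (simp add: Cauchy_Schwarz_ineq2)
        also have "\<dots> \<le> norm h * M" using M(2) by (intro mult_left_mono) auto
        finally show "norm (h \<bullet> g' x) \<le> M * norm h" by (simp add: mult.commute)
      qed
    qed auto
    then show ?thesis by simp
  qed
  have int: "integrable lborel g" using compact_support_integral(1)[OF gc assms(2,3)] .
  have shift: "integrable lborel (\<lambda>x. g (x + c))" "(\<integral>x. g (x + c) \<partial>lborel) = (\<integral>x. g x \<partial>lborel)" for c
  proof -
    have *: "distr lborel borel (\<lambda>x. x + c) = lborel"
      using lborel_distr_plus[of c] by (simp add: add.commute[of _ c])
    have gm: "g \<in> borel_measurable borel" using gc by (rule borel_measurable_continuous_onI)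
    have "integrable (distr lborel borel (\<lambda>x. x + c)) g" using int by (simp only: *)
    then show "integrable lborel (\<lambda>x. g (x + c))" using gm by (subst (asm) integrable_distr_eq) auto
    have "(\<integral>x. g x \<partial>distr lborel borel (\<lambda>x. x + c)) = (\<integral>x. g (x + c) \<partial>lborel)"
      using gm by (intro integral_distr) auto
    then show "(\<integral>x. g (x + c) \<partial>lborel) = (\<integral>x. g x \<partial>lborel)" by (simp only: *)
  qed
  obtain R where R: "\<And>x. x \<in> K \<Longrightarrow> norm x \<le> R" using compact_imp_bounded[OF assms(2)] by (auto simp: bounded_iff)
  have nd: "norm (?h n *\<^sub>R ?d) = ?h n" for n by (simp add: norm_axis_1)
  \<comment> \<open>If x lies outside the ball of radius R + 1, both x and its translate are off K,
    because the step is at most 1; otherwise the Lipschitz constant M dominates.\<close>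
  have bound: "norm (?q n x) \<le> indicator (cball 0 (R + 1)) x *\<^sub>R M" for n x
  proof (cases "x \<in> K \<or> x + ?h n *\<^sub>R ?d \<in> K")
    case True
    have "norm x \<le> R + 1"
    proof (cases "x \<in> K")
      case False
      then have "norm (x + ?h n *\<^sub>R ?d) \<le> R" using True R by blast
      moreover have "norm x \<le> norm (x + ?h n *\<^sub>R ?d) + norm (?h n *\<^sub>R ?d)"
        using norm_triangle_ineq4[of "x + ?h n *\<^sub>R ?d" "?h n *\<^sub>R ?d"] by simp
      moreover have "?h n \<le> 1" by (simp add: field_simps)
      ultimately show ?thesis using nd[of n] by linarith
    qed (use R in force)
    moreover have "\<bar>?q n x\<bar> \<le> M"
      using lip[of "x + ?h n *\<^sub>R ?d" x] nd[of n] by (simp add: abs_divide divide_le_eq)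
    ultimately show ?thesis by (simp add: indicator_def)
  next
    case False
    then show ?thesis using assms(3) M by (simp add: indicator_def)
  qed
  have qint: "integrable lborel (?q n)" for n using shift(1) int by (intro integrable_divide Bochner_Integration.integrable_diff)
  have "(\<lambda>n. (\<integral>x. ?q n x \<partial>lborel)) \<longlonglongrightarrow> (\<integral>x. g' x $ j \<partial>lborel)"
  proof (rule integral_dominated_convergence)
    show "(\<lambda>x. g' x $ j) \<in> borel_measurable lborel"
      using g'c by (auto intro!: borel_measurable_continuous_onI continuous_intros)
    show "?q n \<in> borel_measurable lborel" for n using qint by blast
    show "integrable lborel (\<lambda>x. indicator (cball 0 (R + 1)) x *\<^sub>R M)"
      by (rule borel_integrable_compact) auto
    show "AE x in lborel. norm (?q n x) \<le> indicator (cball 0 (R + 1)) x *\<^sub>R M" for n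
      using bound by simp
    have "(\<lambda>n. ?q n x) \<longlonglongrightarrow> g' x $ j" for x
    proof -
      have "(g has_derivative (\<lambda>h. h \<bullet> g' x)) (at x)" using assms(1) by (simp add: C1_grad_def gderiv_def)
      moreover have "((\<lambda>t. x + t *\<^sub>R ?d) has_derivative (\<lambda>t. t *\<^sub>R ?d)) (at 0)"
        by (auto intro!: derivative_eq_intros)
      ultimately have "((\<lambda>t. g (x + t *\<^sub>R ?d)) has_derivative (\<lambda>t. (t *\<^sub>R ?d) \<bullet> g' x)) (at 0)"
        using has_derivative_compose[of "\<lambda>t. x + t *\<^sub>R ?d" _ "0::real" UNIV g "\<lambda>h. h \<bullet> g' x"] by (simp del: inner_scaleR_left)
      then have "((\<lambda>t. g (x + t *\<^sub>R ?d)) has_real_derivative (?d \<bullet> g' x)) (at 0)"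
        by (rule has_derivative_imp_has_field_derivative) (simp add: mult.commute)
      then have "((\<lambda>t. (g (x + t *\<^sub>R ?d) - g x) / t) \<longlongrightarrow> ?d \<bullet> g' x) (at 0)"
        by (simp add: DERIV_def)
      moreover have "filterlim ?h (at 0) sequentially"
        using LIMSEQ_inverse_real_of_nat by (auto simp: filterlim_at)
      ultimately have "(\<lambda>n. ?q n x) \<longlonglongrightarrow> ?d \<bullet> g' x" by (rule filterlim_compose)
      then show ?thesis by (simp add: inner_axis')
    qed
    then show "AE x in lborel. (\<lambda>n. ?q n x) \<longlonglongrightarrow> g' x $ j" by simp
  qed
  moreover have "(\<integral>x. ?q n x \<partial>lborel) = 0" for n
    using shift int by (simp add: Bochner_Integration.integral_diff)
  ultimately show ?thesis by (simp add: LIMSEQ_const_iff)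
qed

definition test_fun :: "(real^2) set \<Rightarrow> (real^2 \<Rightarrow> real) \<Rightarrow> (real^2 \<Rightarrow> real^2) \<Rightarrow> bool" where
  "test_fun \<Omega> \<phi> \<phi>' \<longleftrightarrow> C1_grad \<phi> \<phi>' \<and> (\<exists>K. compact K \<and> K \<subseteq> \<Omega> \<and> (\<forall>x. x \<notin> K \<longrightarrow> \<phi> x = 0))"

lemma is_weak_grad_iff:
  "is_weak_grad \<Omega> v G \<longleftrightarrow> (\<forall>\<phi> \<phi>' i j. test_fun \<Omega> \<phi> \<phi>' \<longrightarrow>
     (\<integral>x. v x $ i * \<phi>' x $ j \<partial>lebesgue_on \<Omega>) = - (\<integral>x. G x $ i $ j * \<phi> x \<partial>lebesgue_on \<Omega>))"
  unfolding is_weak_grad_def test_fun_def C1_grad_def by auto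

text \<open>Integration by parts: the product of a component of v with \<phi> has compact support,
  so its partial derivative integrates to zero, and the product rule splits that integral.\<close>

lemma C1_is_weak_grad:
  assumes "open \<Omega>" "\<And>i. C1_grad (\<lambda>x. v x $ i) (\<lambda>x. G x $ i)"
  shows "is_weak_grad \<Omega> v G"
  unfolding is_weak_grad_iff
proof (intro allI impI)
  fix \<phi> \<phi>' i j assume "test_fun \<Omega> \<phi> \<phi>'"
  then obtain K where \<phi>: "C1_grad \<phi> \<phi>'" and K: "compact K" "K \<subseteq> \<Omega>" "\<And>x. x \<notin> K \<Longrightarrow> \<phi> x = 0"
    by (auto simp: test_fun_def)
  have z: "\<phi>' x = 0" if "x \<notin> K" for x
    using C1_grad_zero_outside[OF \<phi> compact_imp_closed[OF K(1)] K(3) that] .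
  note c [continuous_intros] = C1_grad_continuous[OF assms(2)] C1_grad_continuous[OF \<phi>]
  have c' [continuous_intros]: "continuous_on UNIV (\<lambda>x. G x $ i)" "continuous_on UNIV \<phi>'"
    using assms(2) \<phi> by (auto simp: C1_grad_def)
  have 1: "integrable lborel (\<lambda>x. v x $ i * \<phi>' x $ j)"
    "(\<integral>x. v x $ i * \<phi>' x $ j \<partial>lebesgue_on \<Omega>) = (\<integral>x. v x $ i * \<phi>' x $ j \<partial>lborel)"
    by (rule compact_support_integral[of _ K]; auto simp: z K assms(1) intro!: continuous_intros)+
  have 2: "integrable lborel (\<lambda>x. G x $ i $ j * \<phi> x)"
    "(\<integral>x. G x $ i $ j * \<phi> x \<partial>lebesgue_on \<Omega>) = (\<integral>x. G x $ i $ j * \<phi> x \<partial>lborel)"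
    by (rule compact_support_integral[of _ K]; auto simp: z K assms(1) intro!: continuous_intros)+
  have "(\<integral>x. (v x $ i *\<^sub>R \<phi>' x + \<phi> x *\<^sub>R G x $ i) $ j \<partial>lborel) = 0"
    by (rule integral_partial_derivative_zero[OF C1_grad_mult[OF assms(2) \<phi>] K(1)]) (simp add: K(3))
  then have "(\<integral>x. v x $ i * \<phi>' x $ j + G x $ i $ j * \<phi> x \<partial>lborel) = 0"
    by (simp add: mult.commute)
  then show "(\<integral>x. v x $ i * \<phi>' x $ j \<partial>lebesgue_on \<Omega>) = - (\<integral>x. G x $ i $ j * \<phi> x \<partial>lebesgue_on \<Omega>)"
    using 1 2 by simp
qed

section \<open>Bump functions and approximation of indicators\<close>

lemma DERIV_max_square: "((\<lambda>s. (max 0 s)\<^sup>2) has_real_derivative 2 * max 0 s) (at s)"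
proof -
  consider "s > 0" | "s < 0" | "s = 0" by linarith
  then show ?thesis
  proof cases
    case 1
    have "((\<lambda>s. s\<^sup>2) has_real_derivative 2 * max 0 s) (at s)"
      using 1 by (auto intro!: derivative_eq_intros)
    then show ?thesis
      by (rule has_field_derivative_transform_within_open[of _ _ _ "{0<..}"]) (use 1 in auto)
  next
    case 2
    have "((\<lambda>s. 0) has_real_derivative 2 * max 0 s) (at s)"
      using 2 by (auto intro!: derivative_eq_intros)
    then show ?thesis
      by (rule has_field_derivative_transform_within_open[of _ _ _ "{..<0}"]) (use 2 in auto)
  next
    case 3
    \<comment> \<open>At the kink the difference quotient is at most the absolute value of h;
      squaring has removed the jump of the derivative.\<close>
    have "((\<lambda>h::real. (max 0 h)\<^sup>2 / h) \<longlongrightarrow> 0) (at 0)"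
    proof (rule Lim_null_comparison)
      show "\<forall>\<^sub>F h::real in at 0. norm ((max 0 h)\<^sup>2 / h) \<le> \<bar>h\<bar>"
        by (auto simp: max_def power2_eq_square)
      show "((\<lambda>h::real. \<bar>h\<bar>) \<longlongrightarrow> 0) (at 0)" by (auto intro!: tendsto_eq_intros)
    qed
    then show ?thesis using 3 by (simp add: DERIV_def)
  qed
qed

text \<open>The squared positive part of r^2 - |x - c|^2 is supported in the ball of radius r, and
  one continuous derivative is all that \<open>test_fun\<close> asks.\<close>

lemma test_fun_bump:
  assumes "open W" "c \<in> W"
  obtains \<phi> \<phi>' where "test_fun W \<phi> \<phi>'" "\<And>x. 0 \<le> \<phi> x" "0 < \<phi> c"
proof -
  obtain r where r: "r > 0" "cball c r \<subseteq> W" using assms open_contains_cball by blast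
  have "C1_grad (\<lambda>x. r\<^sup>2 - (x - c) \<bullet> (x - c)) (\<lambda>x. - 2 *\<^sub>R (x - c))"
    unfolding C1_grad_def gderiv_def
    by (auto intro!: derivative_eq_intros continuous_intros simp: inner_commute algebra_simps)
  then have "C1_grad (\<lambda>x. (max 0 (r\<^sup>2 - (x - c) \<bullet> (x - c)))\<^sup>2)
      (\<lambda>x. (2 * max 0 (r\<^sup>2 - (x - c) \<bullet> (x - c))) *\<^sub>R (- 2 *\<^sub>R (x - c)))"
    by (rule C1_grad_compose[where h="\<lambda>s. (max 0 s)\<^sup>2" and h'="\<lambda>s. 2 * max 0 s"])
      (auto intro!: DERIV_max_square continuous_on_mult continuous_on_const continuous_on_max continuous_on_id)
  moreover have "(max 0 (r\<^sup>2 - (x - c) \<bullet> (x - c)))\<^sup>2 = 0" if "x \<notin> cball c r" for x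
  proof -
    have "r\<^sup>2 \<le> (norm (x - c))\<^sup>2"
      using that r by (intro power_mono) (auto simp: dist_norm norm_minus_commute)
    then show ?thesis by (simp add: power2_norm_eq_inner)
  qed
  ultimately have "test_fun W (\<lambda>x. (max 0 (r\<^sup>2 - (x - c) \<bullet> (x - c)))\<^sup>2)
      (\<lambda>x. (2 * max 0 (r\<^sup>2 - (x - c) \<bullet> (x - c))) *\<^sub>R (- 2 *\<^sub>R (x - c)))"
    using r unfolding test_fun_def by (intro conjI exI[of _ "cball c r"]) auto
  then show ?thesis by (rule that) (use r in auto)
qed

lemma test_fun_sum:
  assumes "\<And>k. k \<in> I \<Longrightarrow> test_fun W (\<phi> k) (\<phi>' k)" "finite I"
  shows "test_fun W (\<lambda>x. \<Sum>k\<in>I. \<phi> k x) (\<lambda>x. \<Sum>k\<in>I. \<phi>' k x)"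
proof -
  obtain K where K: "\<And>k. k \<in> I \<Longrightarrow> compact (K k) \<and> K k \<subseteq> W \<and> (\<forall>x. x \<notin> K k \<longrightarrow> \<phi> k x = 0)"
    using assms(1) unfolding test_fun_def by metis
  show ?thesis
    unfolding test_fun_def
  proof (intro conjI exI[of _ "\<Union>k\<in>I. K k"])
    show "C1_grad (\<lambda>x. \<Sum>k\<in>I. \<phi> k x) (\<lambda>x. \<Sum>k\<in>I. \<phi>' k x)"
      using assms(1) by (intro C1_grad_sum) (simp add: test_fun_def)
    show "compact (\<Union>k\<in>I. K k)" using K assms(2) by (intro compact_UN) blast+
    show "(\<Union>k\<in>I. K k) \<subseteq> W" using K by blast
    show "\<forall>x. x \<notin> (\<Union>k\<in>I. K k) \<longrightarrow> (\<Sum>k\<in>I. \<phi> k x) = 0"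
      using K by (intro allI impI sum.neutral) blast
  qed
qed

text \<open>The map s -> m s / (1 + m s) sends 0 to 0, which keeps the support, and takes [0,
  \<infinity>) into [0, 1); as m grows it tends to 1 wherever \<phi> is positive.\<close>

lemma test_fun_saturate:
  assumes "test_fun W \<phi> \<phi>'" "\<And>x. 0 \<le> \<phi> x" "m \<ge> (0::real)"
  shows "test_fun W (\<lambda>x. m * \<phi> x / (1 + m * \<phi> x)) (\<lambda>x. (m / (1 + m * \<phi> x)\<^sup>2) *\<^sub>R \<phi>' x)"
proof -
  have p: "1 + m * s > 0" if "s \<in> range \<phi>" for s
    using that assms by (auto intro!: add_pos_nonneg)
  have "C1_grad (\<lambda>x. m * \<phi> x / (1 + m * \<phi> x)) (\<lambda>x. (m / (1 + m * \<phi> x)\<^sup>2) *\<^sub>R \<phi>' x)"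
  proof (rule C1_grad_compose[where h="\<lambda>s. m * s / (1 + m * s)" and h'="\<lambda>s. m / (1 + m * s)\<^sup>2"])
    show "C1_grad \<phi> \<phi>'" using assms(1) by (simp add: test_fun_def)
    show "((\<lambda>s. m * s / (1 + m * s)) has_real_derivative m / (1 + m * \<phi> x)\<^sup>2) (at (\<phi> x))" for x
      using p[of "\<phi> x"] by (auto intro!: derivative_eq_intros simp: power2_eq_square field_simps)
    show "continuous_on (range \<phi>) (\<lambda>s. m / (1 + m * s)\<^sup>2)"
      using p by (intro continuous_intros) (metis less_irrefl zero_eq_power2)
  qed
  then show ?thesis using assms(1) by (auto simp: test_fun_def)
qed

lemma test_fun_mono: "test_fun W \<phi> \<phi>' \<Longrightarrow> W \<subseteq> \<Omega> \<Longrightarrow> test_fun \<Omega> \<phi> \<phi>'"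
  unfolding test_fun_def by (meson order_trans)

lemma test_fun_continuous:
  assumes "test_fun W \<phi> \<phi>'"
  shows "continuous_on UNIV \<phi>" "continuous_on UNIV \<phi>'"
proof -
  have "C1_grad \<phi> \<phi>'" using assms by (simp add: test_fun_def)
  then show "continuous_on UNIV \<phi>" "continuous_on UNIV \<phi>'"
    by (rule C1_grad_continuous, simp add: C1_grad_def)
qed

text \<open>The functions \<open>n \<Phi>\<^sub>n / (1 + n \<Phi>\<^sub>n)\<close>, with \<open>\<Phi>\<^sub>n\<close> a sum of bump functions
  whose positivity sets exhaust \<open>W\<close>.\<close>

lemma open_indicator_test_fun_limit:
  assumes "open W"
  obtains \<phi> \<phi>' where "\<And>n. test_fun W (\<phi> n) (\<phi>' n)" "\<And>n x. \<bar>\<phi> n x\<bar> \<le> 1"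
    "\<And>x. (\<lambda>n :: nat. \<phi> n x) \<longlonglongrightarrow> indicator W x"
proof (cases "W = {}")
  case True
  have "test_fun W (\<lambda>x. 0) (\<lambda>x. 0)"
    unfolding test_fun_def by (auto intro: C1_grad_const)
  then show ?thesis using True by (intro that[of "\<lambda>n x. 0" "\<lambda>n x. 0"]) auto
next
  case False
  have "\<exists>\<psi> \<psi>'. test_fun W \<psi> \<psi>' \<and> (\<forall>y. 0 \<le> \<psi> y) \<and> 0 < \<psi> x" if "x \<in> W" for x
    using test_fun_bump[OF assms that] by metis
  then obtain \<psi> \<psi>' where \<psi>: "\<And>x. x \<in> W \<Longrightarrow> test_fun W (\<psi> x) (\<psi>' x)"
    "\<And>x y. x \<in> W \<Longrightarrow> 0 \<le> \<psi> x y" "\<And>x. x \<in> W \<Longrightarrow> 0 < \<psi> x x" by metis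
  let ?U = "\<lambda>x. {y. 0 < \<psi> x y}"
  have "open (?U x)" if "x \<in> W" for x
    using test_fun_continuous(1)[OF \<psi>(1)[OF that]] by (intro open_Collect_less) auto
  then have "\<And>S. S \<in> ?U ` W \<Longrightarrow> open S" by auto
  \<comment> \<open>Lindelof makes the cover of W by positivity sets countable, so that finite sums
    of bumps eventually reach every point of W.\<close>
  then obtain \<F> where \<F>: "\<F> \<subseteq> ?U ` W" "countable \<F>" "\<Union>\<F> = \<Union>(?U ` W)"
    using Lindelof[of "?U ` W"] by metis
  then obtain X where X: "X \<subseteq> W" "countable X" "\<F> = ?U ` X"
    by (metis countable_subset_image)
  have cov: "W \<subseteq> (\<Union>x\<in>X. ?U x)" using \<F>(3) X(3) \<psi>(3) by auto
  then have "X \<noteq> {}" using False by auto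
  \<comment> \<open>The enumeration may repeat points of X, as it must if X is finite; a repetition
    only enlarges the sum.\<close>
  define e where "e = from_nat_into X"
  have e: "e k \<in> W" for k using from_nat_into[OF \<open>X \<noteq> {}\<close>] X(1) by (auto simp: e_def)
  define \<Phi> where "\<Phi> n y = (\<Sum>k<n. \<psi> (e k) y)" for n y
  have \<Phi>: "test_fun W (\<Phi> n) (\<lambda>y. \<Sum>k<n. \<psi>' (e k) y)" for n
    unfolding \<Phi>_def[abs_def] using \<psi>(1) e by (intro test_fun_sum) auto
  have \<Phi>0: "0 \<le> \<Phi> n y" for n y unfolding \<Phi>_def using \<psi>(2) e by (intro sum_nonneg) auto
  show ?thesis
  proof (rule that)
    show "test_fun W (\<lambda>y. real n * \<Phi> n y / (1 + real n * \<Phi> n y))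
        (\<lambda>y. (real n / (1 + real n * \<Phi> n y)\<^sup>2) *\<^sub>R (\<Sum>k<n. \<psi>' (e k) y))" for n
      by (rule test_fun_saturate[OF \<Phi>]) (auto simp: \<Phi>0)
    show "\<bar>real n * \<Phi> n y / (1 + real n * \<Phi> n y)\<bar> \<le> 1" for n y
    proof -
      have "0 \<le> real n * \<Phi> n y" using \<Phi>0 by simp
      then show ?thesis by simp
    qed
    show "(\<lambda>n. real n * \<Phi> n y / (1 + real n * \<Phi> n y)) \<longlonglongrightarrow> indicator W y" for y
    proof (cases "y \<in> W")
      case True
      then obtain x where x: "x \<in> X" "0 < \<psi> x y" using cov by blast
      then obtain k where k: "x = e k" unfolding e_def using from_nat_into_surj[OF X(2)] by metis
      define c where "c = \<psi> x y"
      have c: "c > 0" using x by (simp add: c_def)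
      \<comment> \<open>Once the bump that is positive at y has entered, all later sums stay above
        its value c, so n times the sum tends to infinity.\<close>
      have ge: "c \<le> \<Phi> n y" if "k < n" for n
        unfolding \<Phi>_def c_def k using that \<psi>(2) e by (intro member_le_sum) auto
      have "(\<lambda>n. 1 - 1 / (1 + real n * \<Phi> n y)) \<longlonglongrightarrow> 1 - 0"
      proof (intro tendsto_diff tendsto_const)
        have "filterlim (\<lambda>n. real n * c) at_top sequentially"
          using c by (intro filterlim_at_top_mult_tendsto_pos[OF tendsto_const] filterlim_real_sequentially)
        then have "filterlim (\<lambda>n. 1 + real n * \<Phi> n y) at_top sequentially"
        proof (rule filterlim_at_top_mono)
          show "\<forall>\<^sub>F n in sequentially. real n * c \<le> 1 + real n * \<Phi> n y"
            using eventually_gt_at_top[of k]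
          proof eventually_elim
            case (elim n)
            then show ?case using mult_left_mono[OF ge[OF elim], of "real n"] by linarith
          qed
        qed
        then show "(\<lambda>n. 1 / (1 + real n * \<Phi> n y)) \<longlonglongrightarrow> 0"
          by (intro tendsto_divide_0[OF tendsto_const] filterlim_at_top_imp_at_infinity)
      qed
      moreover have "1 - 1 / (1 + real n * \<Phi> n y) = real n * \<Phi> n y / (1 + real n * \<Phi> n y)" for n
      proof -
        have "1 + real n * \<Phi> n y > 0" using \<Phi>0 by (auto intro!: add_pos_nonneg)
        then show ?thesis by (simp add: field_simps)
      qed
      ultimately show ?thesis using True by simp
    next
      case False
      then have "\<Phi> n y = 0" for n using \<Phi>[of n] unfolding test_fun_def by blast
      then show ?thesis using False by simp
    qed
  qed
qed

text \<open>The fundamental lemma of the calculus of variations. Test functions approximating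
  indicators give zero integrals of g over open sets; these form an intersection-stable generator of
  the Borel sets, and null sets lead on to all Lebesgue sets. A density with all integrals zero
  vanishes almost everywhere.\<close>

lemma AE_zero_if_test_integrals_zero:
  fixes g :: "real^2 \<Rightarrow> real"
  assumes "open \<Omega>" "integrable (lebesgue_on \<Omega>) g"
    and zero: "\<And>\<phi> \<phi>'. test_fun \<Omega> \<phi> \<phi>' \<Longrightarrow> (\<integral>x. g x * \<phi> x \<partial>lebesgue_on \<Omega>) = 0"
  shows "AE x in lebesgue_on \<Omega>. g x = 0"
proof -
  \<comment> \<open>Extension by zero lets the sets below range over the whole plane.\<close>
  define g0 where "g0 x = indicator \<Omega> x * g x" for x
  have \<Omega>: "\<Omega> \<in> sets lebesgue" using assms(1) by auto
  have g0: "integrable lebesgue g0"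
    using assms(2) \<Omega> unfolding g0_def by (subst (asm) integrable_restrict_space) auto
  have ind: "integrable lebesgue (\<lambda>x. indicator A x * g0 x)" if "A \<in> sets lebesgue" for A
    using integrable_mult_indicator[OF that g0] by simp
  have open_zero: "(\<integral>x. indicator U x * g0 x \<partial>lebesgue) = 0" if "open U" for U
  proof -
    have "open (U \<inter> \<Omega>)" using that assms(1) by auto
    then obtain \<phi> \<phi>' where \<phi>: "\<And>n. test_fun (U \<inter> \<Omega>) (\<phi> n) (\<phi>' n)" "\<And>n x. \<bar>\<phi> n x\<bar> \<le> 1"
      "\<And>x. (\<lambda>n :: nat. \<phi> n x) \<longlonglongrightarrow> indicator (U \<inter> \<Omega>) x"
      using open_indicator_test_fun_limit by blast
    have "(\<lambda>n. (\<integral>x. \<phi> n x * g0 x \<partial>lebesgue)) \<longlonglongrightarrow> (\<integral>x. indicator (U \<inter> \<Omega>) x * g0 x \<partial>lebesgue)"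
    proof (rule integral_dominated_convergence)
      show "(\<lambda>x. indicator (U \<inter> \<Omega>) x * g0 x) \<in> borel_measurable lebesgue"
        using ind[of "U \<inter> \<Omega>"] \<open>open (U \<inter> \<Omega>)\<close> by auto
      have "\<phi> n \<in> borel_measurable lebesgue" for n
        using test_fun_continuous(1)[OF \<phi>(1)]
        by (intro measurable_completion) (simp add: borel_measurable_continuous_onI)
      then show "(\<lambda>x. \<phi> n x * g0 x) \<in> borel_measurable lebesgue" for n
        using g0 by auto
      show "integrable lebesgue (\<lambda>x. \<bar>g0 x\<bar>)" using g0 by simp
      show "AE x in lebesgue. (\<lambda>n. \<phi> n x * g0 x) \<longlonglongrightarrow> indicator (U \<inter> \<Omega>) x * g0 x"
        using \<phi>(3) by (auto intro!: tendsto_intros)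
      show "AE x in lebesgue. norm (\<phi> n x * g0 x) \<le> \<bar>g0 x\<bar>" for n
        using \<phi>(2) by (auto simp: abs_mult intro!: mult_left_le_one_le)
    qed
    moreover have "(\<integral>x. \<phi> n x * g0 x \<partial>lebesgue) = 0" for n
    proof -
      have "(\<integral>x. \<phi> n x * g0 x \<partial>lebesgue) = (\<integral>x. indicator \<Omega> x *\<^sub>R (g x * \<phi> n x) \<partial>lebesgue)"
        by (intro Bochner_Integration.integral_cong) (auto simp: g0_def)
      also have "\<dots> = (\<integral>x. g x * \<phi> n x \<partial>lebesgue_on \<Omega>)"
        using \<Omega> by (intro integral_restrict_space[symmetric]) auto
      also have "\<dots> = 0" using test_fun_mono[OF \<phi>(1)] by (intro zero) auto
      finally show ?thesis .
    qed
    moreover have "indicator (U \<inter> \<Omega>) x * g0 x = indicator U x * g0 x" for x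
      by (auto simp: g0_def indicator_def)
    ultimately show ?thesis by (simp add: LIMSEQ_const_iff)
  qed
  have borel_zero: "(\<integral>x. indicator A x * g0 x \<partial>lebesgue) = 0" if "A \<in> sets borel" for A
  proof -
    have "Int_stable {S :: (real^2) set. open S}" by (auto simp: Int_stable_def)
    moreover have "{S :: (real^2) set. open S} \<subseteq> Pow UNIV" by auto
    moreover have "A \<in> sigma_sets UNIV {S. open S}" using that by (simp add: borel_def)
    ultimately show ?thesis
    proof (induction rule: sigma_sets_induct_disjoint)
      case (basic A)
      then show ?case by (simp add: open_zero)
    next
      case empty
      show ?case by simp
    next
      case (compl A)
      then have "A \<in> sets borel" by (simp add: borel_def)
      then have "(\<integral>x. indicator UNIV x * g0 x - indicator A x * g0 x \<partial>lebesgue) =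
          (\<integral>x. indicator UNIV x * g0 x \<partial>lebesgue) - (\<integral>x. indicator A x * g0 x \<partial>lebesgue)"
        by (intro Bochner_Integration.integral_diff ind) auto
      also have "\<dots> = 0" using compl open_zero[of UNIV] by simp
      finally show ?case
        by (rule trans[rotated]) (auto intro!: Bochner_Integration.integral_cong simp: indicator_def)
    next
      case (union A)
      then have A: "A i \<in> sets borel" for i by (auto simp: borel_def)
      have "(\<lambda>n. (\<integral>x. indicator (\<Union>i<n. A i) x * g0 x \<partial>lebesgue)) \<longlonglongrightarrow>
          (\<integral>x. indicator (\<Union>i. A i) x * g0 x \<partial>lebesgue)"
      proof (rule integral_dominated_convergence)
        show "(\<lambda>x. indicator (\<Union>i. A i) x * g0 x) \<in> borel_measurable lebesgue"
          "(\<lambda>x. indicator (\<Union>i<n. A i) x * g0 x) \<in> borel_measurable lebesgue" for n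
          using A ind by (auto intro!: borel_measurable_integrable)
        show "integrable lebesgue (\<lambda>x. \<bar>g0 x\<bar>)" using g0 by simp
        show "AE x in lebesgue. (\<lambda>n. indicator (\<Union>i<n. A i) x * g0 x) \<longlonglongrightarrow> indicator (\<Union>i. A i) x * g0 x"
          by (intro AE_I2 tendsto_intros LIMSEQ_indicator_UN)
        show "AE x in lebesgue. norm (indicator (\<Union>i<n. A i) x * g0 x) \<le> \<bar>g0 x\<bar>" for n
          by (auto simp: indicator_def)
      qed
      moreover have "(\<integral>x. indicator (\<Union>i<n. A i) x * g0 x \<partial>lebesgue) = 0" for n
      proof -
        have "indicator (\<Union>i<n. A i) x * g0 x = (\<Sum>i<n. indicator (A i) x * g0 x)" for x
          using union(1) by (subst indicator_UN_disjoint)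
            (auto simp: sum_distrib_right intro: disjoint_family_on_mono)
        then have "(\<integral>x. indicator (\<Union>i<n. A i) x * g0 x \<partial>lebesgue) =
            (\<integral>x. (\<Sum>i<n. indicator (A i) x * g0 x) \<partial>lebesgue)"
          by presburger
        also have "\<dots> = (\<Sum>i<n. (\<integral>x. indicator (A i) x * g0 x \<partial>lebesgue))"
          using A by (intro Bochner_Integration.integral_sum ind) auto
        also have "\<dots> = 0" using union.IH by simp
        finally show ?thesis .
      qed
      ultimately show ?case by (simp add: LIMSEQ_const_iff)
    qed
  qed
  have leb_zero: "(\<integral>x\<in>A. g0 x \<partial>lebesgue) = (\<integral>x\<in>A. 0 \<partial>lebesgue)" if A: "A \<in> sets lebesgue" for A
  proof -
    \<comment> \<open>A Lebesgue set exceeds a Borel set only by part of a null set, which the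
      integral does not see.\<close>
    obtain S N N' where "A = S \<union> N" "N \<subseteq> N'" "N' \<in> null_sets lborel" "S \<in> sets lborel"
      using A by (rule sets_completionE)
    note * = this
    have "AE x in lebesgue. x \<notin> N'"
      using *(3) by (intro AE_not_in) (simp add: null_sets_completionI)
    then have "AE x in lebesgue. indicator A x * g0 x = indicator S x * g0 x"
      by eventually_elim (use *(1,2) in \<open>auto simp: indicator_def\<close>)
    then have "(\<integral>x. indicator A x * g0 x \<partial>lebesgue) = (\<integral>x. indicator S x * g0 x \<partial>lebesgue)"
      using ind[OF A] ind[of S] *(4) by (intro integral_cong_AE borel_measurable_integrable) auto
    also have "\<dots> = 0" using \<open>S \<in> sets lborel\<close> by (intro borel_zero) simp
    finally show ?thesis by (simp add: set_lebesgue_integral_def)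
  qed
  have "AE x in lebesgue. g0 x = 0"
    using g0 leb_zero by (intro density_unique_real) auto
  then show ?thesis
    using \<Omega> by (subst AE_restrict_space_iff) (auto simp: g0_def indicator_def)
qed

section \<open>Sobolev functions: uniqueness and linearity of weak gradients\<close>

lemma finite_measure_lebesgue_on_bounded:
  assumes "open \<Omega>" "bounded \<Omega>"
  shows "finite_measure (lebesgue_on (\<Omega> :: (real^2) set))"
  using assms by (intro finite_measure_lebesgue_on lmeasurable_open)

lemma test_fun_sq_integrable:
  assumes "test_fun W \<phi> \<phi>'" "open \<Omega>" "bounded \<Omega>"
  shows "sq_integrable (lebesgue_on \<Omega>) \<phi>" "sq_integrable (lebesgue_on \<Omega>) (\<lambda>x. \<phi>' x $ j)"
proof -
  obtain K where \<phi>: "C1_grad \<phi> \<phi>'" and K: "compact K" "\<And>x. x \<notin> K \<Longrightarrow> \<phi> x = 0"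
    using assms(1) by (auto simp: test_fun_def)
  note z = C1_grad_zero_outside[OF \<phi> compact_imp_closed[OF K(1)] K(2)]
  note c = test_fun_continuous[OF assms(1)]
  obtain M where M: "\<And>x. norm (\<phi> x) \<le> M" using bounded_support_bound[OF c(1) K] by blast
  obtain M' where M': "\<And>x. norm (\<phi>' x) \<le> M'" using bounded_support_bound[OF c(2) K(1) z] by blast
  have m: "f \<in> borel_measurable (lebesgue_on \<Omega>)" if "continuous_on UNIV f" for f :: "real^2 \<Rightarrow> real"
    using that assms(2)
    by (intro continuous_imp_measurable_on_sets_lebesgue) (auto intro: continuous_on_subset)
  show "sq_integrable (lebesgue_on \<Omega>) \<phi>"
    by (rule sq_integrable_bounded[OF finite_measure_lebesgue_on_bounded[OF assms(2,3)] m[OF c(1)] M])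
  have "norm (\<phi>' x $ j) \<le> M'" for x
    using M'[of x] component_le_norm_cart[of "\<phi>' x" j] by simp
  moreover have "continuous_on UNIV (\<lambda>x. \<phi>' x $ j)" using c(2) by (intro continuous_intros)
  ultimately show "sq_integrable (lebesgue_on \<Omega>) (\<lambda>x. \<phi>' x $ j)"
    by (intro sq_integrable_bounded[OF finite_measure_lebesgue_on_bounded[OF assms(2,3)] m])
qed

lemma sq_integrable_vec_nth: "sq_integrable M v \<Longrightarrow> sq_integrable M (\<lambda>x. (v x :: real^'n) $ i)"
  by (rule sq_integrable_linear[where T="\<lambda>y. y $ i"]) (auto intro!: linearI)

lemma sq_integrable_mat_nth: "sq_integrable M G \<Longrightarrow> sq_integrable M (\<lambda>x. (G x :: real^'n^'m) $ i $ j)"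
  by (rule sq_integrable_linear[where T="\<lambda>y. y $ i $ j"]) (auto intro!: linearI)

text \<open>Each entry of G - H integrates to zero against all test functions. Boundedness of
  \<Omega> makes the square integrable entries integrable, as the fundamental lemma
  requires.\<close>

lemma weak_grad_unique:
  assumes "open \<Omega>" "bounded \<Omega>" "is_weak_grad \<Omega> v G" "is_weak_grad \<Omega> v H"
    and "sq_integrable (lebesgue_on \<Omega>) G" "sq_integrable (lebesgue_on \<Omega>) H"
  shows "AE x in lebesgue_on \<Omega>. G x = H x"
proof -
  have fm: "finite_measure (lebesgue_on \<Omega>)" by (rule finite_measure_lebesgue_on_bounded[OF assms(1,2)])
  have "AE x in lebesgue_on \<Omega>. G x $ i $ j - H x $ i $ j = 0" for i j
  proof (rule AE_zero_if_test_integrals_zero[OF assms(1)])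
    note G = sq_integrable_mat_nth[OF assms(5), of i j] and H = sq_integrable_mat_nth[OF assms(6), of i j]
    show "integrable (lebesgue_on \<Omega>) (\<lambda>x. G x $ i $ j - H x $ i $ j)"
      using sq_integrable_imp_integrable[OF fm] G H by (intro Bochner_Integration.integrable_diff) auto
    fix \<phi> \<phi>' assume \<phi>: "test_fun \<Omega> \<phi> \<phi>'"
    have "integrable (lebesgue_on \<Omega>) (\<lambda>x. G x $ i $ j * \<phi> x)" "integrable (lebesgue_on \<Omega>) (\<lambda>x. H x $ i $ j * \<phi> x)"
      using sq_integrable_inner[OF G test_fun_sq_integrable(1)[OF \<phi> assms(1,2)]]
        sq_integrable_inner[OF H test_fun_sq_integrable(1)[OF \<phi> assms(1,2)]] by simp_all
    moreover have "(\<integral>x. G x $ i $ j * \<phi> x \<partial>lebesgue_on \<Omega>) = (\<integral>x. H x $ i $ j * \<phi> x \<partial>lebesgue_on \<Omega>)"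
      using assms(3,4) \<phi> unfolding is_weak_grad_iff by fastforce
    ultimately show "(\<integral>x. (G x $ i $ j - H x $ i $ j) * \<phi> x \<partial>lebesgue_on \<Omega>) = 0"
      by (simp add: left_diff_distrib)
  qed
  then have "AE x in lebesgue_on \<Omega>. \<forall>i j. G x $ i $ j - H x $ i $ j = 0"
    by (simp add: AE_all_countable)
  then show ?thesis by eventually_elim (simp add: vec_eq_iff)
qed

lemma is_weak_grad_lincomb:
  assumes "open \<Omega>" "bounded \<Omega>" "is_weak_grad \<Omega> u G" "is_weak_grad \<Omega> v H"
    and "sq_integrable (lebesgue_on \<Omega>) u" "sq_integrable (lebesgue_on \<Omega>) v"
    and "sq_integrable (lebesgue_on \<Omega>) G" "sq_integrable (lebesgue_on \<Omega>) H"
  shows "is_weak_grad \<Omega> (\<lambda>x. c *\<^sub>R u x + d *\<^sub>R v x) (\<lambda>x. c *\<^sub>R G x + d *\<^sub>R H x)"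
  unfolding is_weak_grad_iff
proof (intro allI impI)
  fix \<phi> \<phi>' i j assume \<phi>: "test_fun \<Omega> \<phi> \<phi>'"
  note s = test_fun_sq_integrable[OF \<phi> assms(1,2)]
  have lin: "(\<integral>x. (c * f x + d * g x) * h x \<partial>lebesgue_on \<Omega>) =
      c * (\<integral>x. f x * h x \<partial>lebesgue_on \<Omega>) + d * (\<integral>x. g x * h x \<partial>lebesgue_on \<Omega>)"
    if "sq_integrable (lebesgue_on \<Omega>) f" "sq_integrable (lebesgue_on \<Omega>) g" "sq_integrable (lebesgue_on \<Omega>) h"
    for f g h :: "real^2 \<Rightarrow> real"
  proof -
    have "(\<lambda>x. c *\<^sub>R f x + d *\<^sub>R g x) \<in> borel_measurable (lebesgue_on \<Omega>)"
      using sq_integrable_lincomb[OF that(1,2), of c d] by (simp add: sq_integrable_def)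
    from inner_integral_lincomb[OF that this, of c d]
    show ?thesis by (simp add: mult.commute)
  qed
  have "(\<integral>x. (c * u x $ i + d * v x $ i) * \<phi>' x $ j \<partial>lebesgue_on \<Omega>) =
    c * - (\<integral>x. G x $ i $ j * \<phi> x \<partial>lebesgue_on \<Omega>) + d * - (\<integral>x. H x $ i $ j * \<phi> x \<partial>lebesgue_on \<Omega>)"
    using assms(3,4) \<phi> unfolding is_weak_grad_iff
    by (subst lin) (auto simp: sq_integrable_vec_nth assms s)
  also have "\<dots> = - (\<integral>x. (c * G x $ i $ j + d * H x $ i $ j) * \<phi> x \<partial>lebesgue_on \<Omega>)"
    by (subst lin) (auto simp: sq_integrable_mat_nth assms s)
  finally show "(\<integral>x. (c *\<^sub>R u x + d *\<^sub>R v x) $ i * \<phi>' x $ j \<partial>lebesgue_on \<Omega>) =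
      - (\<integral>x. (c *\<^sub>R G x + d *\<^sub>R H x) $ i $ j * \<phi> x \<partial>lebesgue_on \<Omega>)"
    by simp
qed

lemma H1D:
  assumes "v \<in> H1 \<Omega>"
  shows "sq_integrable (lebesgue_on \<Omega>) v" "sq_integrable (lebesgue_on \<Omega>) (weak_grad \<Omega> v)"
    "is_weak_grad \<Omega> v (weak_grad \<Omega> v)"
proof -
  have "\<exists>G. sq_integrable (lebesgue_on \<Omega>) G \<and> is_weak_grad \<Omega> v G" using assms by (simp add: H1_def)
  from someI_ex[OF this] show "sq_integrable (lebesgue_on \<Omega>) (weak_grad \<Omega> v)"
    "is_weak_grad \<Omega> v (weak_grad \<Omega> v)" by (simp_all add: weak_grad_def)
qed (use assms in \<open>simp add: H1_def\<close>)

text \<open>\<open>weak_grad\<close> is chosen separately for each function, so linearity cannot be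
  expected pointwise; uniqueness supplies it almost everywhere.\<close>

lemma H1_lincomb:
  assumes "open \<Omega>" "bounded \<Omega>" "u \<in> H1 \<Omega>" "v \<in> H1 \<Omega>"
  shows "(\<lambda>x. c *\<^sub>R u x + d *\<^sub>R v x) \<in> H1 \<Omega>"
    and "AE x in lebesgue_on \<Omega>. weak_grad \<Omega> (\<lambda>x. c *\<^sub>R u x + d *\<^sub>R v x) x =
      c *\<^sub>R weak_grad \<Omega> u x + d *\<^sub>R weak_grad \<Omega> v x"
proof -
  note u = H1D[OF assms(3)] and v = H1D[OF assms(4)]
  have w: "is_weak_grad \<Omega> (\<lambda>x. c *\<^sub>R u x + d *\<^sub>R v x) (\<lambda>x. c *\<^sub>R weak_grad \<Omega> u x + d *\<^sub>R weak_grad \<Omega> v x)"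
    by (rule is_weak_grad_lincomb[OF assms(1,2) u(3) v(3) u(1) v(1) u(2) v(2)])
  have s: "sq_integrable (lebesgue_on \<Omega>) (\<lambda>x. c *\<^sub>R weak_grad \<Omega> u x + d *\<^sub>R weak_grad \<Omega> v x)"
    using u(2) v(2) by (rule sq_integrable_lincomb)
  show H: "(\<lambda>x. c *\<^sub>R u x + d *\<^sub>R v x) \<in> H1 \<Omega>"
    unfolding H1_def using w s sq_integrable_lincomb[OF u(1) v(1), of c d] by blast
  show "AE x in lebesgue_on \<Omega>. weak_grad \<Omega> (\<lambda>x. c *\<^sub>R u x + d *\<^sub>R v x) x =
      c *\<^sub>R weak_grad \<Omega> u x + d *\<^sub>R weak_grad \<Omega> v x"
    by (rule weak_grad_unique[OF assms(1,2) H1D(3)[OF H] w H1D(2)[OF H] s])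
qed

lemma continuous_sq_integrable:
  fixes f :: "real^2 \<Rightarrow> 'b::euclidean_space"
  assumes "open \<Omega>" "bounded \<Omega>" "continuous_on UNIV f"
  shows "sq_integrable (lebesgue_on \<Omega>) f"
proof -
  have "compact (f ` closure \<Omega>)"
    using assms(2,3) by (intro compact_continuous_image) (auto intro: continuous_on_subset)
  then obtain M where M: "\<And>y. y \<in> f ` closure \<Omega> \<Longrightarrow> norm y \<le> M"
    by (meson bounded_iff compact_imp_bounded)
  show ?thesis
  proof (rule sq_integrable_bounded[OF finite_measure_lebesgue_on_bounded[OF assms(1,2)]])
    show "f \<in> borel_measurable (lebesgue_on \<Omega>)"
      using assms(1,3)
      by (intro continuous_imp_measurable_on_sets_lebesgue) (auto intro: continuous_on_subset)
    show "norm (f x) \<le> M" if "x \<in> space (lebesgue_on \<Omega>)" for x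
      using M[of "f x"] that closure_subset[of \<Omega>] by auto
  qed
qed

lemma continuous_on_vecI:
  fixes f :: "'a::topological_space \<Rightarrow> 'b::real_normed_vector^'n"
  assumes "\<And>i. continuous_on S (\<lambda>x. f x $ i)" shows "continuous_on S f"
  using continuous_on_vec_lambda[of S "\<lambda>i x. f x $ i"] assms by simp

lemma C1_in_H1:
  assumes "open \<Omega>" "bounded \<Omega>" "\<And>i. C1_grad (\<lambda>x. v x $ i) (\<lambda>x. G x $ i)"
  shows "v \<in> H1 \<Omega>"
proof -
  have "continuous_on UNIV v"
    using C1_grad_continuous[OF assms(3)] by (rule continuous_on_vecI)
  moreover have "continuous_on UNIV G"
  proof (rule continuous_on_vecI)
    show "continuous_on UNIV (\<lambda>x. G x $ i)" for i using assms(3) by (simp only: C1_grad_def)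
  qed
  ultimately have "sq_integrable (lebesgue_on \<Omega>) v" "sq_integrable (lebesgue_on \<Omega>) G"
    using continuous_sq_integrable[OF assms(1,2)] by auto
  then show ?thesis
    using C1_is_weak_grad[OF assms(1,3)] by (auto simp: H1_def)
qed

section \<open>Networks and quadrature forms\<close>

text \<open>C1 on the whole plane and not only on \<Omega>: boundary values are then plain
  restrictions, and derivatives exist at every centroid, although a cell or boundary element need
  not contain its own.\<close>

definition C1_vec :: "(real^2 \<Rightarrow> real^2) \<Rightarrow> bool" where
  "C1_vec v \<longleftrightarrow> (\<exists>G. \<forall>i. C1_grad (\<lambda>x. v x $ i) (\<lambda>x. G x $ i))"

lemma C1_grad_nth: "C1_grad (\<lambda>x. x $ i) (\<lambda>x. axis i 1)"
  unfolding C1_grad_def gderiv_def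
  by (auto simp: inner_axis intro!: bounded_linear_imp_has_derivative bounded_linear_vec_nth)

lemma C1_grad_layer:
  assumes "\<tau> C1_differentiable_on UNIV"
  shows "\<exists>g'. C1_grad (\<lambda>x. layer \<tau> n \<omega> b x j i) g'"
proof (induction j arbitrary: i)
  case 0
  show ?case using C1_grad_nth by auto
next
  case (Suc j)
  then obtain g' where g': "\<And>k. C1_grad (\<lambda>x. layer \<tau> n \<omega> b x j k) (g' k)" by metis
  obtain D where D: "\<And>x. (\<tau> has_vector_derivative D x) (at x)" "continuous_on UNIV D"
    using assms unfolding C1_differentiable_on_def by auto
  \<comment> \<open>Subtracting the bias is written as adding its negative, so that
    \<open>C1_grad_add\<close> applies; the zeros in the gradient below belong to the constant
    weights and bias.\<close>
  let ?s = "\<lambda>x. (\<Sum>k = 1..n j. \<omega> (Suc j) i k * layer \<tau> n \<omega> b x j k) + - b (Suc j) i"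
  have "C1_grad ?s (\<lambda>x. (\<Sum>k = 1..n j. \<omega> (Suc j) i k *\<^sub>R g' k x + layer \<tau> n \<omega> b x j k *\<^sub>R 0) + 0)"
    by (intro C1_grad_add C1_grad_sum C1_grad_mult C1_grad_const g')
  then obtain s' where s': "C1_grad ?s s'" by blast
  have "C1_grad (\<lambda>x. \<tau> (?s x)) (\<lambda>x. D (?s x) *\<^sub>R s' x)"
  proof (rule C1_grad_compose[OF s'])
    show "(\<tau> has_real_derivative D (?s x)) (at (?s x))" for x
      using D(1) by (simp only: has_real_derivative_iff_has_vector_derivative)
    show "continuous_on (range ?s) D" using D(2) by (rule continuous_on_subset) simp
  qed
  then show ?case by auto
qed

lemma C1_vec_network:
  assumes "\<tau> C1_differentiable_on UNIV" "v \<in> networks \<tau> n l"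
  shows "C1_vec v"
proof -
  obtain \<omega> b where v: "v = network \<tau> n l \<omega> b" using assms(2) by (auto simp: networks_def)
  define out where "out x i = (\<Sum>k = 1..n (l - 1). \<omega> l i k * layer \<tau> n \<omega> b x (l - 1) k) + - b l i"
    for x and i :: nat
  obtain g' where g': "\<And>k. C1_grad (\<lambda>x. layer \<tau> n \<omega> b x (l - 1) k) (g' k)"
    using C1_grad_layer[OF assms(1)] by metis
  define s' where "s' i x = (\<Sum>k = 1..n (l - 1). \<omega> l i k *\<^sub>R g' k x + layer \<tau> n \<omega> b x (l - 1) k *\<^sub>R 0) + 0"
    for i :: nat and x
  have s': "C1_grad (\<lambda>x. out x i) (s' i)" for i
    unfolding out_def s'_def[abs_def] by (intro C1_grad_add C1_grad_sum C1_grad_mult C1_grad_const g')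
  define G :: "real^2 \<Rightarrow> real^2^2" where "G x = vector [s' 1 x, s' 2 x]" for x
  have "(\<lambda>x. v x $ 1) = (\<lambda>x. out x 1)" "(\<lambda>x. v x $ 2) = (\<lambda>x. out x 2)"
    "(\<lambda>x. G x $ 1) = s' 1" "(\<lambda>x. G x $ 2) = s' 2"
    by (simp_all add: fun_eq_iff v network_def out_def Let_def G_def)
  then have "C1_grad (\<lambda>x. v x $ 1) (\<lambda>x. G x $ 1)" "C1_grad (\<lambda>x. v x $ 2) (\<lambda>x. G x $ 2)"
    using s'[of 1] s'[of 2] by (simp_all only:)
  then have "\<forall>i. C1_grad (\<lambda>x. v x $ i) (\<lambda>x. G x $ i)"
    unfolding forall_2 by blast
  then show ?thesis unfolding C1_vec_def by blast
qed

section \<open>Differences of networks\<close>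

lemma sum_double:
  fixes f :: "nat \<Rightarrow> 'a::comm_monoid_add"
  shows "(\<Sum>k = 1..2 * m. f k) = (\<Sum>k = 1..m. f k) + (\<Sum>k = 1..m. f (k + m))"
  using sum.ub_add_nat[of 1 m f m] sum.shift_bounds_cl_nat_ivl[of f 1 m m]
  by (simp add: mult_2 add.commute)

text \<open>The two networks are put side by side; the output layer subtracts.\<close>

lemma network_diff:
  assumes "l \<ge> 1" "u \<in> networks \<tau> n l" "v \<in> networks \<tau> n l"
  shows "(\<lambda>x. u x - v x) \<in> networks \<tau> (double_hidden l n) l"
proof -
  obtain \<omega>1 b1 \<omega>2 b2 where u: "u = network \<tau> n l \<omega>1 b1" and v: "v = network \<tau> n l \<omega>2 b2"
    using assms(2,3) by (auto simp: networks_def)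
  let ?n = "double_hidden l n"
  \<comment> \<open>Hidden layers are block diagonal, except that the first stacks both networks
    over the shared input; the output layer concatenates with a minus sign. The last layer is tested
    first, because for l = 1 the only layer is both first and last, and then the weights are simply
    subtracted.\<close>
  define \<omega> where "\<omega> j i k =
    (if j = l then
       if l = 1 then \<omega>1 l i k - \<omega>2 l i k
       else if k \<le> n (l - 1) then \<omega>1 l i k else - \<omega>2 l i (k - n (l - 1))
     else if j = 1 then
       if i \<le> n 1 then \<omega>1 1 i k else \<omega>2 1 (i - n 1) k
     else if i \<le> n j then
       if k \<le> n (j - 1) then \<omega>1 j i k else 0
     else
       if k \<le> n (j - 1) then 0 else \<omega>2 j (i - n j) (k - n (j - 1)))" for j i k
  define b where "b j i =
    (if j = l then b1 j i - b2 j i else if i \<le> n j then b1 j i else b2 j (i - n j))" for j i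
  \<comment> \<open>Only hidden layers are doubled, hence \<open>Suc j < l\<close>; layer 0 is the
    common input and stays outside the induction.\<close>
  have layer: "layer \<tau> ?n \<omega> b x (Suc j) i =
      (if i \<le> n (Suc j) then layer \<tau> n \<omega>1 b1 x (Suc j) i else layer \<tau> n \<omega>2 b2 x (Suc j) (i - n (Suc j)))"
    if "Suc j < l" for x i j
    using that
  proof (induction j arbitrary: i)
    case 0
    then show ?case by (simp add: \<omega>_def b_def double_hidden_def)
  next
    case (Suc j)
    then have n: "?n (Suc j) = 2 * n (Suc j)" by (simp add: double_hidden_def)
    have IH: "layer \<tau> ?n \<omega> b x (Suc j) k = (if k \<le> n (Suc j) then layer \<tau> n \<omega>1 b1 x (Suc j) k
      else layer \<tau> n \<omega>2 b2 x (Suc j) (k - n (Suc j)))" for k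
      using Suc by simp
    have "(\<Sum>k = 1..?n (Suc j). \<omega> (Suc (Suc j)) i k * layer \<tau> ?n \<omega> b x (Suc j) k) =
      (if i \<le> n (Suc (Suc j)) then \<Sum>k = 1..n (Suc j). \<omega>1 (Suc (Suc j)) i k * layer \<tau> n \<omega>1 b1 x (Suc j) k
       else \<Sum>k = 1..n (Suc j). \<omega>2 (Suc (Suc j)) (i - n (Suc (Suc j))) k * layer \<tau> n \<omega>2 b2 x (Suc j) k)"
      unfolding n sum_double IH using Suc.prems by (simp add: \<omega>_def)
    then show ?case
      unfolding layer.simps(2)[where j = "Suc j"] using Suc.prems by (simp add: b_def del: layer.simps)
  qed
  have "network \<tau> ?n l \<omega> b x = u x - v x" for x
  proof -
    have "(\<Sum>k = 1..?n (l - 1). \<omega> l i k * layer \<tau> ?n \<omega> b x (l - 1) k) =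
      (\<Sum>k = 1..n (l - 1). \<omega>1 l i k * layer \<tau> n \<omega>1 b1 x (l - 1) k) -
      (\<Sum>k = 1..n (l - 1). \<omega>2 l i k * layer \<tau> n \<omega>2 b2 x (l - 1) k)" for i
    proof (cases "l = 1")
      case True
      then show ?thesis
        by (simp add: \<omega>_def double_hidden_def left_diff_distrib sum_subtractf)
    next
      case False
      then obtain j where j: "l = Suc (Suc j)" using assms(1) by (cases l; cases "l - 1") auto
      have n: "?n (l - 1) = 2 * n (l - 1)" using j by (simp add: double_hidden_def)
      show ?thesis
        unfolding n sum_double using layer[of j x] j
        by (simp add: \<omega>_def sum_negf del: layer.simps)
    qed
    then show ?thesis
      unfolding u v network_def Let_def b_def by (simp add: vec_eq_iff forall_2)
  qed
  then have "(\<lambda>x. u x - v x) = network \<tau> ?n l \<omega> b" by (simp add: fun_eq_iff)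
  then show ?thesis unfolding networks_def by blast
qed

section \<open>Linearity of the quadrature forms\<close>

lemma C1_vec_continuous: "C1_vec v \<Longrightarrow> continuous_on UNIV v"
  unfolding C1_vec_def by (blast intro: continuous_on_vecI C1_grad_continuous)

lemma C1_vec_differentiable:
  assumes "C1_vec v" shows "v differentiable (at x)"
  unfolding differentiable_componentwise_within[of v]
proof
  fix e :: "real^2" assume "e \<in> Basis"
  then obtain i where "e = axis i 1" by (auto simp: Basis_vec_def)
  moreover have "(\<lambda>x. v x $ i) differentiable (at x)"
    using assms unfolding C1_vec_def C1_grad_def gderiv_def differentiable_def by blast
  ultimately show "(\<lambda>x. v x \<bullet> e) differentiable (at x)" by (simp add: inner_axis)
qed

lemma linear_strain: "linear strain"
  by (auto intro!: linearI simp: strain_def transpose_def vec_eq_iff algebra_simps)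

lemma linear_trace: "linear (trace :: real^'n^'n \<Rightarrow> real)"
  by (auto intro!: linearI simp: trace_def sum.distrib sum_distrib_left)

lemma matrix_frechet_derivative_lincomb:
  assumes "u differentiable (at x)" "v differentiable (at x)"
  shows "matrix (frechet_derivative (\<lambda>x. c *\<^sub>R u x + d *\<^sub>R v x) (at x)) =
    c *\<^sub>R matrix (frechet_derivative u (at x)) + d *\<^sub>R matrix (frechet_derivative (v :: real^'n \<Rightarrow> real^'m) (at x))"
proof -
  have "((\<lambda>x. c *\<^sub>R u x + d *\<^sub>R v x) has_derivative
      (\<lambda>h. c *\<^sub>R frechet_derivative u (at x) h + d *\<^sub>R frechet_derivative v (at x) h)) (at x)"
    using assms by (intro has_derivative_add has_derivative_scaleR_right) (auto simp: frechet_derivative_works)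
  from frechet_derivative_at[OF this, symmetric] show ?thesis
    by (simp add: matrix_def vec_eq_iff)
qed

text \<open>The arc picked by SOME depends only on the set and the point, so all functions are
  differentiated along the same curve; without an arc all three derivatives are 0.\<close>

lemma deriv_along_lincomb:
  assumes "\<And>x. u differentiable (at x)" "\<And>x. v differentiable (at x)"
  shows "deriv_along \<Gamma> (\<lambda>x. c *\<^sub>R u x + d *\<^sub>R v x) x = c *\<^sub>R deriv_along \<Gamma> u x + d *\<^sub>R deriv_along \<Gamma> v x"
proof (cases "\<exists>p. arc_param \<Gamma> x p")
  case True
  let ?p = "SOME p. arc_param \<Gamma> x p"
  have p: "?p differentiable (at 0)" using someI_ex[OF True] by (simp add: arc_param_def)
  have "(\<lambda>s. u (?p s)) differentiable (at 0)" "(\<lambda>s. v (?p s)) differentiable (at 0)"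
    by (rule differentiable_compose[OF assms(1) p], rule differentiable_compose[OF assms(2) p])
  then have uv: "((\<lambda>s. u (?p s)) has_vector_derivative vector_derivative (\<lambda>s. u (?p s)) (at 0)) (at 0)"
    "((\<lambda>s. v (?p s)) has_vector_derivative vector_derivative (\<lambda>s. v (?p s)) (at 0)) (at 0)"
    by (simp_all only: vector_derivative_works)
  have "((\<lambda>s. c *\<^sub>R u (?p s) + d *\<^sub>R v (?p s)) has_vector_derivative
    c *\<^sub>R vector_derivative (\<lambda>s. u (?p s)) (at 0) + d *\<^sub>R vector_derivative (\<lambda>s. v (?p s)) (at 0)) (at 0)"
    by (intro has_vector_derivative_add bounded_linear.has_vector_derivative[OF bounded_linear_scaleR_right] uv)
  then show ?thesis using True by (simp add: deriv_along_def vector_derivative_at)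
qed (simp add: deriv_along_def)

lemma divdiff_lincomb:
  assumes "C1_vec u" "C1_vec v"
  shows "divdiff \<Gamma>\<^sub>D \<Gamma> (\<lambda>x. c *\<^sub>R u x + d *\<^sub>R v x) x x' = c *\<^sub>R divdiff \<Gamma>\<^sub>D \<Gamma> u x x' + d *\<^sub>R divdiff \<Gamma>\<^sub>D \<Gamma> v x x'"
  using assms by (simp add: divdiff_def deriv_along_lincomb C1_vec_differentiable algebra_simps)

lemma sum_lincomb:
  fixes f g h :: "'a \<Rightarrow> real"
  assumes "\<And>i. i \<in> I \<Longrightarrow> h i = c * f i + d * g i"
  shows "sum h I = c * sum f I + d * sum g I"
  using assms by (simp add: sum.distrib sum_distrib_left)

text \<open>The first argument w is arbitrary, so the same lemma serves the bilinear form with a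
  network and the linear form with the datum \<open>g\<^sub>D\<close>.\<close>

lemma half_ip_quad_lincomb:
  assumes "C1_vec u" "C1_vec v"
  shows "half_ip_quad \<Gamma>\<^sub>D P K \<T> w (\<lambda>x. c *\<^sub>R u x + d *\<^sub>R v x) =
    c * half_ip_quad \<Gamma>\<^sub>D P K \<T> w u + d * half_ip_quad \<Gamma>\<^sub>D P K \<T> w v"
proof -
  let ?S = "\<lambda>v. \<Sum>E\<in>bdry_elems \<T> \<Gamma>\<^sub>D. (w (elem_centroid E) \<bullet> v (elem_centroid E)) * len E"
  let ?D = "\<lambda>v. \<Sum>k = 1..K. \<Sum>E\<in>bdry_elems \<T> (P k). \<Sum>E'\<in>bdry_elems \<T> (P k).
        (divdiff \<Gamma>\<^sub>D (P k) w (elem_centroid E) (elem_centroid E') \<bullet>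
         divdiff \<Gamma>\<^sub>D (P k) v (elem_centroid E) (elem_centroid E')) * len E * len E'"
  have "?S (\<lambda>x. c *\<^sub>R u x + d *\<^sub>R v x) = c * ?S u + d * ?S v"
    by (rule sum_lincomb) (simp add: inner_add_right algebra_simps)
  moreover have "?D (\<lambda>x. c *\<^sub>R u x + d *\<^sub>R v x) = c * ?D u + d * ?D v"
    by (rule sum_lincomb)+ (simp add: divdiff_lincomb[OF assms] inner_add_right algebra_simps)
  ultimately show ?thesis by (simp add: half_ip_quad_def algebra_simps)
qed

lemma half_ip_quad_commute: "half_ip_quad \<Gamma>\<^sub>D P K \<T> u v = half_ip_quad \<Gamma>\<^sub>D P K \<T> v u"
  by (simp add: half_ip_quad_def inner_commute)

lemma form_aT_lincomb:
  assumes "C1_vec u" "C1_vec v"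
  shows "form_aT \<Gamma>\<^sub>D P K \<mu> lam \<gamma>\<^sub>D \<T> w (\<lambda>x. c *\<^sub>R u x + d *\<^sub>R v x) =
    c * form_aT \<Gamma>\<^sub>D P K \<mu> lam \<gamma>\<^sub>D \<T> w u + d * form_aT \<Gamma>\<^sub>D P K \<mu> lam \<gamma>\<^sub>D \<T> w v"
proof -
  let ?G = "\<lambda>v T. matrix (frechet_derivative v (at (cell_centroid T)))"
  let ?S = "\<lambda>v. \<Sum>T\<in>\<T>. (strain (?G w T) \<bullet> strain (?G v T)) * vol T"
  let ?D = "\<lambda>v. \<Sum>T\<in>\<T>. (trace (?G w T) * trace (?G v T)) * vol T"
  have G: "?G (\<lambda>x. c *\<^sub>R u x + d *\<^sub>R v x) T = c *\<^sub>R ?G u T + d *\<^sub>R ?G v T" for T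
    by (intro matrix_frechet_derivative_lincomb C1_vec_differentiable assms)
  have "?S (\<lambda>x. c *\<^sub>R u x + d *\<^sub>R v x) = c * ?S u + d * ?S v"
    by (rule sum_lincomb, unfold G)
      (simp add: linear_add[OF linear_strain] linear_cmul[OF linear_strain] inner_add_right algebra_simps)
  moreover have "?D (\<lambda>x. c *\<^sub>R u x + d *\<^sub>R v x) = c * ?D u + d * ?D v"
    by (rule sum_lincomb, unfold G)
      (simp add: linear_add[OF linear_trace] linear_cmul[OF linear_trace] algebra_simps)
  ultimately show ?thesis
    unfolding form_aT_def half_ip_quad_lincomb[OF assms] by (simp add: algebra_simps)
qed

lemma form_aT_commute: "form_aT \<Gamma>\<^sub>D P K \<mu> lam \<gamma>\<^sub>D \<T> u v = form_aT \<Gamma>\<^sub>D P K \<mu> lam \<gamma>\<^sub>D \<T> v u"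
  unfolding form_aT_def half_ip_quad_commute[of _ _ _ _ u]
  by (simp add: inner_commute mult.commute)

lemma form_fT_lincomb:
  assumes "C1_vec u" "C1_vec v"
  shows "form_fT \<Gamma>\<^sub>D \<Gamma>\<^sub>N P K \<mu> \<gamma>\<^sub>D \<T> f g\<^sub>D g\<^sub>N (\<lambda>x. c *\<^sub>R u x + d *\<^sub>R v x) =
    c * form_fT \<Gamma>\<^sub>D \<Gamma>\<^sub>N P K \<mu> \<gamma>\<^sub>D \<T> f g\<^sub>D g\<^sub>N u + d * form_fT \<Gamma>\<^sub>D \<Gamma>\<^sub>N P K \<mu> \<gamma>\<^sub>D \<T> f g\<^sub>D g\<^sub>N v"
proof -
  let ?S = "\<lambda>v. \<Sum>T\<in>\<T>. (f (cell_centroid T) \<bullet> v (cell_centroid T)) * vol T"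
  let ?N = "\<lambda>v. \<Sum>E\<in>bdry_elems \<T> \<Gamma>\<^sub>N. (g\<^sub>N (elem_centroid E) \<bullet> v (elem_centroid E)) * len E"
  have "?S (\<lambda>x. c *\<^sub>R u x + d *\<^sub>R v x) = c * ?S u + d * ?S v"
    "?N (\<lambda>x. c *\<^sub>R u x + d *\<^sub>R v x) = c * ?N u + d * ?N v"
    by (rule sum_lincomb, simp add: inner_add_right algebra_simps)+
  then show ?thesis
    unfolding form_fT_def half_ip_quad_lincomb[OF assms] by (simp add: algebra_simps)
qed

section \<open>Functions of finite energy\<close>

text \<open>This is what the completion in \<open>surface\<close> is for: the trace of a combination
  is known only almost everywhere, and completeness turns that into measurability.\<close>

lemma complete_measure_measurable_AE:
  assumes "complete_measure M" "f \<in> borel_measurable M" "AE x in M. f x = g x"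
  shows "g \<in> borel_measurable M"
proof (rule borel_measurableI)
  interpret complete_measure M by fact
  fix S :: "'b set" assume "open S"
  then have A: "f -` S \<inter> space M \<in> sets M" using assms(2) by auto
  have "AE x in M. x \<in> f -` S \<inter> space M \<longleftrightarrow> x \<in> g -` S \<inter> space M"
    using assms(3) by eventually_elim auto
  then show "g -` S \<inter> space M \<in> sets M" by (rule in_sets_AE[OF _ A]) auto
qed

lemma complete_measure_surface: "complete_measure (surface \<Gamma>)"
  unfolding surface_def by (rule completion.complete_measure_axioms)

text \<open>The mean value inequality needs a convex set, so it is applied to each component on a
  ball containing S.\<close>

lemma C1_vec_lipschitz:
  assumes "C1_vec v" "bounded S"
  obtains L where "\<And>x y. x \<in> S \<Longrightarrow> y \<in> S \<Longrightarrow> norm (v x - v y) \<le> L * norm (x - y)"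
proof -
  obtain G where G: "\<And>i. C1_grad (\<lambda>x. v x $ i) (\<lambda>x. G x $ i)" using assms(1) by (auto simp: C1_vec_def)
  obtain R where R: "S \<subseteq> cball 0 R" using assms(2) by (auto simp: bounded_iff subset_iff)
  have "\<exists>M. \<forall>x\<in>cball 0 R. \<forall>y\<in>cball 0 R. \<bar>v x $ i - v y $ i\<bar> \<le> M * norm (x - y)" for i
  proof -
    have "continuous_on (cball 0 R) (\<lambda>x. G x $ i)"
      using G[of i] by (auto simp: C1_grad_def intro: continuous_on_subset)
    then have "compact ((\<lambda>x. G x $ i) ` cball 0 R)"
      by (rule compact_continuous_image) simp
    then obtain M where M: "\<And>y. y \<in> (\<lambda>x. G x $ i) ` cball 0 R \<Longrightarrow> norm y \<le> M"
      by (meson bounded_iff compact_imp_bounded)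
    have "norm (v x $ i - v y $ i) \<le> M * norm (x - y)" if "x \<in> cball 0 R" "y \<in> cball 0 R" for x y
    proof (rule differentiable_bound[of "cball 0 R" "\<lambda>x. v x $ i" "\<lambda>x h. h \<bullet> G x $ i"])
      fix z :: "real^2" assume z: "z \<in> cball 0 R"
      show "((\<lambda>x. v x $ i) has_derivative (\<lambda>h. h \<bullet> G z $ i)) (at z within cball 0 R)"
        using G[of i] by (auto simp: C1_grad_def gderiv_def intro: has_derivative_at_withinI)
      show "onorm (\<lambda>h. h \<bullet> G z $ i) \<le> M"
      proof (rule onorm_le)
        fix h
        have "norm (h \<bullet> G z $ i) \<le> norm h * norm (G z $ i)" by (simp add: Cauchy_Schwarz_ineq2)
        also have "\<dots> \<le> norm h * M" using M z by (intro mult_left_mono) auto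
        finally show "norm (h \<bullet> G z $ i) \<le> M * norm h" by (simp add: mult.commute)
      qed
    qed (use that in auto)
    then show ?thesis by (intro exI[of _ M]) auto
  qed
  then obtain M where M: "\<And>i x y. x \<in> cball 0 R \<Longrightarrow> y \<in> cball 0 R \<Longrightarrow> \<bar>v x $ i - v y $ i\<bar> \<le> M i * norm (x - y)"
    by metis
  have "norm (v x - v y) \<le> (\<Sum>i\<in>UNIV. M i) * norm (x - y)" if "x \<in> S" "y \<in> S" for x y
  proof -
    have "norm (v x - v y) \<le> (\<Sum>i\<in>UNIV. \<bar>(v x - v y) $ i\<bar>)" by (rule norm_le_l1_cart)
    also have "\<dots> \<le> (\<Sum>i\<in>UNIV. M i * norm (x - y))"
      using that R by (intro sum_mono) (auto simp only: vector_minus_component intro: M)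
    finally show ?thesis by (simp add: sum_distrib_right)
  qed
  then show ?thesis by (rule that)
qed

text \<open>The value 0 of \<open>gdist\<close> also stands for an infinite geodesic distance, where
  the inequality may fail; hence the premise.\<close>

lemma dist_le_gdist:
  fixes x :: "'a::real_normed_vector"
  assumes "gdist \<Gamma> x y \<noteq> 0" shows "dist x y \<le> gdist \<Gamma> x y"
proof -
  have "geodesic_dist \<Gamma> x y \<noteq> top" using assms by (auto simp: gdist_def)
  then have "geodesic_dist \<Gamma> x y = ennreal (gdist \<Gamma> x y)" by (simp add: gdist_def less_top)
  with dist_le_geodesic_dist[of x y \<Gamma>] have "ennreal (dist x y) \<le> ennreal (gdist \<Gamma> x y)" by simp
  then show ?thesis by (subst (asm) ennreal_le_iff) (simp_all add: gdist_def)
qed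

text \<open>Chords are no longer than geodesics, so the difference quotient of a Lipschitz function
  is bounded; where \<open>gdist\<close> is 0, division by zero makes the quotient 0. On a finite
  measure boundedness suffices.\<close>

lemma (in measurable_gdist) C1_vec_H_half:
  assumes "C1_vec v" "bounded \<Gamma>" shows "v \<in> H_half \<Gamma>"
proof -
  obtain L where L: "\<And>x y. x \<in> \<Gamma> \<Longrightarrow> y \<in> \<Gamma> \<Longrightarrow> norm (v x - v y) \<le> L * norm (x - y)"
    using C1_vec_lipschitz[OF assms] by blast
  have vm: "v \<in> borel_measurable (surface \<Gamma>)"
    using C1_vec_continuous[OF assms(1)] by (intro borel_measurable_surface borel_measurable_continuous_onI)
  have "compact (v ` closure \<Gamma>)"
    using C1_vec_continuous[OF assms(1)] assms(2)
    by (intro compact_continuous_image) (auto intro: continuous_on_subset)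
  then obtain B where B: "\<And>y. y \<in> v ` closure \<Gamma> \<Longrightarrow> norm y \<le> B"
    by (meson bounded_iff compact_imp_bounded)
  have "sq_integrable (surface \<Gamma>) v"
    using B closure_subset[of \<Gamma>] by (intro sq_integrable_bounded[OF finite_surface vm, of B]) auto
  moreover have "sq_integrable (surface \<Gamma> \<Otimes>\<^sub>M surface \<Gamma>) (dquot \<Gamma> v)"
  proof (rule sq_integrable_bounded)
    show "finite_measure (surface \<Gamma> \<Otimes>\<^sub>M surface \<Gamma>)"
      by (rule finite_measure_pair_measure[OF finite_surface finite_surface])
    show "dquot \<Gamma> v \<in> borel_measurable (surface \<Gamma> \<Otimes>\<^sub>M surface \<Gamma>)" by (rule dquot_measurable[OF vm])
    fix p assume "p \<in> space (surface \<Gamma> \<Otimes>\<^sub>M surface \<Gamma>)"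
    then have p: "fst p \<in> \<Gamma>" "snd p \<in> \<Gamma>" by (auto simp: space_pair_measure)
    show "norm (dquot \<Gamma> v p) \<le> max L 0"
    proof (cases "gdist \<Gamma> (fst p) (snd p) = 0")
      case False
      then have g: "dist (fst p) (snd p) \<le> gdist \<Gamma> (fst p) (snd p)" by (rule dist_le_gdist)
      then have pos: "gdist \<Gamma> (fst p) (snd p) > 0" using False zero_le_dist[of "fst p" "snd p"] by linarith
      have "norm (v (fst p) - v (snd p)) \<le> max L 0 * dist (fst p) (snd p)"
        using L[OF p] mult_right_mono[of L "max L 0" "norm (fst p - snd p)"] by (simp add: dist_norm)
      also have "\<dots> \<le> max L 0 * gdist \<Gamma> (fst p) (snd p)" using g by (intro mult_left_mono) auto
      finally show ?thesis using pos by (simp add: dquot_def divide_le_eq)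
    qed (simp add: dquot_def)
  qed
  ultimately show ?thesis by (simp add: H_half_iff)
qed

section \<open>The linear space of finite-energy functions and the exact forms on it\<close>

locale elasticity_domain =
  fixes \<Omega> \<Gamma>\<^sub>D \<Gamma>\<^sub>N :: "(real^2) set"
  assumes lipschitz: "lipschitz_domain \<Omega>"
    and frontier_eq: "frontier \<Omega> = \<Gamma>\<^sub>D \<union> \<Gamma>\<^sub>N"
    and borel_D: "\<Gamma>\<^sub>D \<in> sets borel" and borel_N: "\<Gamma>\<^sub>N \<in> sets borel"
begin

lemma domain_open: "open \<Omega>" and domain_bounded: "bounded \<Omega>"
  using lipschitz by (auto simp: lipschitz_domain_def)

sublocale measurable_gdist \<Gamma>\<^sub>D
  using lipschitz frontier_eq borel_D by (intro lipschitz_domain_measurable_gdist[of \<Omega>]) auto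

lemma finite_surface_N: "finite_measure (surface \<Gamma>\<^sub>N)"
  using lipschitz frontier_eq borel_N by (intro lipschitz_domain_finite_surface[of \<Omega>]) auto

lemma bounded_boundary: "bounded \<Gamma>\<^sub>D" "bounded \<Gamma>\<^sub>N"
  using bounded_closure[OF domain_bounded] frontier_eq
  by (auto simp: frontier_def elim: bounded_subset)

text \<open>The conditions are those tested in \<open>energy_J\<close>, so these are the members of
  \<open>H1\<close> at which the energy is not infinite.\<close>

definition finite_energy :: "(real^2 \<Rightarrow> real^2) \<Rightarrow> bool" where
  "finite_energy v \<longleftrightarrow> v \<in> H1 \<Omega> \<and> (AE x in surface (frontier \<Omega>). \<exists>z. has_trace_at \<Omega> v x z) \<and>
     sq_integrable (surface \<Gamma>\<^sub>N) (bdry_trace \<Omega> v) \<and> bdry_trace \<Omega> v \<in> H_half \<Gamma>\<^sub>D"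

lemma frontier_in_closure: "x \<in> frontier \<Omega> \<Longrightarrow> x \<in> closure \<Omega>"
  by (simp add: frontier_def)

lemma AE_boundary:
  assumes "AE x in surface (frontier \<Omega>). Q x"
  shows "AE x in surface \<Gamma>\<^sub>D. Q x" "AE x in surface \<Gamma>\<^sub>N. Q x"
  using assms borel_D borel_N frontier_eq
  by (auto intro: AE_surface_subset[of _ "frontier \<Omega>"])

text \<open>Wherever both functions have a trace, so has the combination, and uniqueness of the
  trace identifies the definite description in \<open>bdry_trace\<close> with it.\<close>

lemma bdry_trace_lincomb:
  assumes "finite_energy u" "finite_energy v"
  shows "AE x in surface (frontier \<Omega>). has_trace_at \<Omega> (\<lambda>x. c *\<^sub>R u x + d *\<^sub>R v x) x
      (c *\<^sub>R bdry_trace \<Omega> u x + d *\<^sub>R bdry_trace \<Omega> v x) \<and>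
    bdry_trace \<Omega> (\<lambda>x. c *\<^sub>R u x + d *\<^sub>R v x) x = c *\<^sub>R bdry_trace \<Omega> u x + d *\<^sub>R bdry_trace \<Omega> v x"
proof -
  have m: "u \<in> borel_measurable (lebesgue_on \<Omega>)" "v \<in> borel_measurable (lebesgue_on \<Omega>)"
    using assms H1D(1) by (auto simp: finite_energy_def sq_integrable_def)
  have m2: "(\<lambda>x. c *\<^sub>R u x + d *\<^sub>R v x) \<in> borel_measurable (lebesgue_on \<Omega>)"
    using m by simp
  have "AE x in surface (frontier \<Omega>). \<exists>z. has_trace_at \<Omega> u x z"
    "AE x in surface (frontier \<Omega>). \<exists>z. has_trace_at \<Omega> v x z"
    using assms by (auto simp: finite_energy_def)
  with AE_space show ?thesis
  proof eventually_elim
    case (elim x)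
    then have x: "x \<in> closure \<Omega>" by (simp add: frontier_in_closure)
    obtain y z where yz: "has_trace_at \<Omega> u x y" "has_trace_at \<Omega> v x z" using elim by blast
    have "has_trace_at \<Omega> (\<lambda>x. c *\<^sub>R u x + d *\<^sub>R v x) x (c *\<^sub>R y + d *\<^sub>R z)"
      by (rule has_trace_at_lincomb[OF domain_open m yz])
    moreover note bdry_trace_eq[OF domain_open x m2 this] bdry_trace_eq[OF domain_open x m(1) yz(1)]
      bdry_trace_eq[OF domain_open x m(2) yz(2)]
    ultimately show ?case by simp
  qed
qed

lemma finite_energy_trace_measurable:
  assumes "finite_energy v"
  shows "bdry_trace \<Omega> v \<in> borel_measurable (surface \<Gamma>\<^sub>D)" "bdry_trace \<Omega> v \<in> borel_measurable (surface \<Gamma>\<^sub>N)"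
  using assms by (auto simp: finite_energy_def sq_integrable_def H_half_def)

lemma finite_energy_lincomb:
  assumes "finite_energy u" "finite_energy v"
  shows "finite_energy (\<lambda>x. c *\<^sub>R u x + d *\<^sub>R v x)"
proof -
  let ?w = "\<lambda>x. c *\<^sub>R u x + d *\<^sub>R v x"
  note tr = bdry_trace_lincomb[OF assms, of c d]
  have eq: "AE x in surface (frontier \<Omega>). c *\<^sub>R bdry_trace \<Omega> u x + d *\<^sub>R bdry_trace \<Omega> v x = bdry_trace \<Omega> ?w x"
    using tr by eventually_elim simp
  note eqD = AE_boundary(1)[OF eq] and eqN = AE_boundary(2)[OF eq]
  have mD: "bdry_trace \<Omega> ?w \<in> borel_measurable (surface \<Gamma>\<^sub>D)"
    using finite_energy_trace_measurable(1)[OF assms(1)] finite_energy_trace_measurable(1)[OF assms(2)]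
    by (intro complete_measure_measurable_AE[OF complete_measure_surface _ eqD]) simp
  have mN: "bdry_trace \<Omega> ?w \<in> borel_measurable (surface \<Gamma>\<^sub>N)"
    using finite_energy_trace_measurable(2)[OF assms(1)] finite_energy_trace_measurable(2)[OF assms(2)]
    by (intro complete_measure_measurable_AE[OF complete_measure_surface _ eqN]) simp
  have eqD': "AE x in surface \<Gamma>\<^sub>D. bdry_trace \<Omega> ?w x = c *\<^sub>R bdry_trace \<Omega> u x + d *\<^sub>R bdry_trace \<Omega> v x"
    using eqD by eventually_elim simp
  have "?w \<in> H1 \<Omega>"
    using assms by (intro H1_lincomb(1)[OF domain_open domain_bounded]) (auto simp: finite_energy_def)
  moreover have "AE x in surface (frontier \<Omega>). \<exists>z. has_trace_at \<Omega> ?w x z"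
    using tr by eventually_elim blast
  moreover have "sq_integrable (surface \<Gamma>\<^sub>N) (bdry_trace \<Omega> ?w)"
    using assms by (intro sq_integrable_AE_cong[OF sq_integrable_lincomb mN eqN]) (auto simp: finite_energy_def)
  moreover have "bdry_trace \<Omega> ?w \<in> H_half \<Gamma>\<^sub>D"
    using assms by (intro H_half_lincomb[OF _ _ mD eqD']) (auto simp: finite_energy_def)
  ultimately show ?thesis by (simp add: finite_energy_def)
qed

text \<open>By continuity the trace is the restriction at every boundary point, so the boundary
  conditions reduce to boundedness and to \<open>C1_vec_H_half\<close>.\<close>

lemma C1_vec_finite_energy:
  assumes "C1_vec v" shows "finite_energy v"
proof -
  have H1: "v \<in> H1 \<Omega>"
    using assms C1_in_H1[OF domain_open domain_bounded] unfolding C1_vec_def by blast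
  have vc: "continuous_on UNIV v" by (rule C1_vec_continuous[OF assms])
  have m: "v \<in> borel_measurable (lebesgue_on \<Omega>)" using H1D(1)[OF H1] by (simp add: sq_integrable_def)
  have ht: "has_trace_at \<Omega> v x (v x)" if "x \<in> frontier \<Omega>" for x
    using vc that by (intro has_trace_at_continuous domain_open frontier_in_closure)
      (auto simp: continuous_on_eq_continuous_at)
  have tr: "bdry_trace \<Omega> v x = v x" if "x \<in> frontier \<Omega>" for x
    by (rule bdry_trace_eq[OF domain_open frontier_in_closure[OF that] m ht[OF that]])
  have "AE x in surface (frontier \<Omega>). v x = bdry_trace \<Omega> v x"
    using tr by (intro AE_I2) simp
  note eq = AE_boundary[OF this]
  have vm: "v \<in> borel_measurable (surface \<Gamma>)" for \<Gamma>
    using vc by (intro borel_measurable_surface borel_measurable_continuous_onI)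
  have mD: "bdry_trace \<Omega> v \<in> borel_measurable (surface \<Gamma>\<^sub>D)" and mN: "bdry_trace \<Omega> v \<in> borel_measurable (surface \<Gamma>\<^sub>N)"
    using complete_measure_measurable_AE[OF complete_measure_surface vm] eq by blast+
  have "compact (v ` closure \<Omega>)"
    using vc domain_bounded by (intro compact_continuous_image) (auto intro: continuous_on_subset)
  then obtain B where B: "\<And>y. y \<in> v ` closure \<Omega> \<Longrightarrow> norm y \<le> B"
    by (meson bounded_iff compact_imp_bounded)
  have "sq_integrable (surface \<Gamma>\<^sub>N) v"
    using B frontier_eq frontier_in_closure
    by (intro sq_integrable_bounded[OF finite_surface_N vm, of B]) auto
  then have "sq_integrable (surface \<Gamma>\<^sub>N) (bdry_trace \<Omega> v)"
    by (rule sq_integrable_AE_cong[OF _ mN eq(2)])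
  moreover have "bdry_trace \<Omega> v \<in> H_half \<Gamma>\<^sub>D"
  \<comment> \<open>The trivial combination 1 v + 0 v transfers membership along the
    almost-everywhere equality of v and its trace.\<close>
  proof (rule H_half_lincomb[where c = 1 and d = 0])
    show "AE x in surface \<Gamma>\<^sub>D. bdry_trace \<Omega> v x = 1 *\<^sub>R v x + 0 *\<^sub>R v x"
      using eq(1) by eventually_elim simp
  qed (use C1_vec_H_half[OF assms bounded_boundary(1)] mD in auto)
  moreover have "AE x in surface (frontier \<Omega>). \<exists>z. has_trace_at \<Omega> v x z"
    using ht by (intro AE_I2) auto
  ultimately show ?thesis using H1 by (simp add: finite_energy_def)
qed

lemma C1_vec_zero: "C1_vec (\<lambda>x. 0)"
  unfolding C1_vec_def by (rule exI[of _ "\<lambda>x. 0"]) (simp add: C1_grad_const)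

text \<open>The linear map T stands for \<open>strain\<close> and for \<open>trace\<close>, which
  gives both volume terms of \<open>form_a\<close> at once.\<close>

lemma weak_grad_linear_integral_lincomb:
  fixes T :: "real^2^2 \<Rightarrow> 'b::euclidean_space"
  assumes "linear T" "finite_energy u" "finite_energy v" "finite_energy w"
  shows "(\<integral>x. T (weak_grad \<Omega> w x) \<bullet> T (weak_grad \<Omega> (\<lambda>x. c *\<^sub>R u x + d *\<^sub>R v x) x) \<partial>lebesgue_on \<Omega>) =
    c * (\<integral>x. T (weak_grad \<Omega> w x) \<bullet> T (weak_grad \<Omega> u x) \<partial>lebesgue_on \<Omega>) +
    d * (\<integral>x. T (weak_grad \<Omega> w x) \<bullet> T (weak_grad \<Omega> v x) \<partial>lebesgue_on \<Omega>)"
proof (rule inner_integral_lincomb)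
  have sq: "sq_integrable (lebesgue_on \<Omega>) (\<lambda>x. T (weak_grad \<Omega> v x))" if "finite_energy v" for v
    using that by (intro sq_integrable_linear[OF assms(1)] H1D(2)) (simp add: finite_energy_def)
  show "sq_integrable (lebesgue_on \<Omega>) (\<lambda>x. T (weak_grad \<Omega> u x))"
    "sq_integrable (lebesgue_on \<Omega>) (\<lambda>x. T (weak_grad \<Omega> v x))"
    "sq_integrable (lebesgue_on \<Omega>) (\<lambda>x. T (weak_grad \<Omega> w x))"
    using assms by (auto intro: sq)
  show "(\<lambda>x. T (weak_grad \<Omega> (\<lambda>x. c *\<^sub>R u x + d *\<^sub>R v x) x)) \<in> borel_measurable (lebesgue_on \<Omega>)"
    using sq[OF finite_energy_lincomb[OF assms(2,3), of c d]] by (simp add: sq_integrable_def)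
  have "AE x in lebesgue_on \<Omega>. weak_grad \<Omega> (\<lambda>x. c *\<^sub>R u x + d *\<^sub>R v x) x =
      c *\<^sub>R weak_grad \<Omega> u x + d *\<^sub>R weak_grad \<Omega> v x"
    using assms(2,3) by (intro H1_lincomb(2)[OF domain_open domain_bounded]) (auto simp: finite_energy_def)
  then show "AE x in lebesgue_on \<Omega>. T (weak_grad \<Omega> (\<lambda>x. c *\<^sub>R u x + d *\<^sub>R v x) x) =
      c *\<^sub>R T (weak_grad \<Omega> u x) + d *\<^sub>R T (weak_grad \<Omega> v x)"
    by eventually_elim (simp add: linear_add[OF assms(1)] linear_cmul[OF assms(1)])
qed

lemma half_ip_trace_lincomb:
  assumes "finite_energy u" "finite_energy v" "g \<in> H_half \<Gamma>\<^sub>D"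
  shows "half_ip \<Gamma>\<^sub>D g (bdry_trace \<Omega> (\<lambda>x. c *\<^sub>R u x + d *\<^sub>R v x)) =
    c * half_ip \<Gamma>\<^sub>D g (bdry_trace \<Omega> u) + d * half_ip \<Gamma>\<^sub>D g (bdry_trace \<Omega> v)"
proof (rule half_ip_lincomb)
  show "bdry_trace \<Omega> (\<lambda>x. c *\<^sub>R u x + d *\<^sub>R v x) \<in> borel_measurable (surface \<Gamma>\<^sub>D)"
    by (rule finite_energy_trace_measurable(1)[OF finite_energy_lincomb[OF assms(1,2)]])
  have "AE x in surface (frontier \<Omega>). bdry_trace \<Omega> (\<lambda>x. c *\<^sub>R u x + d *\<^sub>R v x) x =
      c *\<^sub>R bdry_trace \<Omega> u x + d *\<^sub>R bdry_trace \<Omega> v x"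
    using bdry_trace_lincomb[OF assms(1,2), of c d] by eventually_elim blast
  then show "AE x in surface \<Gamma>\<^sub>D. bdry_trace \<Omega> (\<lambda>x. c *\<^sub>R u x + d *\<^sub>R v x) x =
      c *\<^sub>R bdry_trace \<Omega> u x + d *\<^sub>R bdry_trace \<Omega> v x"
    by (rule AE_boundary(1))
qed (use assms in \<open>auto simp: finite_energy_def\<close>)

lemma form_a_lincomb:
  assumes "finite_energy u" "finite_energy v" "finite_energy w"
  shows "form_a \<Omega> \<Gamma>\<^sub>D \<mu> lam \<gamma> w (\<lambda>x. c *\<^sub>R u x + d *\<^sub>R v x) =
    c * form_a \<Omega> \<Gamma>\<^sub>D \<mu> lam \<gamma> w u + d * form_a \<Omega> \<Gamma>\<^sub>D \<mu> lam \<gamma> w v"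
proof -
  have "bdry_trace \<Omega> w \<in> H_half \<Gamma>\<^sub>D" using assms(3) by (simp add: finite_energy_def)
  from half_ip_trace_lincomb[OF assms(1,2) this, of c d]
    weak_grad_linear_integral_lincomb[OF linear_strain assms, of c d]
    weak_grad_linear_integral_lincomb[OF linear_trace assms, of c d]
  show ?thesis unfolding form_a_def inner_real_def by (simp add: algebra_simps)
qed

lemma form_a_commute: "form_a \<Omega> \<Gamma>\<^sub>D \<mu> lam \<gamma> u v = form_a \<Omega> \<Gamma>\<^sub>D \<mu> lam \<gamma> v u"
  unfolding form_a_def half_ip_commute[of _ "bdry_trace \<Omega> u"]
  by (simp add: inner_commute mult.commute)

lemma form_a_quadratic:
  assumes "finite_energy u" "finite_energy v"
  shows "form_a \<Omega> \<Gamma>\<^sub>D \<mu> lam \<gamma> (\<lambda>x. u x + t *\<^sub>R v x) (\<lambda>x. u x + t *\<^sub>R v x) =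
    form_a \<Omega> \<Gamma>\<^sub>D \<mu> lam \<gamma> u u + 2 * t * form_a \<Omega> \<Gamma>\<^sub>D \<mu> lam \<gamma> u v + t\<^sup>2 * form_a \<Omega> \<Gamma>\<^sub>D \<mu> lam \<gamma> v v"
proof -
  let ?a = "form_a \<Omega> \<Gamma>\<^sub>D \<mu> lam \<gamma>" and ?w = "\<lambda>x. u x + t *\<^sub>R v x"
  have fw: "finite_energy ?w" using finite_energy_lincomb[OF assms, of 1 t] by simp
  have lin: "?a z ?w = ?a z u + t * ?a z v" if "finite_energy z" for z
    using form_a_lincomb[OF assms that, of \<mu> lam \<gamma> 1 t] by simp
  have "?a ?w ?w = ?a u ?w + t * ?a v ?w"
    using lin[OF fw] form_a_commute[of \<mu> lam \<gamma> ?w u] form_a_commute[of \<mu> lam \<gamma> ?w v] by simp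
  also have "\<dots> = ?a u u + t * ?a u v + t * (?a u v + t * ?a v v)"
    using lin[OF assms(1)] lin[OF assms(2)] form_a_commute[of \<mu> lam \<gamma> v u] by simp
  finally show ?thesis by (simp add: power2_eq_square algebra_simps)
qed

lemma form_f_lincomb:
  assumes "finite_energy u" "finite_energy v" "sq_integrable (lebesgue_on \<Omega>) f" "g\<^sub>D \<in> H_half \<Gamma>\<^sub>D"
    and "sq_integrable (surface \<Gamma>\<^sub>N) g\<^sub>N"
  shows "form_f \<Omega> \<Gamma>\<^sub>D \<Gamma>\<^sub>N \<gamma> f g\<^sub>D g\<^sub>N (\<lambda>x. c *\<^sub>R u x + d *\<^sub>R v x) =
    c * form_f \<Omega> \<Gamma>\<^sub>D \<Gamma>\<^sub>N \<gamma> f g\<^sub>D g\<^sub>N u + d * form_f \<Omega> \<Gamma>\<^sub>D \<Gamma>\<^sub>N \<gamma> f g\<^sub>D g\<^sub>N v"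
proof -
  have uv: "sq_integrable (lebesgue_on \<Omega>) u" "sq_integrable (lebesgue_on \<Omega>) v"
    using assms(1,2) H1D(1) by (auto simp: finite_energy_def)
  have "(\<integral>x. f x \<bullet> (c *\<^sub>R u x + d *\<^sub>R v x) \<partial>lebesgue_on \<Omega>) =
    c * (\<integral>x. f x \<bullet> u x \<partial>lebesgue_on \<Omega>) + d * (\<integral>x. f x \<bullet> v x \<partial>lebesgue_on \<Omega>)"
    using sq_integrable_lincomb[OF uv, of c d]
    by (intro inner_integral_lincomb[OF uv assms(3)]) (auto simp: sq_integrable_def)
  moreover have "(\<integral>x. g\<^sub>N x \<bullet> bdry_trace \<Omega> (\<lambda>x. c *\<^sub>R u x + d *\<^sub>R v x) x \<partial>surface \<Gamma>\<^sub>N) =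
    c * (\<integral>x. g\<^sub>N x \<bullet> bdry_trace \<Omega> u x \<partial>surface \<Gamma>\<^sub>N) + d * (\<integral>x. g\<^sub>N x \<bullet> bdry_trace \<Omega> v x \<partial>surface \<Gamma>\<^sub>N)"
  proof (rule inner_integral_lincomb)
    show "bdry_trace \<Omega> (\<lambda>x. c *\<^sub>R u x + d *\<^sub>R v x) \<in> borel_measurable (surface \<Gamma>\<^sub>N)"
      by (rule finite_energy_trace_measurable(2)[OF finite_energy_lincomb[OF assms(1,2)]])
    have "AE x in surface (frontier \<Omega>). bdry_trace \<Omega> (\<lambda>x. c *\<^sub>R u x + d *\<^sub>R v x) x =
        c *\<^sub>R bdry_trace \<Omega> u x + d *\<^sub>R bdry_trace \<Omega> v x"
      using bdry_trace_lincomb[OF assms(1,2), of c d] by eventually_elim blast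
    then show "AE x in surface \<Gamma>\<^sub>N. bdry_trace \<Omega> (\<lambda>x. c *\<^sub>R u x + d *\<^sub>R v x) x =
        c *\<^sub>R bdry_trace \<Omega> u x + d *\<^sub>R bdry_trace \<Omega> v x"
      by (rule AE_boundary(2))
  qed (use assms in \<open>auto simp: finite_energy_def\<close>)
  ultimately show ?thesis
    unfolding form_f_def half_ip_trace_lincomb[OF assms(1,2,4)] by (simp add: algebra_simps)
qed

lemma strain_energy_integrable:
  assumes "finite_energy v"
  shows "integrable (lebesgue_on \<Omega>) (\<lambda>x. strain (weak_grad \<Omega> v x) \<bullet> strain (weak_grad \<Omega> v x))"
    "integrable (lebesgue_on \<Omega>) (\<lambda>x. trace (weak_grad \<Omega> v x) * trace (weak_grad \<Omega> v x))"
proof -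
  have G: "sq_integrable (lebesgue_on \<Omega>) (weak_grad \<Omega> v)"
    using assms by (intro H1D(2)) (simp add: finite_energy_def)
  show "integrable (lebesgue_on \<Omega>) (\<lambda>x. strain (weak_grad \<Omega> v x) \<bullet> strain (weak_grad \<Omega> v x))"
    by (intro sq_integrable_inner sq_integrable_linear[OF linear_strain] G)
  show "integrable (lebesgue_on \<Omega>) (\<lambda>x. trace (weak_grad \<Omega> v x) * trace (weak_grad \<Omega> v x))"
    using sq_integrable_inner[OF sq_integrable_linear[OF linear_trace G] sq_integrable_linear[OF linear_trace G]]
    by simp
qed

text \<open>\<open>strain\<close> keeps the diagonal, and on it (x + y)^2 <= 2 (x^2 + y^2); the
  constant 2 is the dimension. This is what permits a negative \<open>lam\<close> down to
  -\<mu>.\<close>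

lemma trace_square_le: "(trace G)\<^sup>2 \<le> 2 * (strain G \<bullet> strain (G :: real^2^2))"
proof -
  have "strain G $ 1 $ 1 = G $ 1 $ 1" "strain G $ 2 $ 2 = G $ 2 $ 2"
    by (simp_all add: strain_def transpose_def)
  then have "strain G \<bullet> strain G = (G $ 1 $ 1)\<^sup>2 + (strain G $ 1 $ 2)\<^sup>2 + ((strain G $ 2 $ 1)\<^sup>2 + (G $ 2 $ 2)\<^sup>2)"
    by (simp add: inner_vec_def sum_2 power2_eq_square)
  moreover have "trace G = G $ 1 $ 1 + G $ 2 $ 2" by (simp add: trace_def sum_2)
  moreover have "(x + y)\<^sup>2 \<le> 2 * (x\<^sup>2 + a\<^sup>2 + (b\<^sup>2 + y\<^sup>2))" for x y a b :: real
  proof -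
    have "(x + y)\<^sup>2 \<le> 2 * (x\<^sup>2 + y\<^sup>2)"
      using zero_le_power2[of "x - y"] by (simp add: power2_sum power2_diff)
    also have "\<dots> \<le> 2 * (x\<^sup>2 + a\<^sup>2 + (b\<^sup>2 + y\<^sup>2))" by simp
    finally show ?thesis .
  qed
  ultimately show ?thesis by simp
qed

text \<open>The integrand of the volume part is pointwise at least (\<mu> + lam) times the squared
  divergence, and the boundary part is a nonnegative multiple of a square.\<close>

lemma form_a_nonneg:
  assumes "finite_energy v" "\<mu> > 0" "\<mu> + lam \<ge> 0" "\<gamma> \<ge> 0"
  shows "form_a \<Omega> \<Gamma>\<^sub>D \<mu> lam \<gamma> v v \<ge> 0"
proof -
  let ?e = "\<lambda>x. strain (weak_grad \<Omega> v x) \<bullet> strain (weak_grad \<Omega> v x)"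
  let ?t = "\<lambda>x. trace (weak_grad \<Omega> v x) * trace (weak_grad \<Omega> v x)"
  note i = strain_energy_integrable[OF assms(1)]
  have "0 \<le> 2 * \<mu> * ?e x + lam * ?t x" for x
  proof -
    have "\<mu> * ?t x \<le> 2 * \<mu> * ?e x"
      using mult_left_mono[OF trace_square_le[of "weak_grad \<Omega> v x"], of \<mu>] assms(2)
      by (simp add: power2_eq_square)
    moreover have "0 \<le> (\<mu> + lam) * ?t x" using assms(3) by simp
    ultimately show ?thesis by (simp add: distrib_right)
  qed
  then have "0 \<le> (\<integral>x. 2 * \<mu> * ?e x + lam * ?t x \<partial>lebesgue_on \<Omega>)"
    by (rule Bochner_Integration.integral_nonneg)
  also have "\<dots> = 2 * \<mu> * (\<integral>x. ?e x \<partial>lebesgue_on \<Omega>) + lam * (\<integral>x. ?t x \<partial>lebesgue_on \<Omega>)"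
    using i by simp
  finally show ?thesis
    unfolding form_a_def using half_ip_nonneg[of \<Gamma>\<^sub>D "bdry_trace \<Omega> v"] assms(4) by simp
qed

text \<open>Expanding the squared norm of trace minus datum produces the boundary parts of the two
  forms and a constant, which does not affect minimizers.\<close>

lemma energy_J_finite_energy:
  assumes "finite_energy v" "sq_integrable (lebesgue_on \<Omega>) f" "g\<^sub>D \<in> H_half \<Gamma>\<^sub>D"
  shows "energy_J \<Omega> \<Gamma>\<^sub>D \<Gamma>\<^sub>N \<mu> lam \<gamma> f g\<^sub>D g\<^sub>N v =
    ereal (1/2 * form_a \<Omega> \<Gamma>\<^sub>D \<mu> lam \<gamma> v v - form_f \<Omega> \<Gamma>\<^sub>D \<Gamma>\<^sub>N \<gamma> f g\<^sub>D g\<^sub>N v + \<gamma> / 2 * half_ip \<Gamma>\<^sub>D g\<^sub>D g\<^sub>D)"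
proof -
  let ?e = "\<lambda>x. strain (weak_grad \<Omega> v x) \<bullet> strain (weak_grad \<Omega> v x)"
  let ?t = "\<lambda>x. trace (weak_grad \<Omega> v x) * trace (weak_grad \<Omega> v x)"
  let ?tr = "bdry_trace \<Omega> v" and ?d = "\<lambda>x. bdry_trace \<Omega> v x - g\<^sub>D x"
  have tr: "?tr \<in> H_half \<Gamma>\<^sub>D" using assms(1) by (simp add: finite_energy_def)
  have dm: "?d \<in> borel_measurable (surface \<Gamma>\<^sub>D)"
    using tr assms(3) by (auto simp: H_half_def sq_integrable_def)
  have deq: "AE x in surface \<Gamma>\<^sub>D. ?d x = 1 *\<^sub>R ?tr x + (-1) *\<^sub>R g\<^sub>D x" by simp
  have d: "?d \<in> H_half \<Gamma>\<^sub>D" by (rule H_half_lincomb[OF tr assms(3) dm deq])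
  have "half_ip \<Gamma>\<^sub>D ?d ?d = half_ip \<Gamma>\<^sub>D ?tr ?tr - 2 * half_ip \<Gamma>\<^sub>D g\<^sub>D ?tr + half_ip \<Gamma>\<^sub>D g\<^sub>D g\<^sub>D"
    using half_ip_lincomb[OF tr assms(3) d dm deq] half_ip_lincomb[OF tr assms(3) tr dm deq]
      half_ip_lincomb[OF tr assms(3) assms(3) dm deq] half_ip_commute[of \<Gamma>\<^sub>D ?d ?tr]
      half_ip_commute[of \<Gamma>\<^sub>D ?d g\<^sub>D] half_ip_commute[of \<Gamma>\<^sub>D ?tr g\<^sub>D]
    by linarith
  then have b: "(half_norm \<Gamma>\<^sub>D ?d)\<^sup>2 = half_ip \<Gamma>\<^sub>D ?tr ?tr - 2 * half_ip \<Gamma>\<^sub>D g\<^sub>D ?tr + half_ip \<Gamma>\<^sub>D g\<^sub>D g\<^sub>D"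
    using half_ip_nonneg[of \<Gamma>\<^sub>D ?d] by (simp add: half_norm_def)
  have "(\<integral>x. 2 * \<mu> * (norm (strain (weak_grad \<Omega> v x)))\<^sup>2 + lam * \<bar>trace (weak_grad \<Omega> v x)\<bar>\<^sup>2 \<partial>lebesgue_on \<Omega>) =
    (\<integral>x. 2 * \<mu> * ?e x + lam * ?t x \<partial>lebesgue_on \<Omega>)"
    by (simp only: power2_norm_eq_inner power2_abs) (simp only: power2_eq_square)
  also have "\<dots> = 2 * \<mu> * (\<integral>x. ?e x \<partial>lebesgue_on \<Omega>) + lam * (\<integral>x. ?t x \<partial>lebesgue_on \<Omega>)"
    using strain_energy_integrable[OF assms(1)] by simp
  finally show ?thesis
    using assms(1) unfolding energy_J_def b form_a_def form_f_def finite_energy_def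
    by (simp add: algebra_simps)
qed

lemma energy_J_less_top:
  assumes "v \<in> H1 \<Omega>" "energy_J \<Omega> \<Gamma>\<^sub>D \<Gamma>\<^sub>N \<mu> lam \<gamma> f g\<^sub>D g\<^sub>N v < \<infinity>"
  shows "finite_energy v"
  using assms by (auto simp: energy_J_def finite_energy_def split: if_splits)

end

section \<open>The error estimate\<close>

text \<open>At t = - s B the linear term is - s B^2 and the quadratic one s^2 B^2 C, so a small s >
  0 with s C < 1 makes the sum negative unless B = 0.\<close>

lemma linear_coefficient_zero:
  fixes B C :: real
  assumes "\<And>t. 0 \<le> t * B + t\<^sup>2 * C" shows "B = 0"
proof (rule ccontr)
  assume "B \<noteq> 0"
  define s where "s = 1 / (1 + \<bar>C\<bar>)"
  have s: "s > 0" "s * C < 1"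
    by (auto simp: s_def divide_less_eq abs_if)
  have "0 \<le> - s * B * B + (- s * B)\<^sup>2 * C" using assms[of "- s * B"] by simp
  also have "\<dots> = - (s * B\<^sup>2 * (1 - s * C))" by (simp add: power2_eq_square algebra_simps)
  also have "\<dots> < 0" using s \<open>B \<noteq> 0\<close> by (simp add: zero_less_mult_iff)
  finally show False by simp
qed

text \<open>Cauchy-Schwarz and Minkowski for a semidefinite form, reduced to the numbers A = a(u,u),
  B = a(u,v) and C = a(v,v). The case C = 0 is separate, since the form may vanish at nonzero
  functions.\<close>

lemma sqrt_triangle:
  fixes A B C :: real
  assumes "\<And>t. 0 \<le> A + 2 * t * B + t\<^sup>2 * C"
  shows "\<bar>B\<bar> \<le> sqrt A * sqrt C" "sqrt (A - 2 * B + C) \<le> sqrt A + sqrt C"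
proof -
  have A: "A \<ge> 0" using assms[of 0] by simp
  have C: "C \<ge> 0"
  proof (rule ccontr)
    assume "\<not> C \<ge> 0"
    then have "((A + 1) / (- C)) * C = - (A + 1)" "(A + 1) / (- C) \<ge> 0"
      using A by (auto simp: field_simps divide_nonneg_neg)
    then have "(sqrt ((A + 1) / (- C)))\<^sup>2 * C = - (A + 1)" by simp
    \<comment> \<open>Adding the inequalities for t and - t removes B and leaves twice A - (A + 1),
      which is negative.\<close>
    with assms[of "sqrt ((A + 1) / (- C))"] assms[of "- sqrt ((A + 1) / (- C))"] A
    show False by simp
  qed
  have "B\<^sup>2 \<le> A * C"
  proof (cases "C = 0")
    case True
    have "B = 0"
    proof (rule ccontr)
      assume "B \<noteq> 0"
      \<comment> \<open>With C = 0 the expression is affine in t, and this t gives it the value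
        -1.\<close>
      then have "2 * (- (A + 1) / (2 * B)) * B = - (A + 1)" by simp
      then show False using assms[of "- (A + 1) / (2 * B)"] True by simp
    qed
    then show ?thesis using True by simp
  next
    case False
    \<comment> \<open>The quadratic is evaluated at its minimum point - B / C and multiplied by
      C.\<close>
    have "0 \<le> C * (A + 2 * (- B / C) * B + (- B / C)\<^sup>2 * C)"
      using assms[of "- B / C"] C by (intro mult_nonneg_nonneg)
    also have "\<dots> = A * C - B\<^sup>2" using False by (simp add: field_simps power2_eq_square)
    finally show ?thesis by simp
  qed
  then have "sqrt (B\<^sup>2) \<le> sqrt (A * C)" by (rule real_sqrt_le_mono)
  then show B: "\<bar>B\<bar> \<le> sqrt A * sqrt C" by (simp add: real_sqrt_mult)
  have "A - 2 * B + C \<le> (sqrt A + sqrt C)\<^sup>2"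
    using B A C by (simp add: power2_sum)
  then show "sqrt (A - 2 * B + C) \<le> sqrt A + sqrt C"
    using A C by (intro real_le_lsqrt) auto
qed

text \<open>The terms are moved across the inequality: b can be subtracted when it is finite, and c
  > 0 has the inverse 1/c. Infinite values of g need no separate treatment then.\<close>

lemma ennreal_le_add_mult_INF:
  fixes g :: "'a \<Rightarrow> ennreal"
  assumes "c > 0" "\<And>i. i \<in> I \<Longrightarrow> y \<le> b + ennreal c * g i"
  shows "y \<le> b + ennreal c * (INF i\<in>I. g i)"
proof (cases "b = top")
  case False
  have inv: "ennreal (1 / c) * (ennreal c * z) = z" "ennreal c * (ennreal (1 / c) * z) = z" for z
    using assms(1) by (simp_all add: mult.assoc[symmetric] flip: ennreal_mult)
  have "ennreal (1 / c) * (y - b) \<le> (INF i\<in>I. g i)"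
  proof (rule INF_greatest)
    fix i assume "i \<in> I"
    then have "y - b \<le> ennreal c * g i" using assms(2) False by (simp add: ennreal_minus_le_iff)
    then have "ennreal (1 / c) * (y - b) \<le> ennreal (1 / c) * (ennreal c * g i)" by (rule mult_left_mono) simp
    then show "ennreal (1 / c) * (y - b) \<le> g i" by (simp only: inv)
  qed
  then have "ennreal c * (ennreal (1 / c) * (y - b)) \<le> ennreal c * (INF i\<in>I. g i)" by (rule mult_left_mono) simp
  then show ?thesis using False by (simp add: inv ennreal_minus_le_iff)
qed simp

context elasticity_domain
begin

lemma energy_norm_diff_bounds:
  assumes "finite_energy u" "finite_energy v" "\<mu> > 0" "\<mu> + lam \<ge> 0" "\<gamma> \<ge> 0"
  shows "\<bar>form_a \<Omega> \<Gamma>\<^sub>D \<mu> lam \<gamma> u v\<bar> \<le> energy_norm \<Omega> \<Gamma>\<^sub>D \<mu> lam \<gamma> u * energy_norm \<Omega> \<Gamma>\<^sub>D \<mu> lam \<gamma> v"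
    "energy_norm \<Omega> \<Gamma>\<^sub>D \<mu> lam \<gamma> (\<lambda>x. u x - v x) \<le>
      energy_norm \<Omega> \<Gamma>\<^sub>D \<mu> lam \<gamma> u + energy_norm \<Omega> \<Gamma>\<^sub>D \<mu> lam \<gamma> v"
proof -
  let ?a = "form_a \<Omega> \<Gamma>\<^sub>D \<mu> lam \<gamma>"
  have expand: "?a (\<lambda>x. u x + t *\<^sub>R v x) (\<lambda>x. u x + t *\<^sub>R v x) = ?a u u + 2 * t * ?a u v + t\<^sup>2 * ?a v v" for t
    using form_a_quadratic[OF assms(1,2), of \<mu> lam \<gamma> t] .
  have "0 \<le> ?a u u + 2 * t * ?a u v + t\<^sup>2 * ?a v v" for t
    using form_a_nonneg[OF finite_energy_lincomb[OF assms(1,2), of 1 t] assms(3-5)]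
    by (simp add: expand)
  note * = sqrt_triangle[OF this]
  show "\<bar>?a u v\<bar> \<le> energy_norm \<Omega> \<Gamma>\<^sub>D \<mu> lam \<gamma> u * energy_norm \<Omega> \<Gamma>\<^sub>D \<mu> lam \<gamma> v"
    using *(1) by (simp add: energy_norm_def)
  show "energy_norm \<Omega> \<Gamma>\<^sub>D \<mu> lam \<gamma> (\<lambda>x. u x - v x) \<le>
      energy_norm \<Omega> \<Gamma>\<^sub>D \<mu> lam \<gamma> u + energy_norm \<Omega> \<Gamma>\<^sub>D \<mu> lam \<gamma> v"
    using *(2) expand[of "-1"] by (simp add: energy_norm_def)
qed

text \<open>The zero function has finite energy, so the minimizer has it too. Then u + t w is a
  competitor for every real t, and the energy changes by t (a(u,w) - f(w)) + t^2 a(w,w)/2, whose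
  linear coefficient must vanish.\<close>

lemma minimizer_variational_equation:
  assumes data: "sq_integrable (lebesgue_on \<Omega>) f" "g\<^sub>D \<in> H_half \<Gamma>\<^sub>D" "sq_integrable (surface \<Gamma>\<^sub>N) g\<^sub>N"
    and min: "is_arg_min (energy_J \<Omega> \<Gamma>\<^sub>D \<Gamma>\<^sub>N \<mu> lam \<gamma> f g\<^sub>D g\<^sub>N) (\<lambda>v. v \<in> H1 \<Omega>) u"
  shows "finite_energy u"
    and "finite_energy w \<Longrightarrow> form_a \<Omega> \<Gamma>\<^sub>D \<mu> lam \<gamma> u w = form_f \<Omega> \<Gamma>\<^sub>D \<Gamma>\<^sub>N \<gamma> f g\<^sub>D g\<^sub>N w"
proof -
  let ?J = "energy_J \<Omega> \<Gamma>\<^sub>D \<Gamma>\<^sub>N \<mu> lam \<gamma> f g\<^sub>D g\<^sub>N"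
  let ?a = "form_a \<Omega> \<Gamma>\<^sub>D \<mu> lam \<gamma>" and ?F = "form_f \<Omega> \<Gamma>\<^sub>D \<Gamma>\<^sub>N \<gamma> f g\<^sub>D g\<^sub>N"
  have le: "?J u \<le> ?J v" if "finite_energy v" for v
    using min that unfolding is_arg_min_def finite_energy_def by (meson not_le)
  note J = energy_J_finite_energy[OF _ data(1,2)]
  have "?J u \<le> ?J (\<lambda>x. 0)" by (intro le C1_vec_finite_energy C1_vec_zero)
  also have "\<dots> < \<infinity>" by (simp add: J C1_vec_finite_energy C1_vec_zero)
  finally show u: "finite_energy u"
    using min by (intro energy_J_less_top) (auto simp: is_arg_min_def)
  assume w: "finite_energy w"
  have "0 \<le> t * (?a u w - ?F w) + t\<^sup>2 * (?a w w / 2)" for t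
  proof -
    have v: "finite_energy (\<lambda>x. u x + t *\<^sub>R w x)" using finite_energy_lincomb[OF u w, of 1 t] by simp
    have "?F (\<lambda>x. u x + t *\<^sub>R w x) = ?F u + t * ?F w"
      using form_f_lincomb[OF u w data, of \<gamma> 1 t] by simp
    then show ?thesis
      using le[OF v] form_a_quadratic[OF u w, of \<mu> lam \<gamma> t]
      by (simp add: J[OF u] J[OF v] algebra_simps)
  qed
  from linear_coefficient_zero[OF this] show "?a u w = ?F w" by simp
qed

end

theorem theorem2:
  fixes \<Omega> \<Gamma>\<^sub>D \<Gamma>\<^sub>N :: "(real^2) set" and P :: "nat \<Rightarrow> (real^2) set" and K :: nat
    and \<T> :: "(real^2) set set"
    and \<mu> lam \<gamma> \<gamma>\<^sub>D \<beta> :: real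
    and f g\<^sub>D g\<^sub>N u u\<^sub>T :: "real^2 \<Rightarrow> real^2"
    and \<tau> :: "real \<Rightarrow> real" and l :: nat and n :: "nat \<Rightarrow> nat"
  defines "a \<equiv> form_a \<Omega> \<Gamma>\<^sub>D \<mu> lam \<gamma>"
    and "F \<equiv> form_f \<Omega> \<Gamma>\<^sub>D \<Gamma>\<^sub>N \<gamma> f g\<^sub>D g\<^sub>N"
    and "J \<equiv> energy_J \<Omega> \<Gamma>\<^sub>D \<Gamma>\<^sub>N \<mu> lam \<gamma> f g\<^sub>D g\<^sub>N"
    and "a\<^sub>T \<equiv> form_aT \<Gamma>\<^sub>D P K \<mu> lam \<gamma>\<^sub>D \<T>"
    and "F\<^sub>T \<equiv> form_fT \<Gamma>\<^sub>D \<Gamma>\<^sub>N P K \<mu> \<gamma>\<^sub>D \<T> f g\<^sub>D g\<^sub>N"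
    and "J\<^sub>T \<equiv> energy_JT \<Gamma>\<^sub>D \<Gamma>\<^sub>N P K \<mu> lam \<gamma>\<^sub>D \<T> f g\<^sub>D g\<^sub>N"
    and "enorm \<equiv> energy_norm \<Omega> \<Gamma>\<^sub>D \<mu> lam \<gamma>"
    and "M\<^sub>N \<equiv> networks \<tau> n l"
    and "M\<^sub>2\<^sub>N \<equiv> networks \<tau> (double_hidden l n) l"
  assumes domain: "lipschitz_domain \<Omega>"
    and boundary: "frontier \<Omega> = \<Gamma>\<^sub>D \<union> \<Gamma>\<^sub>N" "\<Gamma>\<^sub>D \<inter> \<Gamma>\<^sub>N = {}"
    and pieces: "\<Gamma>\<^sub>D = (\<Union>k\<in>{1..K}. P k)" "disjoint_family_on P {1..K}"
      "\<And>k. k \<in> {1..K} \<Longrightarrow> P k \<in> sets borel"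
    and lame: "\<mu> > 0" "\<mu> + lam \<ge> 0"
    and penalty: "\<gamma> = \<mu> * \<gamma>\<^sub>D" "\<gamma>\<^sub>D > 0"
    and data: "sq_integrable (lebesgue_on \<Omega>) f" "g\<^sub>D \<in> H_half \<Gamma>\<^sub>D" "sq_integrable (surface \<Gamma>\<^sub>N) g\<^sub>N"
    and activation: "\<not> linear \<tau>" "\<tau> C1_differentiable_on UNIV"
    and layers: "l \<ge> 1" "n 0 = 2" "n l = 2"
    and partition: "is_partition \<Omega> \<T>"
    and coercive: "\<beta> > 0" "\<And>m v. m \<in> {n, double_hidden l n} \<Longrightarrow> v \<in> networks \<tau> m l \<Longrightarrow>
      \<beta> * (enorm v)\<^sup>2 \<le> a\<^sub>T v v"
    and exact: "is_arg_min J (\<lambda>v. v \<in> H1 \<Omega>) u"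
    and discrete: "is_arg_min J\<^sub>T (\<lambda>v. v \<in> M\<^sub>N) u\<^sub>T"
  shows "ennreal (enorm (\<lambda>x. u x - u\<^sub>T x)) \<le>
    ennreal (2 / \<beta>) * sup_quot enorm M\<^sub>2\<^sub>N (\<lambda>w. F w - F\<^sub>T w) +
    ennreal ((2 + \<beta>) / \<beta>) *
      (INF v\<in>M\<^sub>N. ennreal (enorm (\<lambda>x. u x - v x)) + sup_quot enorm M\<^sub>2\<^sub>N (\<lambda>w. a v w - a\<^sub>T v w))"
proof -
  have DB: "\<Gamma>\<^sub>D \<in> sets borel" unfolding pieces(1) using pieces(3) by (intro sets.finite_UN) auto
  \<comment> \<open>Only the Dirichlet pieces are assumed Borel; the rest of the closed frontier is
    then Borel as well.\<close>
  have "\<Gamma>\<^sub>N = frontier \<Omega> - \<Gamma>\<^sub>D" using boundary by auto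
  then have NB: "\<Gamma>\<^sub>N \<in> sets borel" using DB by (auto intro!: sets.Diff borel_closed frontier_closed)
  interpret elasticity_domain \<Omega> \<Gamma>\<^sub>D \<Gamma>\<^sub>N
    by unfold_locales (use domain boundary(1) DB NB in auto)
  have \<gamma>: "\<gamma> \<ge> 0" using penalty lame(1) by simp
  note \<beta> = coercive(1)
  note bounds = energy_norm_diff_bounds[OF _ _ lame \<gamma>, folded a_def enorm_def]
  note exact' = exact[unfolded J_def]
  have fu: "finite_energy u" by (rule minimizer_variational_equation(1)[OF data exact'])
  have EL: "a u w = F w" if "finite_energy w" for w
    using minimizer_variational_equation(2)[OF data exact' that] by (simp add: a_def F_def)
  have C1: "C1_vec v" if "v \<in> networks \<tau> m l" for v m
    by (rule C1_vec_network[OF activation(2) that])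
  have fe: "finite_energy v" if "v \<in> networks \<tau> m l" for v m
    by (rule C1_vec_finite_energy[OF C1[OF that]])
  have nonneg: "0 \<le> enorm v" if "finite_energy v" for v
    using form_a_nonneg[OF that lame \<gamma>] by (simp add: enorm_def energy_norm_def)
  have diff: "finite_energy (\<lambda>x. v x - w x)" if "finite_energy v" "finite_energy w" for v w
    using finite_energy_lincomb[OF that, of 1 "-1"] by simp
  have uT: "u\<^sub>T \<in> M\<^sub>N" using discrete by (simp add: is_arg_min_def)
  \<comment> \<open>The bound is proved for each fixed v, and the infimum is taken at the very
    end.\<close>
  have key: "ennreal (enorm (\<lambda>x. u x - u\<^sub>T x)) \<le>
    ennreal (2 / \<beta>) * sup_quot enorm M\<^sub>2\<^sub>N (\<lambda>w. F w - F\<^sub>T w) +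
    ennreal ((2 + \<beta>) / \<beta>) *
      (ennreal (enorm (\<lambda>x. u x - v x)) + sup_quot enorm M\<^sub>2\<^sub>N (\<lambda>w. a v w - a\<^sub>T v w))"
    if v: "v \<in> M\<^sub>N" for v
  proof -
    let ?w = "\<lambda>x. u\<^sub>T x - v x"
    define e where "e = enorm (\<lambda>x. u x - v x)"
    define N where "N = enorm ?w"
    define SF where "SF = sup_quot enorm M\<^sub>2\<^sub>N (\<lambda>w. F w - F\<^sub>T w)"
    define Sa where "Sa = sup_quot enorm M\<^sub>2\<^sub>N (\<lambda>w. a v w - a\<^sub>T v w)"
    have w: "?w \<in> M\<^sub>2\<^sub>N" using network_diff[OF layers(1)] uT v by (simp add: M\<^sub>N_def M\<^sub>2\<^sub>N_def)
    have fv: "finite_energy v" and fuT: "finite_energy u\<^sub>T" and fw: "finite_energy ?w"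
      using fe v uT w by (auto simp: M\<^sub>N_def M\<^sub>2\<^sub>N_def)
    have Cv: "C1_vec v" and CuT: "C1_vec u\<^sub>T" using C1 v uT by (auto simp: M\<^sub>N_def)
    have e0: "0 \<le> e" unfolding e_def by (intro nonneg diff fu fv)
    have N0: "0 \<le> N" unfolding N_def by (intro nonneg fw)
    have tri: "enorm (\<lambda>x. u x - u\<^sub>T x) \<le> e + N"
      using bounds(2)[OF diff[OF fu fv] fw] by (simp add: e_def N_def)
    have "ennreal N \<le> ennreal (2 / \<beta>) * (SF + ennreal e + Sa)"
    \<comment> \<open>\<open>sup_quot\<close> leaves out functions of zero norm, so w is a candidate
      in the suprema only if N > 0; for N = 0 the bound on N is trivial.\<close>
    proof (cases "N = 0")
      case False
      with N0 have Npos: "N > 0" by simp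
      have lin: "a\<^sub>T z ?w = a\<^sub>T z u\<^sub>T - a\<^sub>T z v" "F\<^sub>T ?w = F\<^sub>T u\<^sub>T - F\<^sub>T v" for z
        using form_aT_lincomb[OF CuT Cv, of \<Gamma>\<^sub>D P K \<mu> lam \<gamma>\<^sub>D \<T> z 1 "-1"]
          form_fT_lincomb[OF CuT Cv, of \<Gamma>\<^sub>D \<Gamma>\<^sub>N P K \<mu> \<gamma>\<^sub>D \<T> f g\<^sub>D g\<^sub>N 1 "-1"]
        by (simp_all add: a\<^sub>T_def F\<^sub>T_def)
      have sym: "a\<^sub>T x y = a\<^sub>T y x" for x y unfolding a\<^sub>T_def by (rule form_aT_commute)
      have "J\<^sub>T u\<^sub>T \<le> J\<^sub>T v" using discrete v by (auto simp: is_arg_min_def not_less)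
      then have "a\<^sub>T ?w ?w / 2 \<le> F\<^sub>T ?w - a\<^sub>T v ?w"
        using lin(1)[of ?w] lin(1)[of u\<^sub>T] lin(1)[of v] lin(2) sym[of ?w u\<^sub>T] sym[of ?w v] sym[of u\<^sub>T v]
        unfolding J\<^sub>T_def energy_JT_def a\<^sub>T_def[symmetric] F\<^sub>T_def[symmetric] by argo
      moreover have "\<beta> * N\<^sup>2 \<le> a\<^sub>T ?w ?w"
        unfolding N_def using coercive(2)[of "double_hidden l n" ?w] w by (simp add: M\<^sub>2\<^sub>N_def)
      moreover have "a (\<lambda>x. u x - v x) ?w = a u ?w - a v ?w"
        using form_a_lincomb[OF fu fv fw, of \<mu> lam \<gamma> 1 "-1"]
        by (simp add: a_def form_a_commute[of _ _ _ ?w])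
      moreover have "\<bar>a (\<lambda>x. u x - v x) ?w\<bar> \<le> e * N"
        unfolding e_def N_def by (rule bounds(1)[OF diff[OF fu fv] fw])
      ultimately have "\<beta> / 2 * N\<^sup>2 \<le> \<bar>F ?w - F\<^sub>T ?w\<bar> + e * N + \<bar>a v ?w - a\<^sub>T v ?w\<bar>"
        using EL[OF fw] by linarith
      \<comment> \<open>Dividing by \<beta> N / 2 cancels one power of N, which produces the
        quotients of the suprema and leaves e bare.\<close>
      then have "N \<le> 2 / \<beta> * (\<bar>F ?w - F\<^sub>T ?w\<bar> / N + e + \<bar>a v ?w - a\<^sub>T v ?w\<bar> / N)"
        using Npos \<beta> by (simp add: field_simps power2_eq_square)
      then have "ennreal N \<le> ennreal (2 / \<beta> * (\<bar>F ?w - F\<^sub>T ?w\<bar> / N + e + \<bar>a v ?w - a\<^sub>T v ?w\<bar> / N))"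
        by (rule ennreal_leI)
      also have "\<dots> = ennreal (2 / \<beta>) * (ennreal (\<bar>F ?w - F\<^sub>T ?w\<bar> / N) + ennreal e + ennreal (\<bar>a v ?w - a\<^sub>T v ?w\<bar> / N))"
      proof -
        have "ennreal (c * (p + e + q)) = ennreal c * (ennreal p + ennreal e + ennreal q)"
          if "c \<ge> 0" "p \<ge> 0" "q \<ge> 0" for c p q :: real
          using that e0 by (simp add: ennreal_mult ennreal_plus)
        then show ?thesis using Npos \<beta> by (simp del: times_divide_eq_left)
      qed
      also have "\<dots> \<le> ennreal (2 / \<beta>) * (SF + ennreal e + Sa)"
      proof (intro mult_left_mono add_mono order_refl)
        have w': "?w \<in> {w \<in> M\<^sub>2\<^sub>N. enorm w \<noteq> 0}" using w Npos by (simp add: N_def)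
        show "ennreal (\<bar>F ?w - F\<^sub>T ?w\<bar> / N) \<le> SF"
          unfolding SF_def sup_quot_def N_def using w' by (rule SUP_upper)
        show "ennreal (\<bar>a v ?w - a\<^sub>T v ?w\<bar> / N) \<le> Sa"
          unfolding Sa_def sup_quot_def N_def using w' by (rule SUP_upper)
      qed simp
      finally show ?thesis .
    qed simp
    then have "ennreal (e + N) \<le> ennreal e + ennreal (2 / \<beta>) * (SF + ennreal e + Sa)"
      using e0 N0 by (simp add: ennreal_plus)
    also have "\<dots> = ennreal (2 / \<beta>) * SF + ((1 + ennreal (2 / \<beta>)) * ennreal e + ennreal (2 / \<beta>) * Sa)"
      by (simp add: distrib_left distrib_right ac_simps)
    \<comment> \<open>So far \<open>Sa\<close> has the coefficient 2/\<beta>; it is raised to 1 +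
      2/\<beta> so that e and \<open>Sa\<close> share one factor and the infimum can be taken of
      their sum.\<close>
    also have "\<dots> \<le> ennreal (2 / \<beta>) * SF + ((1 + ennreal (2 / \<beta>)) * ennreal e + (1 + ennreal (2 / \<beta>)) * Sa)"
      by (intro add_mono order_refl mult_right_mono) simp_all
    also have "1 + ennreal (2 / \<beta>) = ennreal ((2 + \<beta>) / \<beta>)"
      using \<beta> by (simp add: add_divide_distrib add.commute flip: ennreal_1 ennreal_plus)
    finally have "ennreal (e + N) \<le> ennreal (2 / \<beta>) * SF + ennreal ((2 + \<beta>) / \<beta>) * (ennreal e + Sa)"
      by (simp add: distrib_left)
    with ennreal_leI[OF tri] show ?thesis unfolding SF_def Sa_def e_def by (rule order_trans)
  qed
  show ?thesis by (rule ennreal_le_add_mult_INF[OF _ key]) (use \<beta> in auto)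
qed

end
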